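(* Let $\sigma\in(0,1)$, $\beta>0$, $c>0$, $r>0$, let $\Theta\sim\mathrm{SBSP}(\beta,\sigma,c)$, and let $Z_1,Z_2,\dots\mid\Theta$ be i.i.d. $\mathrm{NBP}(\Theta,r)$. Let $D_0,D_1\ge1$ be integers, let $0<N_{D_0}<\infty$ be the number of distinct units observed in $Z_{1:D_0}=(Z_1,\dots,Z_{D_0})$, indexed $n=1,\dots,N_{D_0}$, with total counts $m_{D_0,n}=\sum_{d=1}^{D_0}A_{d,n}$, and define $$S_{D_0}^{(D_1)}=\sum_{d=1}^{D_1}\sum_{n=1}^{N_{D_0}}A_{D_0+d,n}.$$ Then $$S_{D_0}^{(D_1)}\mid Z_{1:D_0}\ \overset{d}{=}\ \sum_{n=1}^{N_{D_0}}X_n,\qquad X_n\mid J_n\sim\mathrm{NegBin}(rD_1,J_n),\qquad J_n\sim\mathrm{Beta}(m_{D_0,n}-\sigma,\ rD_0+1),$$ where the pairs $(J_n,X_n)$, $n=1,\dots,N_{D_0}$, are independent.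
   Context: Conventions. $\mathrm{NegBin}(a,p)$, for $a>0$ and $p\in(0,1)$, has mass function $x\mapsto\binom{x+a-1}{x}p^x(1-p)^a$ on $\{0,1,2,\dots\}$. The prior $\mathrm{SBSP}(\beta,\sigma,c)$ (stable-beta scaled process). Let $\rho(s)=\sigma s^{-1-\sigma}\mathbf 1(s>0)$ and let $\Delta_0>\Delta_1>\cdots$ be the points, in decreasing order, of a Poisson point process on $\mathbb R_+$ with intensity $\rho(s)\,ds$. The density of $\Delta_0$ is $f_{\Delta_0}(s)=\sigma s^{-1-\sigma}e^{-s^{-\sigma}}\mathbf 1(s>0)$. Let $G_t$ be the conditional joint law of $(\Delta_n/\Delta_0)_{n\ge1}$ given $\Delta_0=t$. Let $h_{c,\beta}(s)=\frac{\beta^{c+1}}{\Gamma(c+1)}s^{-c\sigma}\exp\{-(\beta-1)s^{-\sigma}\}$. Let $\Delta_{0,h}$ have density $h_{c,\beta}(s)f_{\Delta_0}(s)$ and, given $\Delta_{0,h}=t$, let $(\theta_n)_{n\ge1}\sim G_t$. Let $\omega_1,\omega_2,\dots$ be i.i.d. from the uniform distribution $P_0$ on $\Omega=[0,1]$, independent of $(\Delta_{0,h},(\theta_n))$. Then $\Theta=\sum_{n\ge1}\theta_n\delta_{\omega_n}\sim\mathrm{SBSP}(\beta,\sigma,c)$. The likelihood. Given $\Theta=\sum_n\theta_n\delta_{\omega_n}$, $Z_d\sim\mathrm{NBP}(\Theta,r)$ means $Z_d=\sum_{n\ge1}A_{d,n}\delta_{\omega_n}$ with $A_{d,n}\sim\mathrm{NegBin}(r,\theta_n)$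 independently across $n$. A unit is observed in $Z_{1:D_0}$ if it has a positive count on at least one of the days $1,\dots,D_0$. Observed units are re-indexed $n=1,\dots,N_{D_0}$ with labels $W_n^\star\in\Omega$, so that for such $n$, $A_{d,n}=Z_d(\{W_n^\star\})$ for every day $d$. *)

theory Defs
  imports "HOL-Probability.Probability"
begin

section \<open>Distributions on the line\<close>

text \<open>
  The distribution \<open>NegBin(a,p)\<close> is only meant for \<open>a > 0\<close> and \<open>0 < p < 1\<close>. Outside this range it
  is the point mass at \<open>0\<close>, so that \<open>neg_binomial a\<close> is a probability kernel on all of \<open>\<real>\<close> and may be
  applied to random parameters that lie in \<open>(0,1)\<close> only almost surely.
\<close>

definition neg_binomial :: "real \<Rightarrow> real \<Rightarrow> nat measure" where
  "neg_binomial a p =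
     (if 0 < a \<and> 0 < p \<and> p < 1
      then density (count_space UNIV)
             (\<lambda>x. ennreal (((real x + a - 1) gchoose x) * p ^ x * (1 - p) powr a))
      else return (count_space UNIV) 0)"

lemma sets_neg_binomial [simp, measurable_cong]: "sets (neg_binomial a p) = sets (count_space UNIV)"
  by (simp add: neg_binomial_def)

lemma prob_space_neg_binomial: "prob_space (neg_binomial a p)"
proof (cases "0 < a \<and> 0 < p \<and> p < 1")
  case True
  then have a: "0 < a" and p: "0 < p" "p < 1" by auto
  have c: "((real x + a - 1) gchoose x) = (-1) ^ x * ((- a) gchoose x)" for x
    by (simp add: gbinomial_minus flip: power_mult_distrib) (simp add: algebra_simps)
  have nonneg: "0 \<le> ((real x + a - 1) gchoose x)" for x
    using a by (auto simp: gbinomial_prod_rev intro!: divide_nonneg_nonneg prod_nonneg)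
  have "(\<lambda>x. ((- a) gchoose x) * (- p) ^ x) sums (1 + (- p)) powr (- a)"
    using p by (intro gen_binomial_real) auto
  then have "(\<lambda>x. ((real x + a - 1) gchoose x) * p ^ x) sums (1 - p) powr (- a)"
    by (simp add: c power_minus[of p] mult_ac)
  then have "(\<lambda>x. ((real x + a - 1) gchoose x) * p ^ x * (1 - p) powr a)
               sums ((1 - p) powr (- a) * (1 - p) powr a)"
    by (rule sums_mult2)
  also have "(1 - p) powr (- a) * (1 - p) powr a = 1"
    using p by (simp flip: powr_add)
  finally have s: "(\<lambda>x. ((real x + a - 1) gchoose x) * p ^ x * (1 - p) powr a) sums 1" .
  have "(\<Sum>x. ennreal (((real x + a - 1) gchoose x) * p ^ x * (1 - p) powr a)) = ennreal 1"
    using s nonneg p by (intro suminf_ennreal_eq) auto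
  then show ?thesis
    using True
    by (intro prob_spaceI)
      (simp add: neg_binomial_def emeasure_density nn_integral_count_space_nat)
next
  case False
  then show ?thesis
    unfolding neg_binomial_def by (simp only: if_False) (intro prob_space_return, simp)
qed

definition beta_distribution :: "real \<Rightarrow> real \<Rightarrow> real measure" where
  "beta_distribution a b =
     density lborel
       (\<lambda>x. ennreal (indicator {0<..<1} x * x powr (a - 1) * (1 - x) powr (b - 1) / Beta a b))"


section \<open>Regular conditional distributions\<close>

text \<open>
  The kernel \<open>K\<close> from \<open>N\<close> to \<open>L\<close> is a regular version of the conditional distribution of \<open>Y\<close> given
  \<open>X\<close>, for \<open>X\<close> with values in \<open>N\<close> and \<open>Y\<close> with values in \<open>L\<close>.
\<close>

definition is_cond_distr ::
  "'a measure \<Rightarrow> ('a \<Rightarrow> 'b) \<Rightarrow> 'b measure \<Rightarrow> ('a \<Rightarrow> 'c) \<Rightarrow> 'c measure \<Rightarrow> ('b \<Rightarrow> 'c measure) \<Rightarrow> bool"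
where
  "is_cond_distr M X N Y L K \<longleftrightarrow>
     X \<in> measurable M N \<and> Y \<in> measurable M L \<and> K \<in> measurable N (prob_algebra L) \<and>
     (\<forall>A\<in>sets N. \<forall>B\<in>sets L.
        emeasure M {w \<in> space M. X w \<in> A \<and> Y w \<in> B} = (\<integral>\<^sup>+x\<in>A. emeasure (K x) B \<partial>distr M N X))"


section \<open>Random measures\<close>

text \<open>The purely atomic measure \<open>\<Sum>n. a n * \<delta>(x n)\<close> on the measurable space \<open>N\<close>.\<close>

definition atomic_measure :: "'a measure \<Rightarrow> (nat \<Rightarrow> ennreal) \<Rightarrow> (nat \<Rightarrow> 'a) \<Rightarrow> 'a measure" where
  "atomic_measure N a x = distr (density (count_space UNIV) a) N x"

lemma sets_atomic_measure [simp, measurable_cong]: "sets (atomic_measure N a x) = sets N"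
  by (simp add: atomic_measure_def)

lemma emeasure_atomic_measure:
  assumes "\<And>n. x n \<in> space N" and "B \<in> sets N"
  shows "emeasure (atomic_measure N a x) B = (\<Sum>n. a n * indicator B (x n))"
proof -
  have "emeasure (atomic_measure N a x) B = (\<integral>\<^sup>+n. a n * indicator (x -` B) n \<partial>count_space UNIV)"
    using assms by (simp add: atomic_measure_def emeasure_distr emeasure_density)
  then show ?thesis
    by (simp add: nn_integral_count_space_nat indicator_def)
qed

text \<open>
  The measurable space of all measures on \<open>K\<close>, generated by the evaluations at measurable sets; this
  is \<open>subprob_algebra\<close> without the bound on the total mass.
\<close>

definition measure_algebra :: "'a measure \<Rightarrow> 'a measure measure" where
  "measure_algebra K =
     (SUP A\<in>sets K. vimage_algebra {M. sets M = sets K} (\<lambda>M. emeasure M A) borel)"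

text \<open>A Poisson random measure \<open>\<Phi>\<close> with intensity measure \<open>\<mu>\<close>.\<close>

definition poisson_random_measure :: "'a measure \<Rightarrow> 'b measure \<Rightarrow> ('a \<Rightarrow> 'b measure) \<Rightarrow> bool" where
  "poisson_random_measure Q \<mu> \<Phi> \<longleftrightarrow>
     \<Phi> \<in> measurable Q (measure_algebra \<mu>) \<and>
     (\<forall>B\<in>sets \<mu>. emeasure \<mu> B < \<infinity> \<longrightarrow>
        (\<forall>k::nat. measure Q {v \<in> space Q. emeasure (\<Phi> v) B = of_nat k} =
                  measure \<mu> B ^ k / fact k * exp (- measure \<mu> B))) \<and>
     (\<forall>B\<in>sets \<mu>. emeasure \<mu> B = \<infinity> \<longrightarrow> (AE v in Q. emeasure (\<Phi> v) B = \<infinity>)) \<and>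
     (\<forall>B :: nat \<Rightarrow> 'b set. range B \<subseteq> sets \<mu> \<longrightarrow> disjoint_family B \<longrightarrow>
        prob_space.indep_vars Q (\<lambda>_. borel) (\<lambda>i v. emeasure (\<Phi> v) (B i)) UNIV)"


section \<open>The stable-beta scaled process\<close>

definition stable_intensity :: "real \<Rightarrow> real measure" where
  "stable_intensity \<sigma> = density lborel (\<lambda>s. ennreal (indicator {0<..} s * \<sigma> * s powr (- 1 - \<sigma>)))"

text \<open>
  \<open>G\<close> is a version of \<open>t \<mapsto> G\<^sub>t\<close>, the conditional law of the ratios \<open>\<Delta>\<^sub>n/\<Delta>\<^sub>0\<close> (\<open>n \<ge> 1\<close>) given
  \<open>\<Delta>\<^sub>0 = t\<close>, where \<open>\<Delta>\<^sub>0 > \<Delta>\<^sub>1 > \<dots>\<close> are the ordered points of the Poisson process. It is unique up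
  to null sets of the law of \<open>\<Delta>\<^sub>0\<close>, and does not depend on the space carrying the points; the type of
  \<open>Q\<close> is just large enough for such points to exist. The ratio with index \<open>n \<ge> 1\<close> is the component
  \<open>n - 1\<close> of the sequence.
\<close>

definition scaled_jump_kernel :: "real \<Rightarrow> (real \<Rightarrow> (nat \<Rightarrow> real) measure) \<Rightarrow> bool" where
  "scaled_jump_kernel \<sigma> G \<longleftrightarrow>
     (\<exists>(Q :: (nat \<Rightarrow> real) measure) (\<Delta> :: nat \<Rightarrow> (nat \<Rightarrow> real) \<Rightarrow> real).
        prob_space Q \<and> (\<forall>n. \<Delta> n \<in> borel_measurable Q) \<and>
        poisson_random_measure Q (stable_intensity \<sigma>)
          (\<lambda>v. atomic_measure borel (\<lambda>_. 1) (\<lambda>n. \<Delta> n v)) \<and>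
        (AE v in Q. \<forall>n. 0 < \<Delta> (Suc n) v \<and> \<Delta> (Suc n) v < \<Delta> n v) \<and>
        is_cond_distr Q (\<Delta> 0) borel (\<lambda>v n. \<Delta> (Suc n) v / \<Delta> 0 v) (PiM UNIV (\<lambda>_. borel)) G)"

definition largest_jump_density :: "real \<Rightarrow> real \<Rightarrow> real" where
  "largest_jump_density \<sigma> s =
     indicator {0<..} s * \<sigma> * s powr (- 1 - \<sigma>) * exp (- (s powr (- \<sigma>)))"

definition tilting :: "real \<Rightarrow> real \<Rightarrow> real \<Rightarrow> real \<Rightarrow> real" where
  "tilting c \<beta> \<sigma> s =
     \<beta> powr (c + 1) / Gamma (c + 1) * s powr (- c * \<sigma>) * exp (- (\<beta> - 1) * s powr (- \<sigma>))"

text \<open>The label space \<open>\<Omega> = [0,1]\<close> together with the uniform distribution \<open>P\<^sub>0\<close>.\<close>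

definition P0 :: "real measure" where
  "P0 = restrict_space lborel {0..1}"

text \<open>
  \<open>\<Theta> = \<Sum>n. \<theta>\<^sub>n \<delta>(\<omega>\<^sub>n)\<close> is a stable-beta scaled process on the probability space \<open>M\<close>, with jumps \<open>\<theta>\<close>
  and labels \<open>\<omega>\<close> (both indexed from \<open>0\<close>). The variable \<open>\<Delta>h\<close> is the tilted largest jump.
\<close>

definition SBSP ::
  "'w measure \<Rightarrow> real \<Rightarrow> real \<Rightarrow> real \<Rightarrow> (nat \<Rightarrow> 'w \<Rightarrow> real) \<Rightarrow> (nat \<Rightarrow> 'w \<Rightarrow> real) \<Rightarrow>
     ('w \<Rightarrow> real measure) \<Rightarrow> bool"
where
  "SBSP M \<beta> \<sigma> c \<theta> \<omega> \<Theta> \<longleftrightarrow>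
     (\<exists>G \<Delta>h.
        scaled_jump_kernel \<sigma> G \<and>
        distributed M lborel \<Delta>h (\<lambda>s. ennreal (tilting c \<beta> \<sigma> s * largest_jump_density \<sigma> s)) \<and>
        is_cond_distr M \<Delta>h borel (\<lambda>w n. \<theta> n w) (PiM UNIV (\<lambda>_. borel)) G \<and>
        prob_space.indep_vars M (\<lambda>_. P0) \<omega> UNIV \<and>
        (\<forall>n. distr M P0 (\<omega> n) = P0) \<and>
        distr M ((borel \<Otimes>\<^sub>M PiM UNIV (\<lambda>_. borel)) \<Otimes>\<^sub>M PiM UNIV (\<lambda>_. P0))
            (\<lambda>w. ((\<Delta>h w, \<lambda>n. \<theta> n w), \<lambda>n. \<omega> n w)) =
          distr M (borel \<Otimes>\<^sub>M PiM UNIV (\<lambda>_. borel)) (\<lambda>w. (\<Delta>h w, \<lambda>n. \<theta> n w)) \<Otimes>\<^sub>M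
          distr M (PiM UNIV (\<lambda>_. P0)) (\<lambda>w n. \<omega> n w)) \<and>
     (\<forall>w\<in>space M. \<Theta> w = atomic_measure P0 (\<lambda>n. ennreal (\<theta> n w)) (\<lambda>n. \<omega> n w))"


section \<open>The negative binomial process likelihood\<close>

text \<open>
  Given \<open>\<Theta> = \<Sum>n. \<theta>\<^sub>n \<delta>(\<omega>\<^sub>n)\<close>, the measures \<open>Z\<^sub>d = \<Sum>n. A\<^sub>d\<^sub>,\<^sub>n \<delta>(\<omega>\<^sub>n)\<close>, \<open>d \<ge> 1\<close>, are i.i.d.
  \<open>NBP(\<Theta>, r)\<close>. Conditioning on \<open>\<Theta>\<close> is conditioning on its jumps and labels \<open>(\<theta>, \<omega>)\<close>.
\<close>

definition iid_NBP ::
  "'w measure \<Rightarrow> real \<Rightarrow> (nat \<Rightarrow> 'w \<Rightarrow> real) \<Rightarrow> (nat \<Rightarrow> 'w \<Rightarrow> real) \<Rightarrow> ('w \<Rightarrow> real measure) \<Rightarrow>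
     (nat \<Rightarrow> nat \<Rightarrow> 'w \<Rightarrow> nat) \<Rightarrow> (nat \<Rightarrow> 'w \<Rightarrow> real measure) \<Rightarrow> bool"
where
  "iid_NBP M r \<theta> \<omega> \<Theta> A Z \<longleftrightarrow>
     (\<forall>w\<in>space M. \<Theta> w = atomic_measure P0 (\<lambda>n. ennreal (\<theta> n w)) (\<lambda>n. \<omega> n w)) \<and>
     is_cond_distr M
       (\<lambda>w. (\<lambda>n. \<theta> n w, \<lambda>n. \<omega> n w)) (PiM UNIV (\<lambda>_. borel) \<Otimes>\<^sub>M PiM UNIV (\<lambda>_. P0))
       (\<lambda>w. \<lambda>(d, n)\<in>{1..} \<times> UNIV. A d n w) (PiM ({1..} \<times> UNIV) (\<lambda>_. count_space UNIV))
       (\<lambda>(t, x). PiM ({1..} \<times> UNIV) (\<lambda>(d, n). neg_binomial r (t n))) \<and>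
     (\<forall>d\<ge>1. \<forall>w\<in>space M.
        Z d w = atomic_measure P0 (\<lambda>n. of_nat (A d n w)) (\<lambda>n. \<omega> n w))"

text \<open>The labels of the units observed on the days \<open>1, \<dots>, D\<close>.\<close>

definition observed :: "(nat \<Rightarrow> 'w \<Rightarrow> real measure) \<Rightarrow> nat \<Rightarrow> 'w \<Rightarrow> real set" where
  "observed Z D w = {x \<in> space P0. \<exists>d\<in>{1..D}. 0 < emeasure (Z d w) {x}}"

text \<open>The sigma-algebra generated by \<open>Z\<^sub>1, \<dots>, Z\<^sub>D\<close> as random measures on the label space.\<close>

definition data_algebra :: "'w measure \<Rightarrow> (nat \<Rightarrow> 'w \<Rightarrow> real measure) \<Rightarrow> nat \<Rightarrow> 'w measure" where
  "data_algebra M Z D =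
     vimage_algebra (space M) (\<lambda>w. \<lambda>d\<in>{1..D}. Z d w) (PiM {1..D} (\<lambda>_. measure_algebra P0))"


section \<open>The predictive law\<close>

text \<open>The joint law of \<open>(J, X)\<close> with \<open>J \<sim> Beta(a,b)\<close> and \<open>X | J \<sim> NegBin(R,J)\<close>.\<close>

definition beta_neg_binomial :: "real \<Rightarrow> real \<Rightarrow> real \<Rightarrow> (real \<times> nat) measure" where
  "beta_neg_binomial a b R =
     beta_distribution a b \<bind>
       (\<lambda>j. distr (neg_binomial R j) (borel \<Otimes>\<^sub>M count_space UNIV) (\<lambda>x. (j, x)))"

text \<open>
  The law of \<open>\<Sum>n=1..N. X\<^sub>n\<close> for independent pairs \<open>(J\<^sub>n, X\<^sub>n)\<close> with \<open>J\<^sub>n \<sim> Beta(a\<^sub>n,b)\<close> and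
  \<open>X\<^sub>n | J\<^sub>n \<sim> NegBin(R,J\<^sub>n)\<close>, as a measure on the reals.
\<close>

definition predictive_law :: "nat \<Rightarrow> (nat \<Rightarrow> real) \<Rightarrow> real \<Rightarrow> real \<Rightarrow> real measure" where
  "predictive_law N a b R =
     distr (PiM {1..N} (\<lambda>n. beta_neg_binomial (a n) b R)) borel (\<lambda>p. \<Sum>n=1..N. real (snd (p n)))"

end

theory Submission
  imports Defs "HOL-Real_Asymp.Real_Asymp"
begin

text \<open>
  Given the largest jump, the remaining jumps form a Poisson process on \<open>(0,1)\<close> whose intensity is a
  multiple of \<open>s powr (- 1 - \<sigma>)\<close>. Attaching labels and counts to the jumps, the expectation of a product
  \<open>\<Prod>n. u (\<omega>\<^sub>n, A\<^sub>n)\<close> then depends on \<open>u\<close> only through \<open>\<integral> (1 - F\<^sub>u s) * s powr (- 1 - \<sigma>) ds\<close>, where \<open>F\<^sub>u s\<close>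
  is the mean of \<open>u\<close> over the label and the counts of a unit with jump \<open>s\<close>. Let \<open>u\<close> be the indicator that
  an observed unit avoids a set \<open>T\<close> of labels and past counts, times \<open>v\<close> to the power of its future count.
  By Beta conjugacy this integral does not change when the second factor is replaced by the generating
  function of the Beta-negative binomial law, whatever the largest jump is. The void events of the sets
  \<open>T\<close> form a generator, stable under intersections, of a sigma-algebra that contains the data up to the
  null event of coinciding labels. Hence the conditional generating function of the future sum is the
  product of those of the predictive law, and comparing power series in \<open>v\<close> gives the claim.
\<close>

section \<open>Exponentials of extended nonnegative reals\<close>

text \<open>\<open>G\<close> is only given as a conditional law, fixed up to null sets, so nothing
  can be evaluated at a single value of the largest point. Statements about the ratios are therefore
  identities of integrals weighted by functions of \<open>\<Delta> 0\<close>, and conditioning is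
  approximated by small intervals for \<open>\<Delta> 0\<close>. By the scaling of the power law,
  the exponent is \<open>\<Delta> 0 powr (- \<sigma>)\<close> times an integral over (0,1). The
  tilting acts on the first factor only, which is why \<beta> and c leave no trace in the predictive
  law. A unit with jump s and total count m has likelihood proportional to s^m (1-s)^(r D0).
  Multiplied by s^(-1-\<sigma>) this gives the parameters m-\<sigma> and r D0 + 1; integrability at
  0 needs m > \<sigma>, which holds exactly for observed units. The data show labels with their
  counts but not the numbering of the units in the model, hence test sets of labels and counts. Each
  identity for a fixed v holds almost surely only, so countably many v must suffice. Exponents are
  extended reals, where \<open>eneg\<close> sends infinity to 0: products with zero factors, and
  events, become exponentials too.\<close>

definition eneg :: "ennreal \<Rightarrow> ennreal" where
  "eneg x = (if x = \<infinity> then 0 else ennreal (exp (- enn2real x)))"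

lemma eneg_0 [simp]: "eneg 0 = 1"
  by (simp add: eneg_def)

lemma eneg_top [simp]: "eneg top = 0"
  by (simp add: eneg_def)

lemma eneg_ennreal: "0 \<le> x \<Longrightarrow> eneg (ennreal x) = ennreal (exp (- x))"
  by (simp add: eneg_def)

lemma eneg_add: "eneg (x + y) = eneg x * eneg y"
  by (cases x; cases y) (simp_all add: eneg_ennreal exp_add exp_diff exp_minus divide_inverse ennreal_mult flip: ennreal_plus)

lemma eneg_antimono: "x \<le> y \<Longrightarrow> eneg y \<le> eneg x"
  by (cases x; cases y) (auto simp: eneg_ennreal top_unique)

lemma eneg_le_1: "eneg x \<le> 1"
  using eneg_antimono[of 0 x] by simp

lemma eneg_less_top [simp]: "eneg x < top"
  using eneg_le_1[of x] by (rule le_less_trans) simp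

lemma eneg_neq_top [simp]: "eneg x \<noteq> top"
  using eneg_less_top[of x] by (rule less_imp_neq)

lemma eneg_sum: "finite I \<Longrightarrow> eneg (\<Sum>i\<in>I. f i) = (\<Prod>i\<in>I. eneg (f i))"
  by (induction I rule: finite_induct) (auto simp: eneg_add)

lemma eneg_mult_of_nat: "eneg (c * of_nat k) = eneg c ^ k"
  by (induction k) (auto simp: eneg_add algebra_simps)

text \<open>Continuity at \<open>top\<close> is included, since exponents may grow to infinity:
  \<open>eneg\<close> falls below r > 0 once the exponent exceeds - ln r.\<close>

lemma tendsto_eneg:
  assumes "(f \<longlongrightarrow> x) F"
  shows "((\<lambda>i. eneg (f i)) \<longlongrightarrow> eneg x) F"
proof (cases "x = top")
  case False
  then have ev: "\<forall>\<^sub>F i in F. f i < top"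
    using assms by (intro order_tendstoD(2)[OF assms]) (simp add: less_top)
  have "((\<lambda>i. ennreal (exp (- enn2real (f i)))) \<longlongrightarrow> ennreal (exp (- enn2real x))) F"
    using assms False by (intro tendsto_ennrealI tendsto_exp tendsto_minus tendsto_enn2real) (auto simp: less_top)
  moreover have "\<forall>\<^sub>F i in F. ennreal (exp (- enn2real (f i))) = eneg (f i)"
    using ev by eventually_elim (auto simp: eneg_def)
  ultimately show ?thesis
    using False by (simp add: eneg_def tendsto_cong)
next
  case True
  show ?thesis
    unfolding True eneg_top
  proof (rule order_tendstoI)
    fix a :: ennreal assume "0 < a"
    then obtain r where r: "0 < r" "ennreal r < a"
      proof -
      obtain y where y: "0 < y" "y < a"
        using dense[OF \<open>0 < a\<close>] by auto
      then show ?thesis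
        by (cases y; intro that[of "enn2real y"]) auto
    qed
    have "\<forall>\<^sub>F i in F. ennreal (max 0 (- ln r)) < f i"
      using assms unfolding True by (intro order_tendstoD(1)[where y=top]) auto
    then show "\<forall>\<^sub>F i in F. eneg (f i) < a"
    proof eventually_elim
      case (elim i)
      have "eneg (f i) \<le> eneg (ennreal (max 0 (- ln r)))"
        using elim by (intro eneg_antimono) simp
      also have "\<dots> \<le> ennreal r"
        using r by (subst eneg_ennreal) (auto simp: max_def)
      finally show ?case using r by simp
    qed
  qed auto
qed

lemma borel_measurable_eneg [measurable]: "eneg \<in> borel_measurable borel"
proof (rule borel_measurable_continuous_onI)
  show "continuous_on UNIV eneg"
    unfolding continuous_on_def by (auto intro: tendsto_eneg tendsto_ident_at)
qed

section \<open>Laplace functionals of Poisson random measures\<close>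

text \<open>The Poisson masses of the naturals already sum to 1, which leaves no probability for
  infinity or for other extended reals.\<close>

lemma AE_Poisson_nat:
  fixes X :: "'a \<Rightarrow> ennreal"
  assumes "prob_space Q" and [measurable]: "X \<in> borel_measurable Q" and l: "0 \<le> l"
    and P: "\<And>k::nat. measure Q {v \<in> space Q. X v = of_nat k} = l ^ k / fact k * exp (- l)"
  shows "AE v in Q. \<exists>k::nat. X v = of_nat k"
proof -
  interpret prob_space Q by fact
  define B where "B k = {v \<in> space Q. X v = of_nat k}" for k :: nat
  have B [measurable]: "B k \<in> sets Q" for k
    unfolding B_def by measurable
  have disj: "disjoint_family B"
    by (auto simp: disjoint_family_on_def B_def)
  have em: "emeasure Q (B k) = ennreal (l ^ k / fact k * exp (- l))" for k
    using P[of k] by (simp add: B_def emeasure_eq_measure)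
  have exps: "(\<lambda>k. l ^ k / fact k * exp (- l)) sums (exp l * exp (- l))"
    using sums_mult2[OF exp_converges[of l], of "exp (- l)"] by (simp add: field_simps)
  have "emeasure Q (\<Union>k. B k) = (\<Sum>k. emeasure Q (B k))"
    using disj by (intro suminf_emeasure[symmetric]) auto
  also have "\<dots> = ennreal (exp l * exp (- l))"
    unfolding em using l exps by (intro suminf_ennreal_eq) auto
  also have "\<dots> = 1"
    by (simp flip: exp_add)
  finally have "AE v in Q. v \<in> (\<Union>k. B k)"
    by (intro AE_in_set_eq_1[THEN iffD2]) (auto simp: measure_def)
  then show ?thesis
    by eventually_elim (auto simp: B_def)
qed

text \<open>With z = \<open>eneg c\<close> this is the Poisson generating function exp (- l (1 -
  z)). Infinite c corresponds to z = 0 and, with 0^0 = 1, gives the probability of no point.\<close>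

lemma eneg_Poisson:
  fixes X :: "'a \<Rightarrow> ennreal"
  assumes "prob_space Q" and [measurable]: "X \<in> borel_measurable Q" and l: "0 \<le> l"
    and P: "\<And>k::nat. measure Q {v \<in> space Q. X v = of_nat k} = l ^ k / fact k * exp (- l)"
  shows "(\<integral>\<^sup>+v. eneg (c * X v) \<partial>Q) = eneg (ennreal l * (1 - eneg c))"
proof -
  interpret prob_space Q by fact
  define B where "B k = {v \<in> space Q. X v = of_nat k}" for k :: nat
  have B [measurable]: "B k \<in> sets Q" for k
    unfolding B_def by measurable
  have disj: "disjoint_family B"
    by (auto simp: disjoint_family_on_def B_def)
  have em: "emeasure Q (B k) = ennreal (l ^ k / fact k * exp (- l))" for k
    using P[of k] by (simp add: B_def emeasure_eq_measure)
  have exps: "(\<lambda>k. (l * z) ^ k / fact k * exp (- l)) sums (exp (l * z) * exp (- l))" for z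
    using sums_mult2[OF exp_converges[of "l * z"], of "exp (- l)"] by (simp add: field_simps)
  have "AE v in Q. \<exists>k::nat. X v = of_nat k"
    using AE_Poisson_nat[OF assms] .
  with AE_space have "AE v in Q. eneg (c * X v) = (\<Sum>k. eneg c ^ k * indicator (B k) v)"
  proof eventually_elim
    case (elim v)
    then obtain k where k: "v \<in> B k" by (auto simp: B_def)
    then have "(\<lambda>j. eneg c ^ j * indicator (B j) v) = (\<lambda>j. if j = k then eneg c ^ k else 0)"
      using disj by (auto simp: fun_eq_iff disjoint_family_on_def indicator_def)
    moreover have "(\<Sum>j. if j = k then eneg c ^ k else 0) = eneg c ^ k"
      using sums_single[of k "\<lambda>_. eneg c ^ k"] by (simp add: sums_iff)
    ultimately show ?case
      using k by (simp add: eneg_mult_of_nat B_def)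
  qed
  then have "(\<integral>\<^sup>+v. eneg (c * X v) \<partial>Q) = (\<integral>\<^sup>+v. (\<Sum>k. eneg c ^ k * indicator (B k) v) \<partial>Q)"
    by (rule nn_integral_cong_AE)
  also have "\<dots> = (\<Sum>k. eneg c ^ k * emeasure Q (B k))"
    by (subst nn_integral_suminf) (auto simp: nn_integral_cmult)
  also have "\<dots> = eneg (ennreal l * (1 - eneg c))"
  proof -
    define z where "z = enn2real (eneg c)"
    have z: "0 \<le> z" "z \<le> 1" "eneg c = ennreal z"
      using eneg_le_1[of c] by (auto simp: z_def enn2real_leI)
    have "(\<Sum>k. eneg c ^ k * emeasure Q (B k)) = (\<Sum>k. ennreal ((l * z) ^ k / fact k * exp (- l)))"
      using z l by (auto simp: em ennreal_power power_mult_distrib mult_ac intro!: suminf_cong simp flip: ennreal_mult)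
    also have "\<dots> = ennreal (exp (l * z) * exp (- l))"
      using l z exps[of z] by (intro suminf_ennreal_eq) auto
    also have "\<dots> = eneg (ennreal (l * (1 - z)))"
      using l z by (subst eneg_ennreal) (auto simp: algebra_simps mult_left_le simp flip: exp_add)
    also have "ennreal (l * (1 - z)) = ennreal l * (1 - eneg c)"
      using l z by (simp add: z(3) ennreal_mult ennreal_minus flip: ennreal_1)
    finally show ?thesis .
  qed
  finally show ?thesis .
qed

section \<open>From counts in disjoint sets to the Laplace functional\<close>

locale poisson_points =
  prob_space Q for Q :: "'a measure" and \<mu> :: "real measure" and \<Delta> :: "nat \<Rightarrow> 'a \<Rightarrow> real" +
  assumes sets_mu: "sets \<mu> = sets borel"
    and Delta_measurable [measurable]: "\<Delta> n \<in> borel_measurable Q"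
    and poisson: "poisson_random_measure Q \<mu> (\<lambda>v. atomic_measure borel (\<lambda>_. 1) (\<lambda>n. \<Delta> n v))"
begin

definition count :: "real set \<Rightarrow> 'a \<Rightarrow> ennreal" where
  "count B v = (\<Sum>n. indicator B (\<Delta> n v))"

lemma emeasure_atomic: "B \<in> sets borel \<Longrightarrow> emeasure (atomic_measure borel (\<lambda>_. 1) (\<lambda>n. \<Delta> n v)) B = count B v"
  by (subst emeasure_atomic_measure) (auto simp: count_def)

lemma count_measurable [measurable]: "B \<in> sets borel \<Longrightarrow> count B \<in> borel_measurable Q"
  unfolding count_def[abs_def]
  by (intro borel_measurable_suminf_order measurable_compose[OF Delta_measurable borel_measurable_indicator])

text \<open>For infinite mass the count is infinite almost surely, and both sides become
  \<open>eneg (c * \<infinity>)\<close>, because \<open>1 - eneg c\<close> vanishes only for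
  \<open>c = 0\<close>.\<close>

lemma laplace_indicator:
  assumes B: "B \<in> sets borel"
  shows "(\<integral>\<^sup>+v. eneg (c * count B v) \<partial>Q) = eneg (emeasure \<mu> B * (1 - eneg c))"
proof (cases "emeasure \<mu> B = \<infinity>")
  case True
  then have "AE v in Q. count B v = \<infinity>"
    using poisson B by (auto simp: poisson_random_measure_def sets_mu emeasure_atomic)
  then have "(\<integral>\<^sup>+v. eneg (c * count B v) \<partial>Q) = (\<integral>\<^sup>+v. eneg (c * \<infinity>) \<partial>Q)"
    by (intro nn_integral_cong_AE) auto
  also have "\<dots> = eneg (c * \<infinity>)"
    by (simp add: emeasure_space_1)
  also have "\<dots> = eneg (emeasure \<mu> B * (1 - eneg c))"
  proof (cases "c = 0")
    case False
    then have "eneg c < 1"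
      by (cases c) (auto simp: eneg_ennreal ennreal_lessI)
    then have "1 - eneg c \<noteq> 0"
      by (simp add: diff_gr0_ennreal less_imp_neq[symmetric])
    then show ?thesis
      using False by (simp add: True ennreal_mult_top ennreal_top_mult)
  qed (simp add: True)
  finally show ?thesis .
next
  case False
  then have fin: "emeasure \<mu> B < \<infinity>"
    by (simp add: less_top)
  have "\<And>k::nat. measure Q {v \<in> space Q. count B v = of_nat k} =
                  measure \<mu> B ^ k / fact k * exp (- measure \<mu> B)"
    using poisson B fin by (auto simp: poisson_random_measure_def sets_mu emeasure_atomic)
  moreover have "prob_space Q" by (rule prob_space_axioms)
  ultimately have "(\<integral>\<^sup>+v. eneg (c * count B v) \<partial>Q) = eneg (ennreal (measure \<mu> B) * (1 - eneg c))"
    using B by (intro eneg_Poisson) auto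
  then show ?thesis
    using False by (simp add: emeasure_eq_ennreal_measure)
qed

lemma AE_finite_points:
  assumes B: "B \<in> sets borel" and fin: "emeasure \<mu> B < \<infinity>"
  shows "AE v in Q. finite {n. \<Delta> n v \<in> B}"
proof -
  have "\<And>k::nat. measure Q {v \<in> space Q. count B v = of_nat k} =
                  measure \<mu> B ^ k / fact k * exp (- measure \<mu> B)"
    using poisson B fin by (auto simp: poisson_random_measure_def sets_mu emeasure_atomic)
  then have "AE v in Q. \<exists>k::nat. count B v = of_nat k"
    using B by (intro AE_Poisson_nat[OF prob_space_axioms]) auto
  then show ?thesis
  proof eventually_elim
    case (elim v)
    then obtain k :: nat where k: "count B v = of_nat k" by auto
    show ?case
    proof (rule ccontr)
      assume "infinite {n. \<Delta> n v \<in> B}"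
      then obtain F where F: "F \<subseteq> {n. \<Delta> n v \<in> B}" "finite F" "card F = Suc k"
        by (metis infinite_arbitrarily_large)
      have "of_nat (Suc k) = (\<Sum>n\<in>F. indicator B (\<Delta> n v) :: ennreal)"
        using F by (subst sum.cong[of F F _ "\<lambda>_. 1"]) auto
      also have "\<dots> \<le> of_nat k"
        unfolding k[symmetric] count_def using F(2) by (intro sum_le_suminf) auto
      finally show False
        by (simp add: ennreal_of_nat_eq_real_of_nat del: of_nat_Suc)
    qed
  qed
qed

lemma laplace_disjoint:
  fixes c :: "nat \<Rightarrow> ennreal" and B :: "nat \<Rightarrow> real set"
  assumes B [measurable]: "\<And>i. B i \<in> sets borel" and disj: "disjoint_family B"
  shows "(\<integral>\<^sup>+v. eneg (\<Sum>n. \<Sum>i<k. c i * indicator (B i) (\<Delta> n v)) \<partial>Q) =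
         eneg (\<integral>\<^sup>+x. 1 - eneg (\<Sum>i<k. c i * indicator (B i) x) \<partial>\<mu>)"
proof -
  have [measurable]: "B i \<in> sets \<mu>" for i
    by (simp add: sets_mu)
  have ind: "indep_vars (\<lambda>_. borel) (\<lambda>i. count (B i)) UNIV"
    using poisson B disj
    by (auto simp: poisson_random_measure_def sets_mu emeasure_atomic image_subset_iff)
  \<comment> \<open>At most one of the disjoint sets contains x, so \<open>1 - eneg\<close> is
    additive here; this turns the sum of exponents into an integral.\<close>
  have eq: "(\<Sum>i<k. (1 - eneg (c i)) * indicator (B i) x) = 1 - eneg (\<Sum>i<k. c i * indicator (B i) x)" for x
  proof (cases "\<exists>j<k. x \<in> B j")
    case True
    then obtain j where j: "j < k" "x \<in> B j" by auto
    then have *: "indicator (B i) x = (if i = j then 1 else 0::ennreal)" for i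
      using disj j by (auto simp: disjoint_family_on_def indicator_def)
    show ?thesis
      using j by (simp add: * if_distrib sum.delta cong: if_cong)
  qed (auto simp: indicator_def)
  have "(\<Sum>n. \<Sum>i<k. c i * indicator (B i) (\<Delta> n v)) = (\<Sum>i<k. c i * count (B i) v)" for v
    by (subst suminf_sum) (auto simp: count_def)
  then have "(\<integral>\<^sup>+v. eneg (\<Sum>n. \<Sum>i<k. c i * indicator (B i) (\<Delta> n v)) \<partial>Q) =
             (\<integral>\<^sup>+v. (\<Prod>i<k. eneg (c i * count (B i) v)) \<partial>Q)"
    by (simp add: eneg_sum)
  also have "\<dots> = (\<Prod>i<k. \<integral>\<^sup>+v. eneg (c i * count (B i) v) \<partial>Q)"
  proof (rule indep_vars_nn_integral)
    show "indep_vars (\<lambda>_. borel) (\<lambda>i v. eneg (c i * count (B i) v)) {..<k}"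
      by (rule indep_vars_compose2[OF indep_vars_subset[OF ind]]) auto
  qed auto
  also have "\<dots> = eneg (\<Sum>i<k. emeasure \<mu> (B i) * (1 - eneg (c i)))"
    by (simp add: laplace_indicator eneg_sum)
  also have "(\<Sum>i<k. emeasure \<mu> (B i) * (1 - eneg (c i))) =
             (\<integral>\<^sup>+x. (\<Sum>i<k. (1 - eneg (c i)) * indicator (B i) x) \<partial>\<mu>)"
    by (subst nn_integral_sum) (auto simp: nn_integral_cmult_indicator mult.commute[of "emeasure \<mu> _"])
  also have "\<dots> = (\<integral>\<^sup>+x. 1 - eneg (\<Sum>i<k. c i * indicator (B i) x) \<partial>\<mu>)"
    by (simp only: eq)
  finally show ?thesis .
qed

lemma laplace_simple:
  assumes "simple_function borel g"
  shows "(\<integral>\<^sup>+v. eneg (\<Sum>n. g (\<Delta> n v)) \<partial>Q) = eneg (\<integral>\<^sup>+x. 1 - eneg (g x :: ennreal) \<partial>\<mu>)"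
proof -
  have fin: "finite (range g)" and [measurable]: "g \<in> borel_measurable borel"
    using assms by (auto simp: simple_function_def intro: borel_measurable_simple_function)
  obtain e where e: "bij_betw e {0..<card (range g)} (range g)"
    using ex_bij_betw_nat_finite[OF fin] by auto
  define k where "k = card (range g)"
  define B where "B i = (if i < k then g -` {e i} else {})" for i
  have B: "B i \<in> sets borel" for i
    using measurable_sets[of g borel borel "{e i}"] by (auto simp: B_def)
  have disj: "disjoint_family B"
    using e by (auto simp: disjoint_family_on_def B_def k_def bij_betw_def inj_on_def)
  have "g x = (\<Sum>i<k. e i * indicator (B i) x)" for x
  proof -
    obtain j where j: "j < k" "g x = e j"
    proof -
      have "g x \<in> e ` {0..<k}"
        using e by (simp add: bij_betw_def k_def)
      then show ?thesis
        using that by auto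
    qed
    have "(\<Sum>i<k. e i * indicator (B i) x) = (\<Sum>i<k. if i = j then e j else 0)"
      using e j by (intro sum.cong) (auto simp: B_def k_def bij_betw_def inj_on_def indicator_def)
    then show ?thesis
      using j by simp
  qed
  then show ?thesis
    using laplace_disjoint[OF B disj, of e k] by simp
qed

text \<open>Simple functions increase to g. The left side converges by domination by 1, the exponent
  on the right by monotonicity. Infinite values of g are included; they express that a region
  contains no point.\<close>

theorem laplace_functional:
  assumes g: "g \<in> borel_measurable borel"
  shows "(\<integral>\<^sup>+v. eneg (\<Sum>n. g (\<Delta> n v)) \<partial>Q) = eneg (\<integral>\<^sup>+x. 1 - eneg (g x :: ennreal) \<partial>\<mu>)"
proof -
  obtain f where f: "incseq f" "\<And>i. simple_function borel (f i)" "\<And>x. (SUP i. f i x) = g x"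
    using borel_measurable_implies_simple_function_sequence'[OF g] by metis
  have [measurable]: "f i \<in> borel_measurable borel" for i
    using f(2) by (rule borel_measurable_simple_function)
  have [measurable]: "f i \<in> borel_measurable \<mu>" for i
    by (simp add: measurable_cong_sets[OF sets_mu refl])
  have inc: "incseq (\<lambda>i. f i x)" for x
    using f(1) by (auto simp: incseq_def le_fun_def)
  have lim: "(\<lambda>i. f i x) \<longlonglongrightarrow> g x" for x
    using LIMSEQ_SUP[OF inc[of x]] f(3) by simp
  have "(\<lambda>i. \<Sum>n. f i (\<Delta> n v)) \<longlonglongrightarrow> (\<Sum>n. g (\<Delta> n v))" for v
  proof -
    have "(\<Sum>n. SUP i. f i (\<Delta> n v)) = (SUP i. \<Sum>n. f i (\<Delta> n v))"
      using inc by (intro ennreal_suminf_SUP_eq) auto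
    moreover have "incseq (\<lambda>i. \<Sum>n. f i (\<Delta> n v))"
      using inc by (auto simp: incseq_def intro!: suminf_le)
    ultimately show ?thesis
      using LIMSEQ_SUP[of "\<lambda>i. \<Sum>n. f i (\<Delta> n v)"] by (simp add: f(3))
  qed
  then have "(\<lambda>i. \<integral>\<^sup>+v. eneg (\<Sum>n. f i (\<Delta> n v)) \<partial>Q) \<longlonglongrightarrow> (\<integral>\<^sup>+v. eneg (\<Sum>n. g (\<Delta> n v)) \<partial>Q)"
    using g by (intro nn_integral_dominated_convergence[where w="\<lambda>_. 1"])
      (auto intro!: tendsto_eneg eneg_le_1 AE_I2 simp: emeasure_space_1)
  moreover have "(\<lambda>i. eneg (\<integral>\<^sup>+x. 1 - eneg (f i x) \<partial>\<mu>)) \<longlonglongrightarrow> eneg (\<integral>\<^sup>+x. 1 - eneg (g x) \<partial>\<mu>)"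
  proof (intro tendsto_eneg nn_integral_LIMSEQ)
    show "incseq (\<lambda>i x. 1 - eneg (f i x))"
      using inc by (auto simp: incseq_def le_fun_def intro!: ennreal_minus_mono eneg_antimono)
    show "(\<lambda>i. 1 - eneg (f i x)) \<longlonglongrightarrow> 1 - eneg (g x)" for x
      using lim by (intro tendsto_diff_ennreal tendsto_eneg tendsto_const) (auto simp: less_top)
  qed auto
  ultimately show ?thesis
    using f(2) by (simp add: laplace_simple LIMSEQ_unique)
qed

end

section \<open>Conditional distributions\<close>

text \<open>The definition fixes the joint law on rectangles only. These are stable under
  intersection and generate the product sigma-algebra, so the joint law is that of X followed by the
  kernel.\<close>

lemma is_cond_distr_nn_integral:
  assumes "prob_space M" and K: "is_cond_distr M X N Y L K"
    and \<phi> [measurable]: "\<phi> \<in> borel_measurable (N \<Otimes>\<^sub>M L)"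
  shows "(\<integral>\<^sup>+w. \<phi> (X w, Y w) \<partial>M) = (\<integral>\<^sup>+x. \<integral>\<^sup>+y. \<phi> (x, y) \<partial>K x \<partial>distr M N X)"
proof -
  interpret prob_space M by fact
  have X [measurable]: "X \<in> measurable M N" and Y [measurable]: "Y \<in> measurable M L"
    and K' [measurable]: "K \<in> measurable N (prob_algebra L)"
    using K by (auto simp: is_cond_distr_def)
  have KS [measurable]: "K \<in> measurable N (subprob_algebra L)"
    by (rule measurable_prob_algebraD) measurable
  define R where "R = distr M N X"
  define k where "k x = distr (K x) (N \<Otimes>\<^sub>M L) (Pair x)" for x
  have k [measurable]: "k \<in> measurable R (subprob_algebra (N \<Otimes>\<^sub>M L))"
    unfolding k_def R_def by (rule measurable_prob_algebraD) measurable
  have ne: "space R \<noteq> {}"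
    unfolding R_def using not_empty measurable_space[OF X] by auto
  have sK: "sets (K x) = sets L" if "x \<in> space N" for x
    using measurable_space[OF K' that] by (auto simp: space_prob_algebra)
  have "distr M (N \<Otimes>\<^sub>M L) (\<lambda>w. (X w, Y w)) = R \<bind> k"
  proof (rule measure_eqI_generator_eq)
    show "Int_stable {a \<times> b |a b. a \<in> sets N \<and> b \<in> sets L}"
      by (rule Int_stable_pair_measure_generator)
    show "{a \<times> b |a b. a \<in> sets N \<and> b \<in> sets L} \<subseteq> Pow (space N \<times> space L)"
      by (rule pair_measure_closed)
    show "sets (distr M (N \<Otimes>\<^sub>M L) (\<lambda>w. (X w, Y w))) = sigma_sets (space N \<times> space L) {a \<times> b |a b. a \<in> sets N \<and> b \<in> sets L}"
      by (simp add: sets_pair_measure)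
    show "sets (R \<bind> k) = sigma_sets (space N \<times> space L) {a \<times> b |a b. a \<in> sets N \<and> b \<in> sets L}"
      using ne measurable_space[OF k] by (subst sets_bind[where N="N \<Otimes>\<^sub>M L"]) (auto simp: sets_pair_measure space_subprob_algebra)
    show "range (\<lambda>_::nat. space N \<times> space L) \<subseteq> {a \<times> b |a b. a \<in> sets N \<and> b \<in> sets L}"
      by auto
    show "emeasure (distr M (N \<Otimes>\<^sub>M L) (\<lambda>w. (X w, Y w))) (space N \<times> space L) \<noteq> \<infinity>"
      by (simp add: emeasure_distr emeasure_eq_measure)
    fix Z assume "Z \<in> {a \<times> b |a b. a \<in> sets N \<and> b \<in> sets L}"
    then obtain a b where Z: "Z = a \<times> b" and a [measurable]: "a \<in> sets N" and b [measurable]: "b \<in> sets L"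
      by auto
    have "emeasure (R \<bind> k) Z = (\<integral>\<^sup>+x. emeasure (k x) Z \<partial>R)"
      using ne Z by (intro emeasure_bind[where N="N \<Otimes>\<^sub>M L"]) auto
    also have "\<dots> = (\<integral>\<^sup>+x\<in>a. emeasure (K x) b \<partial>R)"
    proof (rule nn_integral_cong)
      fix x assume "x \<in> space R"
      then have x: "x \<in> space N" by (simp add: R_def)
      have [measurable]: "Pair x \<in> measurable (K x) (N \<Otimes>\<^sub>M L)"
        using x by (simp add: measurable_cong_sets[OF sK[OF x] refl])
      have "Pair x -` (a \<times> b) \<inter> space (K x) = (if x \<in> a then b else {})"
        using sets.sets_into_space[OF b] sets_eq_imp_space_eq[OF sK[OF x]] by auto
      then show "emeasure (k x) Z = emeasure (K x) b * indicator a x"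
        by (simp add: k_def Z emeasure_distr)
    qed
    also have "\<dots> = emeasure M {w \<in> space M. X w \<in> a \<and> Y w \<in> b}"
      using K a b by (simp add: is_cond_distr_def R_def)
    also have "\<dots> = emeasure (distr M (N \<Otimes>\<^sub>M L) (\<lambda>w. (X w, Y w))) Z"
      by (auto simp: Z emeasure_distr intro!: arg_cong[where f="emeasure M"])
    finally show "emeasure (distr M (N \<Otimes>\<^sub>M L) (\<lambda>w. (X w, Y w))) Z = emeasure (R \<bind> k) Z" ..
  qed auto
  then have "(\<integral>\<^sup>+w. \<phi> (X w, Y w) \<partial>M) = (\<integral>\<^sup>+z. \<phi> z \<partial>(R \<bind> k))"
    by (simp add: nn_integral_distr flip: \<open>distr M _ _ = R \<bind> k\<close>)
  also have "\<dots> = (\<integral>\<^sup>+x. \<integral>\<^sup>+z. \<phi> z \<partial>k x \<partial>R)"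
    by (rule nn_integral_bind) measurable
  also have "\<dots> = (\<integral>\<^sup>+x. \<integral>\<^sup>+y. \<phi> (x, y) \<partial>K x \<partial>R)"
  proof (rule nn_integral_cong)
    fix x assume "x \<in> space R"
    then have x: "x \<in> space N" by (simp add: R_def)
    have [measurable]: "Pair x \<in> measurable (K x) (N \<Otimes>\<^sub>M L)"
      using x by (simp add: measurable_cong_sets[OF sK[OF x] refl])
    show "(\<integral>\<^sup>+z. \<phi> z \<partial>k x) = (\<integral>\<^sup>+y. \<phi> (x, y) \<partial>K x)"
      unfolding k_def by (rule nn_integral_distr) measurable
  qed
  finally show ?thesis
    by (simp add: R_def)
qed

section \<open>Ratios of the points of a stable Poisson process\<close>

lemma sets_stable_intensity [simp, measurable_cong]: "sets (stable_intensity \<sigma>) = sets borel"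
  by (simp add: stable_intensity_def)

lemma stable_intensity_tail:
  assumes "0 < \<sigma>" "0 < x"
  shows "emeasure (stable_intensity \<sigma>) {x..} = ennreal (x powr (- \<sigma>))"
proof -
  have "emeasure (stable_intensity \<sigma>) {x..} =
        (\<integral>\<^sup>+s. ennreal (\<sigma> * s powr (- 1 - \<sigma>)) * indicator {x..} s \<partial>lborel)"
    unfolding stable_intensity_def using assms
    by (subst emeasure_density) (auto intro!: nn_integral_cong simp: indicator_def)
  also have "\<dots> = ennreal (0 - (- (x powr (- \<sigma>))))"
  proof (rule nn_integral_FTC_atLeast)
    show "((\<lambda>s. - (s powr (- \<sigma>))) \<longlongrightarrow> 0) at_top"
      using tendsto_minus[OF tendsto_neg_powr[OF _ filterlim_ident, of "- \<sigma>"]] assms by simp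
    fix s assume "x \<le> s"
    then show "((\<lambda>s. - (s powr (- \<sigma>))) has_real_derivative \<sigma> * s powr (- 1 - \<sigma>)) (at s)"
      using assms by (auto intro!: derivative_eq_intros simp: powr_diff powr_minus field_simps)
  qed (use assms in auto)
  finally show ?thesis by simp
qed

text \<open>The interval (0,1) carries the ratios to the largest point. Up to the factor
  \<open>t powr (- \<sigma>)\<close> this is the Laplace exponent of the ratios when the largest
  point is t.\<close>

definition jump_exponent :: "real \<Rightarrow> (real \<Rightarrow> ennreal) \<Rightarrow> ennreal" where
  "jump_exponent \<sigma> f = (\<integral>\<^sup>+s. (1 - eneg (f s)) * indicator {0<..<1} s \<partial>stable_intensity \<sigma>)"

definition left_cont :: "(real \<Rightarrow> ennreal) \<Rightarrow> bool" where
  "left_cont f \<longleftrightarrow> (\<forall>s X. 0 < s \<longrightarrow> s < 1 \<longrightarrow> (\<forall>k. 0 < X k \<and> X k \<le> s) \<longrightarrow> X \<longlonglongrightarrow> s \<longrightarrow>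
      (\<lambda>k::nat. f (X k)) \<longlonglongrightarrow> f s)"

locale stable_points =
  poisson_points Q "stable_intensity \<sigma>" \<Delta> for Q :: "'a measure" and \<sigma> \<Delta> +
  assumes sigma_pos: "0 < \<sigma>"
    and decreasing: "AE v in Q. \<forall>n. 0 < \<Delta> (Suc n) v \<and> \<Delta> (Suc n) v < \<Delta> n v"
begin

abbreviation "\<rho> \<equiv> stable_intensity \<sigma>"

lemma AE_points:
  "AE v in Q. (\<forall>n. 0 < \<Delta> n v) \<and> (\<forall>m n. m < n \<longrightarrow> \<Delta> n v < \<Delta> m v) \<and> (\<forall>d>0. finite {n. d \<le> \<Delta> n v})"
proof -
  have "AE v in Q. finite {n. \<Delta> n v \<in> {1 / real (Suc j)..}}" for j
    using sigma_pos by (intro AE_finite_points) (auto simp: stable_intensity_tail)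
  then have "AE v in Q. \<forall>j. finite {n. 1 / real (Suc j) \<le> \<Delta> n v}"
    by (simp add: AE_all_countable)
  then show ?thesis
    using decreasing
  proof eventually_elim
    case (elim v)
    have "0 < \<Delta> n v" for n
      using elim(2) by (cases n) (auto intro: less_trans)
    moreover have "\<Delta> n v < \<Delta> m v" if "m < n" for m n
      using that elim(2) by (induction n) (auto simp: less_Suc_eq intro: less_trans)
    moreover have "finite {n. d \<le> \<Delta> n v}" if "0 < d" for d
    proof -
      obtain j where "1 / real (Suc j) < d"
        using \<open>0 < d\<close> by (metis nat_approx_posE)
      then show ?thesis
        using elim(1) by (intro finite_subset[OF _ elim(1)[rule_format, of j]]) auto
    qed
    ultimately show ?case by auto
  qed
qed

text \<open>The value \<open>\<infinity>\<close> of the exponent above \<open>q\<close> encodes the event that no point exceeds \<open>q\<close>.\<close>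

lemma laplace_below:
  assumes h [measurable]: "h \<in> borel_measurable borel" and h0: "\<And>x. q < x \<Longrightarrow> h x = 0"
  shows "(\<integral>\<^sup>+v. indicator {..q} (\<Delta> 0 v) * eneg (\<Sum>n. h (\<Delta> n v)) \<partial>Q) =
         eneg (\<integral>\<^sup>+x. 1 - eneg (h x) \<partial>\<rho>) * eneg (emeasure \<rho> {q<..})"
proof -
  define g where "g x = h x + (if q < x then top else 0)" for x
  have [measurable]: "g \<in> borel_measurable borel"
    unfolding g_def by measurable
  have "AE v in Q. indicator {..q} (\<Delta> 0 v) * eneg (\<Sum>n. h (\<Delta> n v)) = eneg (\<Sum>n. g (\<Delta> n v))"
    using AE_points
  proof eventually_elim
    case (elim v)
    show ?case
    proof (cases "\<Delta> 0 v \<le> q")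
      case True
      have le: "\<Delta> n v \<le> q" for n
      proof (cases "n = 0")
        case False
        then have "\<Delta> n v < \<Delta> 0 v"
          using elim by blast
        then show ?thesis
          using True by simp
      qed (simp add: True)
      have "g (\<Delta> n v) = h (\<Delta> n v)" for n
        using le[of n] by (simp add: g_def)
      then show ?thesis
        using True by simp
    next
      case False
      then have "g (\<Delta> 0 v) = top"
        by (simp add: g_def)
      then have "(\<Sum>n. g (\<Delta> n v)) = top"
        using sum_le_suminf[of "\<lambda>n. g (\<Delta> n v)" "{0}"] by (simp add: top_unique)
      then show ?thesis
        using False by simp
    qed
  qed
  then have "(\<integral>\<^sup>+v. indicator {..q} (\<Delta> 0 v) * eneg (\<Sum>n. h (\<Delta> n v)) \<partial>Q) =
             (\<integral>\<^sup>+v. eneg (\<Sum>n. g (\<Delta> n v)) \<partial>Q)"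
    by (rule nn_integral_cong_AE)
  also have "\<dots> = eneg (\<integral>\<^sup>+x. 1 - eneg (g x) \<partial>\<rho>)"
    by (rule laplace_functional) measurable
  also have "(\<integral>\<^sup>+x. 1 - eneg (g x) \<partial>\<rho>) = (\<integral>\<^sup>+x. (1 - eneg (h x)) + indicator {q<..} x \<partial>\<rho>)"
    using h0 by (intro nn_integral_cong) (auto simp: g_def)
  also have "\<dots> = (\<integral>\<^sup>+x. 1 - eneg (h x) \<partial>\<rho>) + emeasure \<rho> {q<..}"
    by (subst nn_integral_add) auto
  finally show ?thesis
    by (simp add: eneg_add)
qed

text \<open>The function h vanishes above p and hence above q, so the formula for
  \<open>\<Delta> 0 \<le> q\<close> and the one for \<open>\<Delta> 0 \<le> p\<close> have the same
  exponent; their difference is the claim.\<close>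

lemma laplace_cell:
  assumes h [measurable]: "h \<in> borel_measurable borel" and h0: "\<And>x. p < x \<Longrightarrow> h x = 0" and "p \<le> q"
  shows "(\<integral>\<^sup>+v. indicator {p<..q} (\<Delta> 0 v) * eneg (\<Sum>n. h (\<Delta> n v)) \<partial>Q) =
         (\<integral>\<^sup>+v. indicator {p<..q} (\<Delta> 0 v) * eneg (\<integral>\<^sup>+x. 1 - eneg (h x) \<partial>\<rho>) \<partial>Q)"
proof -
  define c where "c = eneg (\<integral>\<^sup>+x. 1 - eneg (h x) \<partial>\<rho>)"
  define Y where "Y = (\<integral>\<^sup>+v. indicator {p<..q} (\<Delta> 0 v) * eneg (\<Sum>n. h (\<Delta> n v)) \<partial>Q)"
  define P where "P A = (\<integral>\<^sup>+v. indicator A (\<Delta> 0 v) \<partial>Q)" for A :: "real set"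
  have P: "P {..x} = eneg (emeasure \<rho> {x<..})" for x
    using laplace_below[of "\<lambda>_. 0" x] by (simp add: P_def)
  have split: "indicator {..q} x = indicator {p<..q} x + (indicator {..p} x :: ennreal)" for x
    using \<open>p \<le> q\<close> by (auto simp: indicator_def)
  have Pq: "P {..q} = P {p<..q} + P {..p}"
    unfolding P_def split by (rule nn_integral_add) measurable
  have "c * P {..q} = Y + c * P {..p}"
  proof -
    have "c * P {..q} = (\<integral>\<^sup>+v. indicator {..q} (\<Delta> 0 v) * eneg (\<Sum>n. h (\<Delta> n v)) \<partial>Q)"
      using h0 \<open>p \<le> q\<close> by (subst laplace_below) (auto simp: c_def P)
    also have "\<dots> = Y + (\<integral>\<^sup>+v. indicator {..p} (\<Delta> 0 v) * eneg (\<Sum>n. h (\<Delta> n v)) \<partial>Q)"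
      unfolding Y_def split distrib_right by (rule nn_integral_add) measurable
    also have "(\<integral>\<^sup>+v. indicator {..p} (\<Delta> 0 v) * eneg (\<Sum>n. h (\<Delta> n v)) \<partial>Q) = c * P {..p}"
      using h0 by (subst laplace_below) (auto simp: c_def P)
    finally show ?thesis .
  qed
  then have "c * P {p<..q} + c * P {..p} = Y + c * P {..p}"
    by (simp add: Pq distrib_left)
  \<comment> \<open>Subtraction of the common summand is only legitimate for a finite one.\<close>
  moreover have "c * P {..p} \<noteq> top"
    by (simp add: c_def P ennreal_mult_eq_top_iff less_imp_neq)
  ultimately have "c * P {p<..q} = Y"
    by (metis ennreal_add_diff_cancel_right)
  then show ?thesis
    by (simp add: Y_def c_def P_def nn_integral_multc mult.commute)
qed

abbreviation "K_fun \<equiv> jump_exponent \<sigma>"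

abbreviation "ratio_sum f v \<equiv> \<Sum>n. f (\<Delta> (Suc n) v / \<Delta> 0 v)"

abbreviation "ratio_exponent f v \<equiv> ennreal (\<Delta> 0 v powr (- \<sigma>)) * K_fun f"

text \<open>Substituting x = t s, the power law picks up the factor
  \<open>t powr (- \<sigma>)\<close>, and the points below t become ratios in (0,1).\<close>

lemma K_fun_scale:
  assumes [measurable]: "f \<in> borel_measurable borel" and t: "0 < t"
  shows "(\<integral>\<^sup>+x. (1 - eneg (f (x / t))) * indicator {..<t} x \<partial>\<rho>) = ennreal (t powr (- \<sigma>)) * K_fun f"
proof -
  define d where "d s = ennreal (indicator {0<..} s * \<sigma> * s powr (- 1 - \<sigma>))" for s :: real
  have [measurable]: "d \<in> borel_measurable borel"
    unfolding d_def by measurable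
  have r: "\<rho> = density lborel d"
    by (simp add: stable_intensity_def d_def[abs_def])
  have "(\<integral>\<^sup>+x. (1 - eneg (f (x / t))) * indicator {..<t} x \<partial>\<rho>) =
        (\<integral>\<^sup>+x. d x * ((1 - eneg (f (x / t))) * indicator {..<t} x) \<partial>lborel)"
    unfolding r by (rule nn_integral_density) measurable
  also have "\<dots> = ennreal t * (\<integral>\<^sup>+s. d (t * s) * ((1 - eneg (f s)) * indicator {..<t} (t * s)) \<partial>lborel)"
    using t by (subst nn_integral_real_affine[where c=t and t=0]) auto
  also have "\<dots> = (\<integral>\<^sup>+s. ennreal t * (d (t * s) * ((1 - eneg (f s)) * indicator {..<t} (t * s))) \<partial>lborel)"
    by (rule nn_integral_cmult[symmetric]) measurable
  also have "\<dots> = (\<integral>\<^sup>+s. ennreal (t powr (- \<sigma>)) * (d s * ((1 - eneg (f s)) * indicator {0<..<1} s)) \<partial>lborel)"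
  proof (rule nn_integral_cong)
    fix s :: real
    show "ennreal t * (d (t * s) * ((1 - eneg (f s)) * indicator {..<t} (t * s))) =
          ennreal (t powr (- \<sigma>)) * (d s * ((1 - eneg (f s)) * indicator {0<..<1} s))"
    proof (cases "0 < s \<and> s < 1")
      case True
      have "t * (\<sigma> * (t * s) powr (- 1 - \<sigma>)) = t powr (- \<sigma>) * (\<sigma> * s powr (- 1 - \<sigma>))"
        using t True by (simp add: powr_mult powr_diff powr_minus field_simps)
      then have "ennreal t * d (t * s) = ennreal (t powr (- \<sigma>)) * d s"
        using t True sigma_pos by (simp add: d_def flip: ennreal_mult)
      then show ?thesis
        using t True by (simp add: mult.assoc[symmetric])
    next
      case False
      then show ?thesis
        using t by (auto simp: d_def indicator_def zero_less_mult_iff)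
    qed
  qed
  also have "\<dots> = ennreal (t powr (- \<sigma>)) * K_fun f"
    unfolding jump_exponent_def r by (subst nn_integral_cmult) (auto simp: nn_integral_density)
  finally show ?thesis .
qed

end

section \<open>Rounding the largest point and passing to the limit\<close>

context stable_points
begin

lemma limit_points:
  assumes \<epsilon>: "0 < \<epsilon>" and f0: "\<And>s. s \<le> \<epsilon> \<Longrightarrow> f s = 0" and lc: "left_cont f"
    and pos: "\<And>n. 0 < \<Delta> n v" and dec: "\<And>m n. m < n \<Longrightarrow> \<Delta> n v < \<Delta> m v"
    and fin: "\<And>d. 0 < d \<Longrightarrow> finite {n. d \<le> \<Delta> n v}"
    and q: "\<And>k. \<Delta> 0 v \<le> q k" "q \<longlonglongrightarrow> \<Delta> 0 v" and p: "\<And>k. p k < \<Delta> 0 v" "p \<longlonglongrightarrow> \<Delta> 0 v"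
  shows "(\<lambda>k. \<Sum>n. f (\<Delta> n v / q k) * indicator {..p k} (\<Delta> n v)) \<longlonglongrightarrow>
         (ratio_sum f v)"
proof -
  \<comment> \<open>A finite set of indices that works for all k: f vanishes up to \<epsilon>, and
    rounding the largest point up only makes ratios smaller. Index 0 drops out since
    \<open>p k < \<Delta> 0 v\<close> kills its indicator.\<close>
  define I where "I = {n. \<epsilon> * \<Delta> 0 v \<le> \<Delta> n v} - {0}"
  have I: "finite I"
    unfolding I_def using fin \<epsilon> pos by (intro finite_Diff) auto
  have small: "f (\<Delta> n v / t) = 0" if "n \<notin> I" "n \<noteq> 0" "\<Delta> 0 v \<le> t" for n t
  proof -
    have "\<Delta> n v \<le> \<epsilon> * \<Delta> 0 v"
      using that by (auto simp: I_def)
    also have "\<dots> \<le> \<epsilon> * t"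
      using that \<epsilon> by simp
    finally have "\<Delta> n v / t \<le> \<epsilon>"
      using that pos[of 0] by (simp add: field_simps)
    then show ?thesis by (rule f0)
  qed
  have "(\<Sum>n. f (\<Delta> n v / q k) * indicator {..p k} (\<Delta> n v)) =
        (\<Sum>n\<in>I. f (\<Delta> n v / q k) * indicator {..p k} (\<Delta> n v))" for k
  proof (rule suminf_finite[OF I])
    fix n assume n: "n \<notin> I"
    then show "f (\<Delta> n v / q k) * indicator {..p k} (\<Delta> n v) = 0"
      using p(1)[of k] small[of n "q k"] q(1)[of k] by (cases "n = 0") auto
  qed
  moreover have "(ratio_sum f v) = (\<Sum>n\<in>I. f (\<Delta> n v / \<Delta> 0 v))"
  proof -
    \<comment> \<open>The sum of ratios starts at index 1; the value 0 at index 0 absorbs the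
      shift.\<close>
    define F where "F n = (if n = 0 then 0 else f (\<Delta> n v / \<Delta> 0 v))" for n
    have "(\<lambda>n. F (Suc n)) sums (\<Sum>n. F (Suc n))"
      by (rule summable_sums) simp
    then have "F sums ((\<Sum>n. F (Suc n)) + F 0)"
      by (rule sums_Suc)
    moreover have "F 0 = 0"
      by (simp add: F_def)
    ultimately have "(\<Sum>n. F (Suc n)) = (\<Sum>n. F n)"
      by (simp only: sums_iff add_0_right)
    also have "\<dots> = (\<Sum>n\<in>I. F n)"
      using small[of _ "\<Delta> 0 v"] by (intro suminf_finite[OF I]) (auto simp: F_def)
    also have "\<dots> = (\<Sum>n\<in>I. f (\<Delta> n v / \<Delta> 0 v))"
      by (auto intro!: sum.cong simp: I_def F_def)
    also have "(\<lambda>n. F (Suc n)) = (\<lambda>n. f (\<Delta> (Suc n) v / \<Delta> 0 v))"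
      by (simp add: F_def)
    finally show ?thesis .
  qed
  moreover have "(\<lambda>k. \<Sum>n\<in>I. f (\<Delta> n v / q k) * indicator {..p k} (\<Delta> n v)) \<longlonglongrightarrow>
                 (\<Sum>n\<in>I. f (\<Delta> n v / \<Delta> 0 v))"
  proof (rule tendsto_sum)
    fix n assume "n \<in> I"
    then have n: "\<Delta> n v < \<Delta> 0 v"
      using dec by (auto simp: I_def)
    have "\<forall>\<^sub>F k in sequentially. \<Delta> n v < p k"
      using p(2) n by (rule order_tendstoD)
    then have ev: "\<forall>\<^sub>F k in sequentially. f (\<Delta> n v / q k) = f (\<Delta> n v / q k) * indicator {..p k} (\<Delta> n v)"
      by eventually_elim simp
    have q0: "0 < q k" for k
      using q(1)[of k] pos[of 0] by simp
    have "(\<lambda>k. f (\<Delta> n v / q k)) \<longlonglongrightarrow> f (\<Delta> n v / \<Delta> 0 v)"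
    proof (rule lc[unfolded left_cont_def, rule_format])
      show "(\<lambda>k. \<Delta> n v / q k) \<longlonglongrightarrow> \<Delta> n v / \<Delta> 0 v"
        using pos[of 0] by (intro tendsto_divide tendsto_const q) auto
      show "0 < \<Delta> n v / q k \<and> \<Delta> n v / q k \<le> \<Delta> n v / \<Delta> 0 v" for k
        using pos q0 q(1)[of k] by (auto intro!: divide_left_mono simp: less_imp_le)
    qed (use n pos in auto)
    then show "(\<lambda>k. f (\<Delta> n v / q k) * indicator {..p k} (\<Delta> n v)) \<longlonglongrightarrow> f (\<Delta> n v / \<Delta> 0 v)"
      by (rule tendsto_cong[THEN iffD1, rotated]) (rule ev)
  qed
  ultimately show ?thesis by simp
qed

text \<open>The cutoff of f makes all integrands vanish below \<open>\<epsilon> * t\<close>. Above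
  that level the intensity has finite mass, so the bound 1 is integrable.\<close>

lemma limit_intensity:
  assumes [measurable]: "f \<in> borel_measurable borel"
    and \<epsilon>: "0 < \<epsilon>" and f0: "\<And>s. s \<le> \<epsilon> \<Longrightarrow> f s = 0" and lc: "left_cont f"
    and t: "0 < t" and q: "\<And>k. t \<le> q k" "q \<longlonglongrightarrow> t" and p: "\<And>k. p k < t" "p \<longlonglongrightarrow> t"
  shows "(\<lambda>k. \<integral>\<^sup>+x. 1 - eneg (f (x / q k) * indicator {..p k} x) \<partial>\<rho>) \<longlonglongrightarrow>
         (\<integral>\<^sup>+x. (1 - eneg (f (x / t))) * indicator {..<t} x \<partial>\<rho>)"
proof (rule nn_integral_dominated_convergence[where w="indicator {\<epsilon> * t..}"])
  have q0: "0 < q k" for k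
    using q(1)[of k] t by simp
  show "(\<integral>\<^sup>+x. indicator {\<epsilon> * t..} x \<partial>\<rho>) < \<infinity>"
    using t \<epsilon> sigma_pos by (simp add: stable_intensity_tail)
  have small: "f (x / s) = 0" if "x < \<epsilon> * t" "t \<le> s" for x s
  proof -
    have "x \<le> \<epsilon> * s"
      using that \<epsilon> by (meson less_imp_le mult_left_mono order_trans)
    then show ?thesis
      using t that by (intro f0) (simp add: field_simps)
  qed
  show "AE x in \<rho>. 1 - eneg (f (x / q k) * indicator {..p k} x) \<le> indicator {\<epsilon> * t..} x" for k
    using small[OF _ q(1)[of k]] by (intro AE_I2) (auto simp: indicator_def not_le diff_le_self_ennreal)
  show "AE x in \<rho>. (\<lambda>k. 1 - eneg (f (x / q k) * indicator {..p k} x)) \<longlonglongrightarrow> (1 - eneg (f (x / t))) * indicator {..<t} x"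
  proof (rule AE_I2)
    fix x :: real
    consider "x \<le> 0" | "0 < x" "x < t" | "t \<le> x" by linarith
    then show "(\<lambda>k. 1 - eneg (f (x / q k) * indicator {..p k} x)) \<longlonglongrightarrow> (1 - eneg (f (x / t))) * indicator {..<t} x"
    proof cases
      case 1
      then have "x < \<epsilon> * t"
        using \<epsilon> t by (auto intro: le_less_trans)
      then show ?thesis
        using small[OF _ q(1)] small[of x t] by simp
    next
      case 2
      have "\<forall>\<^sub>F k in sequentially. x < p k"
        using p(2) 2(2) by (rule order_tendstoD)
      then have ev: "\<forall>\<^sub>F k in sequentially. 1 - eneg (f (x / q k)) = 1 - eneg (f (x / q k) * indicator {..p k} x)"
        by eventually_elim simp
      have "(\<lambda>k. f (x / q k)) \<longlonglongrightarrow> f (x / t)"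
      proof (rule lc[unfolded left_cont_def, rule_format])
        show "(\<lambda>k. x / q k) \<longlonglongrightarrow> x / t"
          using t by (intro tendsto_divide tendsto_const q) auto
        show "0 < x / q k \<and> x / q k \<le> x / t" for k
          using 2 t q0 q(1)[of k] by (auto intro!: divide_left_mono simp: less_imp_le)
      qed (use 2 t in auto)
      then have "(\<lambda>k. 1 - eneg (f (x / q k))) \<longlonglongrightarrow> 1 - eneg (f (x / t))"
        by (intro tendsto_diff_ennreal tendsto_eneg tendsto_const) (auto simp: less_top)
      then have "(\<lambda>k. 1 - eneg (f (x / q k) * indicator {..p k} x)) \<longlonglongrightarrow> 1 - eneg (f (x / t))"
        by (rule tendsto_cong[THEN iffD1, rotated]) (rule ev)
      then show ?thesis
        using 2 by simp
    next
      case 3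
      then have "\<not> x \<le> p k" for k
        using p(1)[of k] by simp
      then show ?thesis
        using 3 by simp
    qed
  qed
qed measurable

text \<open>The largest point is rounded up to a grid. On the event that it lies in the cell \<open>(p,q]\<close>, the points
  in \<open>(0,p]\<close> are still an independent Poisson process. Left continuity of \<open>f\<close> suffices for the limit of
  fine grids, because the largest point is replaced by \<open>q\<close> from above.\<close>

lemma ratio_laplace_cutoff:
  assumes f [measurable]: "f \<in> borel_measurable borel"
    and \<epsilon>: "0 < \<epsilon>" and f0: "\<And>s. s \<le> \<epsilon> \<Longrightarrow> f s = 0" and lc: "left_cont f"
    and a: "0 < a"
  shows "(\<integral>\<^sup>+v. indicator {0<..a} (\<Delta> 0 v) * eneg (ratio_sum f v) \<partial>Q) =
         (\<integral>\<^sup>+v. indicator {0<..a} (\<Delta> 0 v) * eneg (ratio_exponent f v) \<partial>Q)"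
proof -
  \<comment> \<open>The number of the cell (p,q] of width a / (k + 1) that contains t. Cells are
    closed on the right and numbered from 1, hence the ceiling.\<close>
  define J where "J k t = nat \<lceil>t * real (Suc k) / a\<rceil>" for k :: nat and t :: real
  define q where "q k j = a * real j / real (Suc k)" for k j :: nat
  define p where "p k j = a * (real j - 1) / real (Suc k)" for k j :: nat
  define h where "h k j x = f (x / q k j) * indicator {..p k j} x" for k j :: nat and x
  have [measurable]: "h k j \<in> borel_measurable borel" for k j
    unfolding h_def by measurable
  have pq: "p k j \<le> q k j" for k j
    using a by (simp add: p_def q_def divide_right_mono mult_left_mono)
  have J_iff: "J k t = j \<longleftrightarrow> p k j < t \<and> t \<le> q k j" if "1 \<le> j" for k t j
  proof -
    have "J k t = j \<longleftrightarrow> \<lceil>t * real (Suc k) / a\<rceil> = int j"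
      using that by (auto simp: J_def)
    also have "\<dots> \<longleftrightarrow> real j - 1 < t * real (Suc k) / a \<and> t * real (Suc k) / a \<le> real j"
      by (simp add: ceiling_eq_iff)
    also have "\<dots> \<longleftrightarrow> p k j < t \<and> t \<le> q k j"
      using a unfolding p_def q_def by (simp add: field_simps del: of_nat_Suc)
    finally show ?thesis .
  qed
  have J_range: "J k t \<in> {1..Suc k}" if "0 < t" "t \<le> a" for k t
  proof -
    have "0 < t * real (Suc k) / a" "t * real (Suc k) / a \<le> real (Suc k)"
      using that a by (auto simp: field_simps simp del: of_nat_Suc intro!: mult_right_mono)
    then have "0 < \<lceil>t * real (Suc k) / a\<rceil>" "\<lceil>t * real (Suc k) / a\<rceil> \<le> int (Suc k)"
      by (auto simp: ceiling_le_iff simp del: of_nat_Suc)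
    then have "1 \<le> nat \<lceil>t * real (Suc k) / a\<rceil>" "nat \<lceil>t * real (Suc k) / a\<rceil> \<le> Suc k"
      by linarith+
    then show ?thesis
      by (simp add: J_def)
  qed
  have cells: "{p k j<..q k j} \<subseteq> {0<..a}" if "j \<in> {1..Suc k}" for k j
  proof -
    have "0 \<le> p k j" "q k j \<le> a"
      using that a mult_left_mono[of "real j" "real (Suc k)" a]
      by (auto simp: p_def q_def pos_divide_le_eq simp del: of_nat_Suc)
    then show ?thesis by auto
  qed
  \<comment> \<open>The random cell number is resolved into a finite sum over fixed cells, so that
    each summand involves a deterministic function \<open>h k j\<close> and falls under
    \<open>laplace_cell\<close>.\<close>
  have split: "indicator {0<..a} t * G (J k t) = (\<Sum>j=1..Suc k. indicator {p k j<..q k j} t * G j)"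
    for t k and G :: "nat \<Rightarrow> ennreal"
  proof (cases "0 < t \<and> t \<le> a")
    case True
    then have "(\<Sum>j=1..Suc k. indicator {p k j<..q k j} t * G j) = (\<Sum>j=1..Suc k. if j = J k t then G j else 0)"
    proof (intro sum.cong refl)
      fix j assume "j \<in> {1..Suc k}"
      then have "t \<in> {p k j<..q k j} \<longleftrightarrow> J k t = j"
        using J_iff[of j k t] by auto
      then show "indicator {p k j<..q k j} t * G j = (if j = J k t then G j else 0)"
        by (auto simp: indicator_def)
    qed
    then show ?thesis
      using J_range[of t k] True by (simp add: sum.delta')
  next
    case False
    then have "indicator {p k j<..q k j} t = (0::ennreal)" if "j \<in> {1..Suc k}" for j
      using cells[OF that] by (auto simp: indicator_def)
    then have "(\<Sum>j=1..Suc k. indicator {p k j<..q k j} t * G j) = 0"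
      by (intro sum.neutral) auto
    then show ?thesis
      using False by (auto simp: indicator_def)
  qed
  have bounds: "p k (J k t) < t" "t \<le> q k (J k t)" "q k (J k t) \<le> t + a / real (Suc k)"
    "t - a / real (Suc k) \<le> p k (J k t)" if "0 < t" "t \<le> a" for k t
  proof -
    have "1 \<le> J k t"
      using J_range[OF that, of k] by simp
    from J_iff[OF this, of k t] show 1: "p k (J k t) < t" "t \<le> q k (J k t)" by auto
    have "q k (J k t) = p k (J k t) + a / real (Suc k)"
      unfolding p_def q_def by (simp add: diff_divide_distrib algebra_simps)
    then show "q k (J k t) \<le> t + a / real (Suc k)" "t - a / real (Suc k) \<le> p k (J k t)"
      using 1 by auto
  qed
  have a0: "(\<lambda>k. a / real (Suc k)) \<longlonglongrightarrow> 0"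
    by (intro real_tendsto_divide_at_top[OF tendsto_const] filterlim_compose[OF filterlim_real_sequentially filterlim_Suc])
  have limq: "(\<lambda>k. q k (J k t)) \<longlonglongrightarrow> t" and limp: "(\<lambda>k. p k (J k t)) \<longlonglongrightarrow> t" if "0 < t" "t \<le> a" for t
  proof -
    show "(\<lambda>k. q k (J k t)) \<longlonglongrightarrow> t"
    proof (rule tendsto_sandwich)
      show "\<forall>\<^sub>F k in sequentially. t \<le> q k (J k t)"
        "\<forall>\<^sub>F k in sequentially. q k (J k t) \<le> t + a / real (Suc k)"
        using bounds[OF that] by (auto intro: always_eventually)
      show "(\<lambda>k. t + a / real (Suc k)) \<longlonglongrightarrow> t"
        using tendsto_add[OF tendsto_const a0, of t] by simp
    qed simp
    show "(\<lambda>k. p k (J k t)) \<longlonglongrightarrow> t"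
    proof (rule tendsto_sandwich)
      show "\<forall>\<^sub>F k in sequentially. t - a / real (Suc k) \<le> p k (J k t)"
        "\<forall>\<^sub>F k in sequentially. p k (J k t) \<le> t"
        using bounds[OF that] by (auto intro: always_eventually less_imp_le)
      show "(\<lambda>k. t - a / real (Suc k)) \<longlonglongrightarrow> t"
        using tendsto_diff[OF tendsto_const a0, of t] by simp
    qed simp
  qed
  define L where "L k v = indicator {0<..a} (\<Delta> 0 v) * eneg (\<Sum>n. h k (J k (\<Delta> 0 v)) (\<Delta> n v))" for k v
  define U where "U k v = indicator {0<..a} (\<Delta> 0 v) * eneg (\<integral>\<^sup>+x. 1 - eneg (h k (J k (\<Delta> 0 v)) x) \<partial>\<rho>)" for k v
  have L_eq: "L k v = (\<Sum>j=1..Suc k. indicator {p k j<..q k j} (\<Delta> 0 v) * eneg (\<Sum>n. h k j (\<Delta> n v)))" for k v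
    unfolding L_def by (rule split)
  have U_eq: "U k v = (\<Sum>j=1..Suc k. indicator {p k j<..q k j} (\<Delta> 0 v) * eneg (\<integral>\<^sup>+x. 1 - eneg (h k j x) \<partial>\<rho>))" for k v
    unfolding U_def by (rule split)
  have [measurable]: "L k \<in> borel_measurable Q" "U k \<in> borel_measurable Q" for k
    unfolding L_eq[abs_def] U_eq[abs_def] by measurable
  have LU: "(\<integral>\<^sup>+v. L k v \<partial>Q) = (\<integral>\<^sup>+v. U k v \<partial>Q)" for k
  proof -
    have "(\<integral>\<^sup>+v. L k v \<partial>Q) = (\<Sum>j=1..Suc k. \<integral>\<^sup>+v. indicator {p k j<..q k j} (\<Delta> 0 v) * eneg (\<Sum>n. h k j (\<Delta> n v)) \<partial>Q)"
      unfolding L_eq by (rule nn_integral_sum) measurable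
    also have "\<dots> = (\<Sum>j=1..Suc k. \<integral>\<^sup>+v. indicator {p k j<..q k j} (\<Delta> 0 v) * eneg (\<integral>\<^sup>+x. 1 - eneg (h k j x) \<partial>\<rho>) \<partial>Q)"
      by (intro sum.cong refl laplace_cell pq) (auto simp: h_def)
    also have "\<dots> = (\<integral>\<^sup>+v. U k v \<partial>Q)"
      unfolding U_eq by (rule nn_integral_sum[symmetric]) measurable
    finally show ?thesis .
  qed
  have "(\<lambda>k. \<integral>\<^sup>+v. L k v \<partial>Q) \<longlonglongrightarrow>
        (\<integral>\<^sup>+v. indicator {0<..a} (\<Delta> 0 v) * eneg (ratio_sum f v) \<partial>Q)"
  proof (rule nn_integral_dominated_convergence[where w="\<lambda>_. 1"])
    show "AE v in Q. L k v \<le> 1" for k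
      by (intro AE_I2) (auto simp: L_def indicator_def eneg_le_1)
    show "AE v in Q. (\<lambda>k. L k v) \<longlonglongrightarrow> indicator {0<..a} (\<Delta> 0 v) * eneg (ratio_sum f v)"
      using AE_points
    proof eventually_elim
      case (elim v)
      show ?case
      proof (cases "\<Delta> 0 v \<le> a")
        case True
        have "(\<lambda>k. \<Sum>n. f (\<Delta> n v / q k (J k (\<Delta> 0 v))) * indicator {..p k (J k (\<Delta> 0 v))} (\<Delta> n v)) \<longlonglongrightarrow>
              (ratio_sum f v)"
          using elim True by (intro limit_points[OF \<epsilon> f0 lc]) (auto intro!: limq limp bounds)
        then show ?thesis
          using True elim by (auto simp: L_def h_def intro!: tendsto_eneg)
      qed (auto simp: L_def)
    qed
  qed (auto simp: emeasure_space_1)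
  moreover have "(\<lambda>k. \<integral>\<^sup>+v. U k v \<partial>Q) \<longlonglongrightarrow>
        (\<integral>\<^sup>+v. indicator {0<..a} (\<Delta> 0 v) * eneg (ratio_exponent f v) \<partial>Q)"
  proof (rule nn_integral_dominated_convergence[where w="\<lambda>_. 1"])
    show "AE v in Q. U k v \<le> 1" for k
      by (intro AE_I2) (auto simp: U_def indicator_def eneg_le_1)
    show "AE v in Q. (\<lambda>k. U k v) \<longlonglongrightarrow> indicator {0<..a} (\<Delta> 0 v) * eneg (ratio_exponent f v)"
    proof (rule AE_I2)
      fix v
      show "(\<lambda>k. U k v) \<longlonglongrightarrow> indicator {0<..a} (\<Delta> 0 v) * eneg (ratio_exponent f v)"
      proof (cases "0 < \<Delta> 0 v \<and> \<Delta> 0 v \<le> a")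
        case True
        have "(\<lambda>k. \<integral>\<^sup>+x. 1 - eneg (h k (J k (\<Delta> 0 v)) x) \<partial>\<rho>) \<longlonglongrightarrow>
              (\<integral>\<^sup>+x. (1 - eneg (f (x / \<Delta> 0 v))) * indicator {..<\<Delta> 0 v} x \<partial>\<rho>)"
          unfolding h_def
          using True by (intro limit_intensity[OF f \<epsilon> f0 lc]) (auto intro!: limq limp bounds)
        also have "(\<integral>\<^sup>+x. (1 - eneg (f (x / \<Delta> 0 v))) * indicator {..<\<Delta> 0 v} x \<partial>\<rho>) =
                   ennreal (\<Delta> 0 v powr (- \<sigma>)) * K_fun f"
          using True by (intro K_fun_scale) auto
        finally show ?thesis
          using True by (auto simp: U_def intro!: tendsto_eneg)
      qed (auto simp: U_def)
    qed
  qed (auto simp: emeasure_space_1)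
  ultimately show ?thesis
    unfolding LU by (rule LIMSEQ_unique)
qed

text \<open>The cutoff near 0 is removed by increasing truncations of f; the sums over points and
  the exponents converge monotonically, the integrals by domination by 1.\<close>

lemma ratio_laplace_interval:
  assumes f [measurable]: "f \<in> borel_measurable borel" and lc: "left_cont f"
  shows "(\<integral>\<^sup>+v. indicator {..a} (\<Delta> 0 v) * eneg (ratio_sum f v) \<partial>Q) =
         (\<integral>\<^sup>+v. indicator {..a} (\<Delta> 0 v) * eneg (ratio_exponent f v) \<partial>Q)"
proof (cases "0 < a")
  case a: True
  \<comment> \<open>The strict inequality keeps the truncation left continuous: its value is 0 at
    the cut itself and everywhere below.\<close>
  define F where "F j s = f s * indicator {1 / real (Suc j)<..} s" for j s
  have [measurable]: "F j \<in> borel_measurable borel" for j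
    unfolding F_def by measurable
  have inc: "incseq (\<lambda>j. F j s)" for s
  proof (rule incseq_SucI)
    fix j
    have "1 / real (Suc (Suc j)) \<le> 1 / real (Suc j)"
      by (intro divide_left_mono) auto
    then show "F j s \<le> F (Suc j) s"
      by (auto simp: F_def indicator_def simp del: of_nat_Suc)
  qed
  have lim: "(\<lambda>j. F j s) \<longlonglongrightarrow> f s" if "0 < s" for s
  proof -
    obtain j0 where j0: "1 / real (Suc j0) < s"
      using \<open>0 < s\<close> by (metis nat_approx_posE)
    have "\<forall>\<^sub>F j in sequentially. f s = F j s"
      using eventually_ge_at_top[of j0]
    proof eventually_elim
      case (elim j)
      then have "1 / real (Suc j) \<le> 1 / real (Suc j0)"
        by (intro divide_left_mono) auto
      then show ?case
        using j0 by (auto simp: F_def)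
    qed
    then show ?thesis
      by (rule tendsto_cong[THEN iffD1]) (rule tendsto_const)
  qed
  have "left_cont (F j)" for j
    unfolding left_cont_def
  proof (intro allI impI)
    fix s :: real and X :: "nat \<Rightarrow> real"
    assume s: "0 < s" "s < 1" and X: "\<forall>k. 0 < X k \<and> X k \<le> s" "X \<longlonglongrightarrow> s"
    show "(\<lambda>k. F j (X k)) \<longlonglongrightarrow> F j s"
    proof (cases "1 / real (Suc j) < s")
      case True
      have "(\<lambda>k. f (X k)) \<longlonglongrightarrow> f s"
        using lc s X by (auto simp: left_cont_def)
      moreover have "\<forall>\<^sub>F k in sequentially. f (X k) = F j (X k)"
        using order_tendstoD(1)[OF X(2) True] by eventually_elim (simp add: F_def)
      ultimately have "(\<lambda>k. F j (X k)) \<longlonglongrightarrow> f s"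
        by (simp add: tendsto_cong)
      then show ?thesis
        using True by (simp add: F_def)
    next
      case False
      then have "\<not> 1 / real (Suc j) < X k" for k
        using X(1)[rule_format, of k] by linarith
      then show ?thesis
        using False by (simp add: F_def)
    qed
  qed
  note lcF = this
  have *: "(\<integral>\<^sup>+v. indicator {0<..a} (\<Delta> 0 v) * eneg (ratio_sum (F j) v) \<partial>Q) =
         (\<integral>\<^sup>+v. indicator {0<..a} (\<Delta> 0 v) * eneg (ratio_exponent (F j) v) \<partial>Q)" for j
  proof (rule ratio_laplace_cutoff)
    show "0 < 1 / real (Suc j)" by simp
    show "F j s = 0" if "s \<le> 1 / real (Suc j)" for s
      using that by (simp add: F_def)
  qed (use a lcF in auto)
  have limK: "(\<lambda>j. K_fun (F j)) \<longlonglongrightarrow> K_fun f"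
    unfolding jump_exponent_def
  proof (rule nn_integral_LIMSEQ)
    show "incseq (\<lambda>j s. (1 - eneg (F j s)) * indicator {0<..<1} s)"
      using inc by (auto simp: incseq_def le_fun_def intro!: mult_right_mono ennreal_minus_mono eneg_antimono)
    show "(\<lambda>j. (1 - eneg (F j s)) * indicator {0<..<1} s) \<longlonglongrightarrow> (1 - eneg (f s)) * indicator {0<..<1} s" for s
      using lim[of s] by (cases "0 < s \<and> s < 1")
        (auto intro!: tendsto_diff_ennreal tendsto_eneg tendsto_const)
  qed measurable
  have "(\<lambda>j. \<integral>\<^sup>+v. indicator {0<..a} (\<Delta> 0 v) * eneg (ratio_sum (F j) v) \<partial>Q) \<longlonglongrightarrow>
        (\<integral>\<^sup>+v. indicator {0<..a} (\<Delta> 0 v) * eneg (ratio_sum f v) \<partial>Q)"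
  proof (rule nn_integral_dominated_convergence[where w="\<lambda>_. 1"])
    show "AE v in Q. (\<lambda>j. indicator {0<..a} (\<Delta> 0 v) * eneg (ratio_sum (F j) v)) \<longlonglongrightarrow>
                     indicator {0<..a} (\<Delta> 0 v) * eneg (ratio_sum f v)"
      using AE_points
    proof eventually_elim
      case (elim v)
      have SUP: "(SUP j. F j (\<Delta> (Suc n) v / \<Delta> 0 v)) = f (\<Delta> (Suc n) v / \<Delta> 0 v)" for n
        using LIMSEQ_unique[OF LIMSEQ_SUP[OF inc] lim] elim by simp
      have "(\<Sum>n. SUP j. F j (\<Delta> (Suc n) v / \<Delta> 0 v)) = (SUP j. ratio_sum (F j) v)"
        using inc by (intro ennreal_suminf_SUP_eq) auto
      moreover have "incseq (\<lambda>j. ratio_sum (F j) v)"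
        using inc by (auto simp: incseq_def intro!: suminf_le)
      ultimately have "(\<lambda>j. ratio_sum (F j) v) \<longlonglongrightarrow> (ratio_sum f v)"
        using LIMSEQ_SUP[of "\<lambda>j. ratio_sum (F j) v"] by (simp add: SUP)
      then show ?case
        by (cases "0 < \<Delta> 0 v \<and> \<Delta> 0 v \<le> a") (auto intro!: tendsto_eneg)
    qed
    show "AE v in Q. indicator {0<..a} (\<Delta> 0 v) * eneg (ratio_sum (F j) v) \<le> 1" for j
      by (intro AE_I2) (auto simp: indicator_def eneg_le_1)
  qed (auto simp: emeasure_space_1)
  moreover have "(\<lambda>j. \<integral>\<^sup>+v. indicator {0<..a} (\<Delta> 0 v) * eneg (ratio_exponent (F j) v) \<partial>Q) \<longlonglongrightarrow>
        (\<integral>\<^sup>+v. indicator {0<..a} (\<Delta> 0 v) * eneg (ratio_exponent f v) \<partial>Q)"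
  proof (rule nn_integral_dominated_convergence[where w="\<lambda>_. 1"])
    show "AE v in Q. (\<lambda>j. indicator {0<..a} (\<Delta> 0 v) * eneg (ratio_exponent (F j) v)) \<longlonglongrightarrow>
                     indicator {0<..a} (\<Delta> 0 v) * eneg (ratio_exponent f v)"
    proof (rule AE_I2)
      fix v
      show "(\<lambda>j. indicator {0<..a} (\<Delta> 0 v) * eneg (ratio_exponent (F j) v)) \<longlonglongrightarrow>
            indicator {0<..a} (\<Delta> 0 v) * eneg (ratio_exponent f v)"
        using limK by (cases "0 < \<Delta> 0 v \<and> \<Delta> 0 v \<le> a")
          (auto intro!: tendsto_eneg ennreal_tendsto_cmult)
    qed
    show "AE v in Q. indicator {0<..a} (\<Delta> 0 v) * eneg (ratio_exponent (F j) v) \<le> 1" for j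
      by (intro AE_I2) (auto simp: indicator_def eneg_le_1)
  qed (auto simp: emeasure_space_1)
  ultimately have "(\<integral>\<^sup>+v. indicator {0<..a} (\<Delta> 0 v) * eneg (ratio_sum f v) \<partial>Q) =
         (\<integral>\<^sup>+v. indicator {0<..a} (\<Delta> 0 v) * eneg (ratio_exponent f v) \<partial>Q)"
    unfolding * by (rule LIMSEQ_unique)
  moreover have "AE v in Q. indicator {..a} (\<Delta> 0 v) = (indicator {0<..a} (\<Delta> 0 v) :: ennreal)"
    using AE_points by eventually_elim (auto simp: indicator_def)
  then have "(\<integral>\<^sup>+v. indicator {..a} (\<Delta> 0 v) * G v \<partial>Q) = (\<integral>\<^sup>+v. indicator {0<..a} (\<Delta> 0 v) * G v \<partial>Q)" for G
    by (intro nn_integral_cong_AE) auto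
  ultimately show ?thesis by simp
next
  case False
  have "AE v in Q. indicator {..a} (\<Delta> 0 v) = (0 :: ennreal)"
    using AE_points
  proof eventually_elim
    case (elim v)
    then show ?case
      using False by (auto simp: indicator_def not_less intro: order_trans dest: spec[of _ 0])
  qed
  then have "(\<integral>\<^sup>+v. indicator {..a} (\<Delta> 0 v) * G v \<partial>Q) = 0" for G
    by (subst nn_integral_cong_AE[where v="\<lambda>_. 0"]) auto
  then show ?thesis by simp
qed

text \<open>As functionals of g, both sides are integrals against images of Q with densities at most
  1. These finite measures agree on the half-lines \<open>{..a}\<close> and are therefore
  equal.\<close>

theorem ratio_laplace:
  assumes f [measurable]: "f \<in> borel_measurable borel" and lc: "left_cont f"
    and g [measurable]: "g \<in> borel_measurable borel"
  shows "(\<integral>\<^sup>+v. g (\<Delta> 0 v) * eneg (ratio_sum f v) \<partial>Q) =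
         (\<integral>\<^sup>+v. g (\<Delta> 0 v) * eneg (ratio_exponent f v) \<partial>Q)"
proof -
  define \<nu>1 where "\<nu>1 = distr (density Q (\<lambda>v. eneg (ratio_sum f v))) borel (\<Delta> 0)"
  define \<nu>2 where "\<nu>2 = distr (density Q (\<lambda>v. eneg (ratio_exponent f v))) borel (\<Delta> 0)"
  have int1: "(\<integral>\<^sup>+t. g t \<partial>\<nu>1) = (\<integral>\<^sup>+v. g (\<Delta> 0 v) * eneg (ratio_sum f v) \<partial>Q)"
    if [measurable]: "g \<in> borel_measurable borel" for g
    unfolding \<nu>1_def by (simp add: nn_integral_distr nn_integral_density mult.commute)
  have int2: "(\<integral>\<^sup>+t. g t \<partial>\<nu>2) = (\<integral>\<^sup>+v. g (\<Delta> 0 v) * eneg (ratio_exponent f v) \<partial>Q)"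
    if [measurable]: "g \<in> borel_measurable borel" for g
    unfolding \<nu>2_def by (simp add: nn_integral_distr nn_integral_density mult.commute)
  have sets: "sets \<nu>1 = sets borel" "sets \<nu>2 = sets borel"
    by (simp_all add: \<nu>1_def \<nu>2_def)
  have em: "emeasure \<nu>1 {..a} = emeasure \<nu>2 {..a}" for a
    using ratio_laplace_interval[OF f lc, of a] int1[of "indicator {..a}"] int2[of "indicator {..a}"]
    by (simp add: sets)
  have "\<nu>1 = \<nu>2"
  proof (rule measure_eqI_generator_eq[where E="range atMost" and A="\<lambda>i. {..real i}" and \<Omega>=UNIV])
    show "Int_stable (range (atMost :: real \<Rightarrow> real set))"
      by (auto simp: Int_stable_def)
    show "sets \<nu>1 = sigma_sets UNIV (range atMost)" "sets \<nu>2 = sigma_sets UNIV (range atMost)"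
      by (simp_all add: sets borel_eq_atMost)
    show "(\<Union>i. {..real i}) = UNIV"
      by (auto intro: real_arch_simple)
    have "emeasure \<nu>1 {..a} \<le> 1" for a
    proof -
      have "emeasure \<nu>1 {..a} = (\<integral>\<^sup>+v. indicator {..a} (\<Delta> 0 v) * eneg (ratio_sum f v) \<partial>Q)"
        using int1[of "indicator {..a}"] by (simp add: sets)
      also have "\<dots> \<le> (\<integral>\<^sup>+v. 1 \<partial>Q)"
        by (intro nn_integral_mono) (auto simp: indicator_def eneg_le_1)
      finally show ?thesis
        by (simp add: emeasure_space_1)
    qed
    then show "emeasure \<nu>1 {..real i} \<noteq> \<infinity>" for i
      by (metis ennreal_one_less_top infinity_ennreal_def not_le)
  qed (use em in auto)
  then show ?thesis
    using int1[of g] int2[of g] by simp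
qed

end

section \<open>The law of the largest point and the tilted process\<close>

context stable_points
begin

text \<open>No point exceeds x > 0 with probability \<open>exp (- (x powr (- \<sigma>)))\<close>,
  the mass that the intensity gives to the tail being \<open>x powr (- \<sigma>)\<close>.
  Differentiation of this distribution function yields the density.\<close>

lemma distr_largest_point: "distr Q borel (\<Delta> 0) = density lborel (\<lambda>s. ennreal (largest_jump_density \<sigma> s))"
  (is "?L = ?R")
proof (rule measure_eqI_lessThan)
  have Q_le: "emeasure Q {v \<in> space Q. \<Delta> 0 v \<le> q} = eneg (emeasure \<rho> {q<..})" for q
  proof -
    have "emeasure Q {v \<in> space Q. \<Delta> 0 v \<le> q} = (\<integral>\<^sup>+v. indicator {v \<in> space Q. \<Delta> 0 v \<le> q} v \<partial>Q)"
      by simp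
    also have "\<dots> = (\<integral>\<^sup>+v. indicator {..q} (\<Delta> 0 v) * eneg (\<Sum>n. (\<lambda>_. 0) (\<Delta> n v)) \<partial>Q)"
      by (intro nn_integral_cong) (simp add: indicator_def)
    also have "\<dots> = eneg (\<integral>\<^sup>+x. 1 - eneg 0 \<partial>\<rho>) * eneg (emeasure \<rho> {q<..})"
      by (rule laplace_below) auto
    finally show ?thesis
      by simp
  qed
  have tail: "emeasure \<rho> {x<..} = ennreal (x powr (- \<sigma>))" if "0 < x" for x
  proof -
    have "emeasure \<rho> {x<..} = emeasure \<rho> {x..}"
      unfolding stable_intensity_def using AE_lborel_singleton[of x]
      by (intro emeasure_eq_AE) (auto simp: AE_density)
    then show ?thesis
      using stable_intensity_tail[OF sigma_pos that] by simp
  qed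
  have Lx: "emeasure ?L {x<..} = ennreal (1 - exp (- (x powr (- \<sigma>))))" if "0 < x" for x
  proof -
    have "emeasure ?L {x<..} = emeasure Q {v \<in> space Q. x < \<Delta> 0 v}"
      by (auto simp: emeasure_distr intro!: arg_cong[where f="emeasure Q"])
    also have "{v \<in> space Q. x < \<Delta> 0 v} = space Q - {v \<in> space Q. \<Delta> 0 v \<le> x}"
      by auto
    also have "emeasure Q \<dots> = 1 - emeasure Q {v \<in> space Q. \<Delta> 0 v \<le> x}"
      by (subst emeasure_Diff) (auto simp: emeasure_space_1)
    also have "\<dots> = ennreal (1 - exp (- (x powr (- \<sigma>))))"
      unfolding Q_le tail[OF that] by (subst eneg_ennreal) (auto simp: ennreal_minus simp flip: ennreal_1)
    finally show ?thesis .
  qed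
  have Rx: "emeasure ?R {x<..} = ennreal (1 - exp (- (x powr (- \<sigma>))))" if x: "0 < x" for x
  proof -
    have "emeasure ?R {x<..} = emeasure ?R {x..}"
      using AE_lborel_singleton[of x]
      by (intro emeasure_eq_AE) (auto simp: AE_density largest_jump_density_def)
    also have "\<dots> = (\<integral>\<^sup>+s. ennreal (\<sigma> * s powr (- 1 - \<sigma>) * exp (- (s powr (- \<sigma>)))) * indicator {x..} s \<partial>lborel)"
      using x by (subst emeasure_density) (auto intro!: nn_integral_cong simp: indicator_def largest_jump_density_def)
    also have "\<dots> = ennreal (1 - exp (- (x powr (- \<sigma>))))"
    proof (rule nn_integral_FTC_atLeast)
      have "((\<lambda>s. exp (- (s powr (- \<sigma>)))) \<longlongrightarrow> exp (- 0)) at_top"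
        using sigma_pos by (intro tendsto_intros tendsto_neg_powr filterlim_ident) auto
      then show "((\<lambda>s. exp (- (s powr (- \<sigma>)))) \<longlongrightarrow> 1) at_top"
        by simp
      fix s assume "x \<le> s"
      then show "((\<lambda>s. exp (- (s powr (- \<sigma>)))) has_real_derivative \<sigma> * s powr (- 1 - \<sigma>) * exp (- (s powr (- \<sigma>)))) (at s)"
        using x by (auto intro!: derivative_eq_intros simp: powr_diff powr_minus field_simps)
    qed (use sigma_pos in auto)
    finally show ?thesis .
  qed
  \<comment> \<open>The tail formula covers positive x only; the total mass, needed for x <= 0, is
    its limit as x decreases to 0.\<close>
  have R0: "emeasure ?R {0<..} = 1"
  proof -
    have "(\<lambda>n. emeasure ?R {1 / real (Suc n)<..}) \<longlonglongrightarrow> emeasure ?R (\<Union>n. {1 / real (Suc n)<..})"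
    proof (rule Lim_emeasure_incseq)
      show "incseq (\<lambda>n. {1 / real (Suc n)<..})"
        by (auto simp: incseq_def intro: le_less_trans[rotated] divide_left_mono)
    qed auto
    also have "(\<Union>n. {1 / real (Suc n)<..}) = {0<..}"
    proof -
      have "\<exists>n. 1 / real (Suc n) < x" if "0 < x" for x :: real
        using that by (metis nat_approx_posE)
      then show ?thesis
        by (auto simp del: of_nat_Suc intro: less_trans[rotated])
    qed
    finally have 1: "(\<lambda>n. emeasure ?R {1 / real (Suc n)<..}) \<longlonglongrightarrow> emeasure ?R {0<..}" .
    have "filterlim (\<lambda>n. real (Suc n) powr \<sigma>) at_top sequentially"
      using sigma_pos by real_asymp
    then have "(\<lambda>n. 1 - exp (- (real (Suc n) powr \<sigma>))) \<longlonglongrightarrow> 1 - 0"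
      by (intro tendsto_intros filterlim_compose[OF exp_at_bot] filterlim_uminus_at_top[THEN iffD1])
    then have "(\<lambda>n. ennreal (1 - exp (- (real (Suc n) powr \<sigma>)))) \<longlonglongrightarrow> ennreal (1 - 0)"
      by (rule tendsto_ennrealI)
    then have "(\<lambda>n. emeasure ?R {1 / real (Suc n)<..}) \<longlonglongrightarrow> 1"
      by (simp add: Rx powr_minus powr_divide)
    from LIMSEQ_unique[OF 1 this] show ?thesis by simp
  qed
  show "emeasure ?L {x<..} = emeasure ?R {x<..}" for x
  proof (cases "0 < x")
    case False
    have "emeasure ?L {x<..} = emeasure Q {v \<in> space Q. x < \<Delta> 0 v}"
      by (auto simp: emeasure_distr intro!: arg_cong[where f="emeasure Q"])
    also have "\<dots> = emeasure Q (space Q)"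
    proof (rule emeasure_eq_AE)
      show "AE v in Q. v \<in> {v \<in> space Q. x < \<Delta> 0 v} \<longleftrightarrow> v \<in> space Q"
        using AE_points by eventually_elim (use False in \<open>auto simp: not_less intro: le_less_trans\<close>)
    qed auto
    also have "\<dots> = emeasure ?R {0<..}"
      by (simp add: R0 emeasure_space_1)
    also have "\<dots> = emeasure ?R {x<..}"
      using False by (intro emeasure_eq_AE) (auto simp: AE_density largest_jump_density_def indicator_def intro!: AE_I2)
    finally show ?thesis .
  qed (simp add: Lx Rx)
  show "emeasure ?L {x<..} < \<infinity>" for x
    by (auto simp: emeasure_distr less_top[symmetric])
qed (auto simp: largest_jump_density_def[abs_def])

end

text \<open>The same G disintegrates the ratios on Q and the jumps on M, over laws of the first
  coordinate that differ by the density \<open>tilting\<close>. So means over the jumps are weighted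
  means over the ratios.\<close>

lemma scaled_jump_kernel_transfer:
  assumes "0 < \<sigma>" "0 < \<beta>" "0 < c" and "prob_space M"
    and G: "is_cond_distr Q (\<Delta> 0) borel (\<lambda>v n. \<Delta> (Suc n) v / \<Delta> 0 v) (PiM UNIV (\<lambda>_. borel)) G"
    and Q: "stable_points Q \<sigma> \<Delta>"
    and D: "distributed M lborel \<Delta>h (\<lambda>s. ennreal (tilting c \<beta> \<sigma> s * largest_jump_density \<sigma> s))"
    and \<theta>: "is_cond_distr M \<Delta>h borel (\<lambda>w n. \<theta> n w) (PiM UNIV (\<lambda>_. borel)) G"
    and \<phi> [measurable]: "\<phi> \<in> borel_measurable (PiM UNIV (\<lambda>_. borel))"
  shows "(\<integral>\<^sup>+w. \<phi> (\<lambda>n. \<theta> n w) \<partial>M) =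
         (\<integral>\<^sup>+v. ennreal (tilting c \<beta> \<sigma> (\<Delta> 0 v)) * \<phi> (\<lambda>n. \<Delta> (Suc n) v / \<Delta> 0 v) \<partial>Q)"
proof -
  interpret Q: stable_points Q \<sigma> \<Delta> by fact
  have [measurable]: "G \<in> measurable borel (subprob_algebra (PiM UNIV (\<lambda>_. borel)))"
    using G by (auto simp: is_cond_distr_def dest: measurable_prob_algebraD)
  have [measurable]: "tilting c \<beta> \<sigma> \<in> borel_measurable borel" "largest_jump_density \<sigma> \<in> borel_measurable borel"
    unfolding tilting_def largest_jump_density_def by measurable
  define I where "I t = (\<integral>\<^sup>+y. \<phi> y \<partial>G t)" for t
  have [measurable]: "I \<in> borel_measurable borel"
    unfolding I_def by measurable
  have nonneg: "0 \<le> tilting c \<beta> \<sigma> s" "0 \<le> largest_jump_density \<sigma> s" for s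
    using assms by (auto simp: tilting_def largest_jump_density_def intro!: mult_nonneg_nonneg divide_nonneg_nonneg Gamma_real_nonneg)
  have "(\<integral>\<^sup>+w. \<phi> (\<lambda>n. \<theta> n w) \<partial>M) = (\<integral>\<^sup>+w. (\<lambda>(t, y). \<phi> y) (\<Delta>h w, \<lambda>n. \<theta> n w) \<partial>M)"
    by simp
  also have "\<dots> = (\<integral>\<^sup>+t. I t \<partial>distr M borel \<Delta>h)"
    by (subst is_cond_distr_nn_integral[OF \<open>prob_space M\<close> \<theta>]) (auto simp: I_def[abs_def])
  also have "distr M borel \<Delta>h = distr M lborel \<Delta>h"
    by (rule distr_cong) auto
  also have "\<dots> = density lborel (\<lambda>s. ennreal (tilting c \<beta> \<sigma> s * largest_jump_density \<sigma> s))"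
    using D by (rule distributed_distr_eq_density)
  also have "(\<integral>\<^sup>+t. I t \<partial>\<dots>) = (\<integral>\<^sup>+s. ennreal (largest_jump_density \<sigma> s) * (ennreal (tilting c \<beta> \<sigma> s) * I s) \<partial>lborel)"
    by (subst nn_integral_density) (auto intro!: nn_integral_cong simp: ennreal_mult nonneg mult_ac)
  also have "\<dots> = (\<integral>\<^sup>+s. ennreal (tilting c \<beta> \<sigma> s) * I s \<partial>distr Q borel (\<Delta> 0))"
    unfolding Q.distr_largest_point by (subst nn_integral_density) auto
  also have "\<dots> = (\<integral>\<^sup>+s. (\<integral>\<^sup>+y. ennreal (tilting c \<beta> \<sigma> s) * \<phi> y \<partial>G s) \<partial>distr Q borel (\<Delta> 0))"
    unfolding I_def
    using measurable_space[OF \<open>G \<in> measurable borel (subprob_algebra (PiM UNIV (\<lambda>_. borel)))\<close>]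
    by (intro nn_integral_cong nn_integral_cmult[symmetric])
       (auto simp: space_subprob_algebra cong: measurable_cong_sets)
  also have "\<dots> = (\<integral>\<^sup>+v. (\<lambda>(s, y). ennreal (tilting c \<beta> \<sigma> s) * \<phi> y) (\<Delta> 0 v, \<lambda>n. \<Delta> (Suc n) v / \<Delta> 0 v) \<partial>Q)"
    by (subst is_cond_distr_nn_integral[OF Q.prob_space_axioms G]) auto
  finally show ?thesis by simp
qed

text \<open>\<Psi> maps K to the tilted mean of
  \<open>eneg (ennreal (\<Delta> 0 v powr (- \<sigma>)) * K)\<close>. Its values are never computed;
  what matters is that it is the same function for all f, so that equal exponents give equal
  means.\<close>

theorem SBSP_jumps:
  assumes "0 < \<sigma>" "0 < \<beta>" "0 < c" "prob_space M" and SB: "SBSP M \<beta> \<sigma> c \<theta> \<omega> \<Theta>"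
  obtains \<Psi> :: "ennreal \<Rightarrow> ennreal"
  where "\<And>f. f \<in> borel_measurable borel \<Longrightarrow> left_cont f \<Longrightarrow>
            (\<integral>\<^sup>+w. eneg (\<Sum>n. f (\<theta> n w)) \<partial>M) = \<Psi> (jump_exponent \<sigma> f)"
proof -
  obtain G \<Delta>h where G: "scaled_jump_kernel \<sigma> G"
    and D: "distributed M lborel \<Delta>h (\<lambda>s. ennreal (tilting c \<beta> \<sigma> s * largest_jump_density \<sigma> s))"
    and \<theta>: "is_cond_distr M \<Delta>h borel (\<lambda>w n. \<theta> n w) (PiM UNIV (\<lambda>_. borel)) G"
    using SB by (auto simp: SBSP_def)
  obtain Q :: "(nat \<Rightarrow> real) measure" and \<Delta> where
    Q: "prob_space Q" "\<forall>n. \<Delta> n \<in> borel_measurable Q"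
      "poisson_random_measure Q (stable_intensity \<sigma>) (\<lambda>v. atomic_measure borel (\<lambda>_. 1) (\<lambda>n. \<Delta> n v))"
      "AE v in Q. \<forall>n. 0 < \<Delta> (Suc n) v \<and> \<Delta> (Suc n) v < \<Delta> n v"
    and GQ: "is_cond_distr Q (\<Delta> 0) borel (\<lambda>v n. \<Delta> (Suc n) v / \<Delta> 0 v) (PiM UNIV (\<lambda>_. borel)) G"
    using G unfolding scaled_jump_kernel_def by blast
  interpret Q: stable_points Q \<sigma> \<Delta>
    using Q \<open>0 < \<sigma>\<close> by (intro stable_points.intro poisson_points.intro poisson_points_axioms.intro stable_points_axioms.intro) auto
  have tr: "(\<integral>\<^sup>+w. \<phi> (\<lambda>n. \<theta> n w) \<partial>M) =
         (\<integral>\<^sup>+v. ennreal (tilting c \<beta> \<sigma> (\<Delta> 0 v)) * \<phi> (\<lambda>n. \<Delta> (Suc n) v / \<Delta> 0 v) \<partial>Q)"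
    if "\<phi> \<in> borel_measurable (PiM UNIV (\<lambda>_. borel))" for \<phi>
    by (rule scaled_jump_kernel_transfer[OF assms(1-4) GQ Q.stable_points_axioms D \<theta> that])
  have [measurable]: "tilting c \<beta> \<sigma> \<in> borel_measurable borel"
    unfolding tilting_def by measurable
  define \<Psi> where "\<Psi> K = (\<integral>\<^sup>+v. ennreal (tilting c \<beta> \<sigma> (\<Delta> 0 v)) * eneg (ennreal (\<Delta> 0 v powr (- \<sigma>)) * K) \<partial>Q)" for K
  show ?thesis
  proof (rule that)
    fix f :: "real \<Rightarrow> ennreal" assume f [measurable]: "f \<in> borel_measurable borel" and lc: "left_cont f"
    have "(\<integral>\<^sup>+w. eneg (\<Sum>n. f (\<theta> n w)) \<partial>M) =
          (\<integral>\<^sup>+v. ennreal (tilting c \<beta> \<sigma> (\<Delta> 0 v)) * eneg (\<Sum>n. f (\<Delta> (Suc n) v / \<Delta> 0 v)) \<partial>Q)"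
      by (rule tr[of "\<lambda>y. eneg (\<Sum>n. f (y n))"]) measurable
    also have "\<dots> = \<Psi> (jump_exponent \<sigma> f)"
      unfolding \<Psi>_def by (rule Q.ratio_laplace[OF f lc]) measurable
    finally show "(\<integral>\<^sup>+w. eneg (\<Sum>n. f (\<theta> n w)) \<partial>M) = \<Psi> (jump_exponent \<sigma> f)" .
  qed
qed

section \<open>Marking the jumps with labels and counts\<close>

lemma indep_vars_coordinates:
  assumes "\<And>i. i \<in> I \<Longrightarrow> prob_space (M i)" and "I \<noteq> {}"
  shows "prob_space.indep_vars (PiM I M) M (\<lambda>i y. y i) I"
proof -
  interpret P: prob_space "PiM I M"
    by (rule prob_space_PiM) fact
  have "distr (PiM I M) (PiM I M) (\<lambda>y. \<lambda>i\<in>I. y i) = distr (PiM I M) (PiM I M) (\<lambda>y. y)"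
    by (rule distr_cong) (auto simp: space_PiM PiE_restrict)
  also have "\<dots> = PiM I (\<lambda>i. distr (PiM I M) (M i) (\<lambda>y. y i))"
    unfolding distr_id using assms by (intro PiM_cong) (simp_all add: distr_PiM_component)
  finally show ?thesis
    using assms by (subst P.indep_vars_iff_distr_eq_PiM') auto
qed

text \<open>The rows of the array occupy the disjoint index blocks \<open>D \<times> {n}\<close>, so
  they are independent, and row n has law \<open>PiM D (\<lambda>_. K n)\<close>. Independence takes
  the place of iterated integration, as the whole array may be infinite.\<close>

lemma nn_integral_PiM_blocks:
  fixes K :: "'b \<Rightarrow> 'c measure" and h :: "'b \<Rightarrow> ('a \<Rightarrow> 'c) \<Rightarrow> ennreal"
  assumes K: "\<And>n. prob_space (K n)" and D: "D \<subseteq> D'" and fin: "finite L"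
    and S: "\<And>n. sets (K n) = sets S"
    and h [measurable]: "\<And>n. h n \<in> borel_measurable (PiM D (\<lambda>_. S))"
  shows "(\<integral>\<^sup>+y. (\<Prod>n\<in>L. h n (\<lambda>d\<in>D. y (d, n))) \<partial>PiM (D' \<times> UNIV) (\<lambda>(d, n). K n)) =
         (\<Prod>n\<in>L. \<integral>\<^sup>+a. h n a \<partial>PiM D (\<lambda>_. K n))"
proof (cases "D = {} \<or> L = {}")
  case True
  have "prob_space (PiM (D' \<times> UNIV) (\<lambda>(d, n). K n))"
    using K by (intro prob_space_PiM) auto
  then show ?thesis
    using True fin by (auto simp: prob_space.emeasure_space_1 PiM_empty nn_integral_count_space_finite restrict_def)
next
  case ne: False
  define P where "P = PiM (D' \<times> UNIV) (\<lambda>(d, n). K n)"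
  have KP: "prob_space ((\<lambda>(d, n). K n) i)" for i :: "'a \<times> 'b"
    using K by (cases i) auto
  interpret P: prob_space P
    unfolding P_def by (rule prob_space_PiM) (rule KP)
  have [measurable_cong]: "sets (K n) = sets S" for n
    by (rule S)
  have hK [measurable]: "h n \<in> borel_measurable (PiM D (\<lambda>_. K n))" for n
    by measurable
  define row where "row n y = (\<lambda>d\<in>D. y (d, n))" for n :: 'b and y :: "'a \<times> 'b \<Rightarrow> 'c"
  have row_meas: "row n \<in> measurable P (PiM D (\<lambda>_. K n))" for n
    unfolding row_def P_def
  proof (rule measurable_restrict)
    fix d assume "d \<in> D"
    then show "(\<lambda>y. y (d, n)) \<in> measurable (PiM (D' \<times> UNIV) (\<lambda>(d, n). K n)) (K n)"
      using D measurable_component_singleton[of "(d, n)" "D' \<times> UNIV" "\<lambda>(d, n). K n"] by auto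
  qed
  have distr_row: "distr P (PiM D (\<lambda>_. K n)) (row n) = PiM D (\<lambda>_. K n)" for n
    using distr_PiM_reindex[of "D' \<times> UNIV" "\<lambda>(d, n). K n" "\<lambda>d. (d, n)" D] D KP
    unfolding P_def row_def by (auto simp: inj_on_def)
  have "P.indep_vars (\<lambda>n. PiM (D \<times> {n}) (\<lambda>(d, n). K n)) (\<lambda>n y. restrict (\<lambda>i. y i) (D \<times> {n})) L"
  proof (rule P.indep_vars_restrict)
    show "P.indep_vars (\<lambda>(d, n). K n) (\<lambda>i y. y i) (D' \<times> UNIV)"
      unfolding P_def using ne D by (intro indep_vars_coordinates KP) auto
    show "disjoint_family_on (\<lambda>n. D \<times> {n}) L"
      by (auto simp: disjoint_family_on_def)
  qed (use D in auto)
  then have "P.indep_vars (\<lambda>_. borel) (\<lambda>n y. (\<lambda>z. h n (\<lambda>d\<in>D. z (d, n))) (restrict (\<lambda>i. y i) (D \<times> {n}))) L"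
  proof (rule P.indep_vars_compose2)
    fix n
    have "(\<lambda>z. \<lambda>d\<in>D. z (d, n)) \<in> measurable (PiM (D \<times> {n}) (\<lambda>(d, n). K n)) (PiM D (\<lambda>_. K n))"
    proof (rule measurable_restrict)
      fix d assume "d \<in> D"
      then show "(\<lambda>y. y (d, n)) \<in> measurable (PiM (D \<times> {n}) (\<lambda>(d, n). K n)) (K n)"
        using measurable_component_singleton[of "(d, n)" "D \<times> {n}" "\<lambda>(d, n). K n"] by auto
    qed
    from measurable_compose[OF this hK]
    show "(\<lambda>z. h n (\<lambda>d\<in>D. z (d, n))) \<in> measurable (PiM (D \<times> {n}) (\<lambda>(d, n). K n)) borel" .
  qed
  moreover have "(\<lambda>d\<in>D. restrict (\<lambda>i. y i) (D \<times> {n}) (d, n)) = row n y" for n y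
    by (auto simp: row_def)
  ultimately have ind: "P.indep_vars (\<lambda>_. borel) (\<lambda>n y. h n (row n y)) L"
    by simp
  have "(\<integral>\<^sup>+y. (\<Prod>n\<in>L. h n (row n y)) \<partial>P) = (\<Prod>n\<in>L. \<integral>\<^sup>+y. h n (row n y) \<partial>P)"
    using fin ind by (rule P.indep_vars_nn_integral) auto
  also have "\<dots> = (\<Prod>n\<in>L. \<integral>\<^sup>+a. h n a \<partial>distr P (PiM D (\<lambda>_. K n)) (row n))"
    using row_meas by (intro prod.cong refl nn_integral_distr[symmetric]) auto
  finally show ?thesis
    unfolding distr_row unfolding P_def row_def .
qed

section \<open>The model given by jumps, labels and daily counts\<close>

locale nbp_model = prob_space M for M :: "'w measure" +
  fixes \<sigma> \<beta> c r :: real and \<theta> \<omega> :: "nat \<Rightarrow> 'w \<Rightarrow> real" and \<Theta> :: "'w \<Rightarrow> real measure"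
    and A :: "nat \<Rightarrow> nat \<Rightarrow> 'w \<Rightarrow> nat" and Z :: "nat \<Rightarrow> 'w \<Rightarrow> real measure"
  assumes \<sigma>: "0 < \<sigma>" "\<sigma> < 1" and \<beta>: "0 < \<beta>" and c: "0 < c" and r: "0 < r"
    and SB: "SBSP M \<beta> \<sigma> c \<theta> \<omega> \<Theta>" and NB: "iid_NBP M r \<theta> \<omega> \<Theta> A Z"
begin

declare One_nat_def [simp del]

lemma space_P0: "space P0 = {0..1}" and sets_P0: "sets P0 = sets (restrict_space borel {0..1})"
  by (auto simp: P0_def sets_restrict_space)

sublocale P0: prob_space P0
  by (rule prob_spaceI) (simp add: P0_def emeasure_restrict_space)

definition row :: "nat \<Rightarrow> nat \<Rightarrow> 'w \<Rightarrow> nat \<Rightarrow> nat" where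
  "row D n w = (\<lambda>d\<in>{1..D}. A d n w)"

abbreviation row_space :: "nat \<Rightarrow> (nat \<Rightarrow> nat) measure" where
  "row_space D \<equiv> PiM {1..D} (\<lambda>_. count_space UNIV)"

abbreviation mark_space :: "nat \<Rightarrow> (real \<times> (nat \<Rightarrow> nat)) measure" where
  "mark_space D \<equiv> P0 \<Otimes>\<^sub>M row_space D"

text \<open>For s outside (0,1) the convention for \<open>neg_binomial\<close> makes this the point
  mass at the zero row, so it is a probability measure for every real s.\<close>

definition mark :: "nat \<Rightarrow> real \<Rightarrow> (nat \<Rightarrow> nat) measure" where
  "mark D s = PiM {1..D} (\<lambda>_. neg_binomial r s)"

lemma sets_mark [simp, measurable_cong]: "sets (mark D s) = sets (row_space D)"
  unfolding mark_def by (intro sets_PiM_cong) auto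

lemma prob_space_mark: "prob_space (mark D s)"
  unfolding mark_def by (intro prob_space_PiM prob_space_neg_binomial)

definition mark_int :: "nat \<Rightarrow> (real \<times> (nat \<Rightarrow> nat) \<Rightarrow> ennreal) \<Rightarrow> real \<Rightarrow> ennreal" where
  "mark_int D u s = (\<integral>\<^sup>+x. \<integral>\<^sup>+a. u (x, a) \<partial>mark D s \<partial>P0)"

abbreviation "seqs \<equiv> (PiM UNIV (\<lambda>_. borel) :: (nat \<Rightarrow> real) measure)"
abbreviation "labels \<equiv> (PiM UNIV (\<lambda>_. P0) :: (nat \<Rightarrow> real) measure)"

definition count_kernel :: "(nat \<Rightarrow> real) \<times> (nat \<Rightarrow> real) \<Rightarrow> (nat \<times> nat \<Rightarrow> nat) measure" where
  "count_kernel = (\<lambda>(t, x :: nat \<Rightarrow> real). PiM ({1..} \<times> UNIV) (\<lambda>(d, n). neg_binomial r (t n)))"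

lemma NB': "is_cond_distr M (\<lambda>w. (\<lambda>n. \<theta> n w, \<lambda>n. \<omega> n w)) (seqs \<Otimes>\<^sub>M labels)
       (\<lambda>w. \<lambda>(d, n)\<in>{1..} \<times> UNIV. A d n w) (PiM ({1..} \<times> UNIV) (\<lambda>_. count_space UNIV)) count_kernel"
  using NB unfolding iid_NBP_def count_kernel_def by auto

lemma theta_omega_measurable: "(\<lambda>w. (\<lambda>n. \<theta> n w, \<lambda>n. \<omega> n w)) \<in> measurable M (seqs \<Otimes>\<^sub>M labels)"
  using NB' by (simp add: is_cond_distr_def)

lemma theta_measurable [measurable]: "\<theta> n \<in> borel_measurable M"
proof -
  have "(\<lambda>w. fst (\<lambda>n. \<theta> n w, \<lambda>n. \<omega> n w) n) \<in> borel_measurable M"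
    by (rule measurable_compose[OF theta_omega_measurable]) measurable
  then show ?thesis by simp
qed

lemma omega_measurable [measurable]: "\<omega> n \<in> measurable M P0"
proof -
  have "(\<lambda>w. snd (\<lambda>n. \<theta> n w, \<lambda>n. \<omega> n w) n) \<in> measurable M P0"
    by (rule measurable_compose[OF theta_omega_measurable]) measurable
  then show ?thesis by simp
qed

lemma A_measurable: "1 \<le> d \<Longrightarrow> A d n \<in> measurable M (count_space UNIV)"
proof -
  assume d: "1 \<le> d"
  have "(\<lambda>w. \<lambda>(d, n)\<in>{1..} \<times> UNIV. A d n w) \<in> measurable M (PiM ({1..} \<times> UNIV) (\<lambda>_. count_space UNIV))"
    using NB' by (simp add: is_cond_distr_def)
  from measurable_compose[OF this measurable_component_singleton[of "(d, n)"]] d show ?thesis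
    by simp
qed

lemma row_measurable [measurable]: "row D n \<in> measurable M (row_space D)"
  unfolding row_def by (intro measurable_restrict A_measurable) auto

lemma indep_omega: "indep_vars (\<lambda>_. P0) \<omega> UNIV" and distr_omega: "distr M P0 (\<omega> n) = P0"
  using SB by (auto simp: SBSP_def)

text \<open>The product law in \<open>SBSP\<close> also contains the tilted largest jump.
  Integrating functions that ignore it leaves the independence of jumps and labels.\<close>

lemma theta_omega_independent:
  assumes g [measurable]: "g \<in> borel_measurable (seqs \<Otimes>\<^sub>M labels)"
  shows "(\<integral>\<^sup>+w. g (\<lambda>n. \<theta> n w, \<lambda>n. \<omega> n w) \<partial>M) =
         (\<integral>\<^sup>+w. \<integral>\<^sup>+v. g (\<lambda>n. \<theta> n w, \<lambda>n. \<omega> n v) \<partial>M \<partial>M)"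
proof -
  obtain \<Delta>h where D: "distributed M lborel \<Delta>h (\<lambda>s. ennreal (tilting c \<beta> \<sigma> s * largest_jump_density \<sigma> s))"
    and eq: "distr M ((borel \<Otimes>\<^sub>M seqs) \<Otimes>\<^sub>M labels) (\<lambda>w. ((\<Delta>h w, \<lambda>n. \<theta> n w), \<lambda>n. \<omega> n w)) =
          distr M (borel \<Otimes>\<^sub>M seqs) (\<lambda>w. (\<Delta>h w, \<lambda>n. \<theta> n w)) \<Otimes>\<^sub>M distr M labels (\<lambda>w n. \<omega> n w)"
    using SB unfolding SBSP_def by blast
  have [measurable]: "\<Delta>h \<in> borel_measurable M"
    using distributed_measurable[OF D] by simp
  have [measurable]: "(\<lambda>w n. \<theta> n w) \<in> measurable M seqs" "(\<lambda>w n. \<omega> n w) \<in> measurable M labels"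
    by (auto intro!: measurable_PiM_single')
       (auto intro!: measurable_space[OF omega_measurable])
  define L1 where "L1 = distr M (borel \<Otimes>\<^sub>M seqs) (\<lambda>w. (\<Delta>h w, \<lambda>n. \<theta> n w))"
  define L2 where "L2 = distr M labels (\<lambda>w n. \<omega> n w)"
  interpret L2: prob_space L2
    unfolding L2_def by (rule prob_space_distr) measurable
  have [measurable_cong]: "sets L1 = sets (borel \<Otimes>\<^sub>M seqs)" "sets L2 = sets labels"
    by (simp_all add: L1_def L2_def)
  have "(\<integral>\<^sup>+w. g (\<lambda>n. \<theta> n w, \<lambda>n. \<omega> n w) \<partial>M) =
        (\<integral>\<^sup>+z. g (snd (fst z), snd z) \<partial>distr M ((borel \<Otimes>\<^sub>M seqs) \<Otimes>\<^sub>M labels) (\<lambda>w. ((\<Delta>h w, \<lambda>n. \<theta> n w), \<lambda>n. \<omega> n w)))"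
    by (subst nn_integral_distr) auto
  also have "\<dots> = (\<integral>\<^sup>+a. \<integral>\<^sup>+b. g (snd a, b) \<partial>L2 \<partial>L1)"
    unfolding eq L1_def[symmetric] L2_def[symmetric]
    by (subst L2.nn_integral_fst[symmetric]) auto
  also have "\<dots> = (\<integral>\<^sup>+w. \<integral>\<^sup>+b. g (\<lambda>n. \<theta> n w, b) \<partial>L2 \<partial>M)"
    unfolding L1_def by (subst nn_integral_distr) auto
  also have "\<dots> = (\<integral>\<^sup>+w. \<integral>\<^sup>+v. g (\<lambda>n. \<theta> n w, \<lambda>n. \<omega> n v) \<partial>M \<partial>M)"
    unfolding L2_def by (intro nn_integral_cong nn_integral_distr) auto
  finally show ?thesis .
qed

text \<open>Measurability in the jump t is inherited from the kernel in \<open>NB'\<close>: evaluate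
  it at constant sequences of jumps and labels and look at the row of unit 0.\<close>

lemma mark_measurable:
  assumes u [measurable]: "u \<in> borel_measurable (mark_space D)"
  shows "(\<lambda>(t, x). \<integral>\<^sup>+a. u (x, a) \<partial>mark D t) \<in> borel_measurable (borel \<Otimes>\<^sub>M P0)"
proof -
  have K [measurable]: "count_kernel \<in> measurable (seqs \<Otimes>\<^sub>M labels) (subprob_algebra (PiM ({1..} \<times> UNIV) (\<lambda>_. count_space UNIV)))"
    using NB' by (auto simp: is_cond_distr_def dest: measurable_prob_algebraD)
  define R where "R y = (\<lambda>d\<in>{1..D}. y (d, 0::nat))" for y :: "nat \<times> nat \<Rightarrow> nat"
  have R [measurable]: "R \<in> measurable (PiM ({1..} \<times> UNIV) (\<lambda>_. count_space UNIV)) (row_space D)"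
    unfolding R_def by (rule measurable_restrict) (auto intro!: measurable_component_singleton)
  have "(\<lambda>z. \<integral>\<^sup>+y. u (snd z 0, R y) \<partial>count_kernel z) \<in> borel_measurable (seqs \<Otimes>\<^sub>M labels)"
    by (intro nn_integral_measurable_subprob_algebra2[OF _ K]) measurable
  moreover have "(\<lambda>(t, x). (\<lambda>_. t, \<lambda>_. x)) \<in> measurable ((borel :: real measure) \<Otimes>\<^sub>M P0) (seqs \<Otimes>\<^sub>M labels)"
    by (auto intro!: measurable_Pair measurable_PiM_single' simp: split_beta' space_pair_measure)
  ultimately have "(\<lambda>z. (\<lambda>z. \<integral>\<^sup>+y. u (snd z 0, R y) \<partial>count_kernel z) ((\<lambda>(t, x). (\<lambda>_. t, \<lambda>_. x)) z)) \<in> borel_measurable ((borel :: real measure) \<Otimes>\<^sub>M P0)"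
    by (rule measurable_compose[rotated])
  then show ?thesis
  proof (rule measurable_cong[THEN iffD1, rotated])
    fix z assume "z \<in> space ((borel :: real measure) \<Otimes>\<^sub>M P0)"
    then obtain t x where z: "z = (t, x)" "x \<in> space P0"
      by (cases z) (auto simp: space_pair_measure)
    have [measurable]: "(\<lambda>a. u (x, a)) \<in> borel_measurable (row_space D)"
      using z(2) by measurable
    have "(\<integral>\<^sup>+y. (\<Prod>n\<in>{0}. u (x, \<lambda>d\<in>{1..D}. y (d, n))) \<partial>PiM ({1..} \<times> UNIV) (\<lambda>(d, n::nat). neg_binomial r t)) =
          (\<Prod>n\<in>{0::nat}. \<integral>\<^sup>+a. u (x, a) \<partial>PiM {1..D} (\<lambda>_. neg_binomial r t))"
      by (rule nn_integral_PiM_blocks[where S="count_space UNIV"]) (auto simp: prob_space_neg_binomial)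
    then show "(\<integral>\<^sup>+y. u (snd ((\<lambda>(t, x). (\<lambda>_. t, \<lambda>_. x)) z) 0, R y) \<partial>count_kernel ((\<lambda>(t, x). (\<lambda>_. t, \<lambda>_. x)) z)) =
          (\<lambda>(t, x). \<integral>\<^sup>+a. u (x, a) \<partial>mark D t) z"
      by (simp add: z count_kernel_def R_def mark_def)
  qed
qed

lemma mark_int_measurable [measurable]:
  assumes "u \<in> borel_measurable (mark_space D)"
  shows "mark_int D u \<in> borel_measurable borel"
  unfolding mark_int_def[abs_def]
  using P0.borel_measurable_nn_integral[OF mark_measurable[OF assms]] by simp

text \<open>Given jumps and labels, the rows of different units are independent; given the jumps,
  the labels are independent and uniform. Integrating counts first and labels second, each factor
  becomes the mean over one mark.\<close>

lemma marking_finite: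
  assumes u [measurable]: "u \<in> borel_measurable (mark_space D)"
  shows "(\<integral>\<^sup>+w. (\<Prod>n<k. u (\<omega> n w, row D n w)) \<partial>M) = (\<integral>\<^sup>+w. (\<Prod>n<k. mark_int D u (\<theta> n w)) \<partial>M)"
proof -
  define U where "U t x = (\<integral>\<^sup>+a. u (x, a) \<partial>mark D t)" for t x
  have U [measurable]: "(\<lambda>(t, x). U t x) \<in> borel_measurable (borel \<Otimes>\<^sub>M P0)"
    unfolding U_def by (rule mark_measurable[OF u])
  have [measurable]: "(\<lambda>z. \<lambda>d\<in>{1..D}. snd z (d, n::nat)) \<in> measurable (N \<Otimes>\<^sub>M PiM ({1..} \<times> UNIV) (\<lambda>_. count_space UNIV)) (row_space D)"
    for n and N :: "'z measure"
    by (rule measurable_restrict) (auto intro!: measurable_compose[OF measurable_snd measurable_component_singleton])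
  have "(\<integral>\<^sup>+w. (\<Prod>n<k. u (\<omega> n w, row D n w)) \<partial>M) =
        (\<integral>\<^sup>+w. (\<lambda>z. \<Prod>n<k. u (snd (fst z) n, \<lambda>d\<in>{1..D}. snd z (d, n)))
           ((\<lambda>n. \<theta> n w, \<lambda>n. \<omega> n w), \<lambda>(d, n)\<in>{1..} \<times> UNIV. A d n w) \<partial>M)"
    by (intro nn_integral_cong prod.cong refl arg_cong[where f=u]) (auto simp: row_def restrict_def)
  also have "\<dots> = (\<integral>\<^sup>+z. \<integral>\<^sup>+y. (\<Prod>n<k. u (snd z n, \<lambda>d\<in>{1..D}. y (d, n))) \<partial>count_kernel z
                    \<partial>distr M (seqs \<Otimes>\<^sub>M labels) (\<lambda>w. (\<lambda>n. \<theta> n w, \<lambda>n. \<omega> n w)))"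
    by (subst is_cond_distr_nn_integral[OF prob_space_axioms NB']) auto
  also have "\<dots> = (\<integral>\<^sup>+z. (\<Prod>n<k. U (fst z n) (snd z n)) \<partial>distr M (seqs \<Otimes>\<^sub>M labels) (\<lambda>w. (\<lambda>n. \<theta> n w, \<lambda>n. \<omega> n w)))"
  proof (rule nn_integral_cong)
    fix z assume "z \<in> space (distr M (seqs \<Otimes>\<^sub>M labels) (\<lambda>w. (\<lambda>n. \<theta> n w, \<lambda>n. \<omega> n w)))"
    then obtain t x where z: "z = (t, x)" and x: "\<And>n. x n \<in> space P0"
      by (cases z) (auto simp: space_pair_measure space_PiM)
    have [measurable]: "(\<lambda>a. u (x n, a)) \<in> borel_measurable (row_space D)" for n
      using x by measurable
    show "(\<integral>\<^sup>+y. (\<Prod>n<k. u (snd z n, \<lambda>d\<in>{1..D}. y (d, n))) \<partial>count_kernel z) = (\<Prod>n<k. U (fst z n) (snd z n))"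
      unfolding z count_kernel_def U_def mark_def fst_conv snd_conv prod.case
      by (rule nn_integral_PiM_blocks[where S="count_space UNIV"]) (auto simp: prob_space_neg_binomial)
  qed
  also have "\<dots> = (\<integral>\<^sup>+w. (\<Prod>n<k. U (\<theta> n w) (\<omega> n w)) \<partial>M)"
    by (subst nn_integral_distr[OF theta_omega_measurable]) auto
  also have "\<dots> = (\<integral>\<^sup>+w. \<integral>\<^sup>+v. (\<Prod>n<k. U (\<theta> n w) (\<omega> n v)) \<partial>M \<partial>M)"
    using theta_omega_independent[of "\<lambda>z. \<Prod>n<k. U (fst z n) (snd z n)"] by simp
  also have "\<dots> = (\<integral>\<^sup>+w. (\<Prod>n<k. mark_int D u (\<theta> n w)) \<partial>M)"
  proof (rule nn_integral_cong)
    fix w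
    have "(\<integral>\<^sup>+v. (\<Prod>n<k. U (\<theta> n w) (\<omega> n v)) \<partial>M) = (\<Prod>n<k. \<integral>\<^sup>+v. U (\<theta> n w) (\<omega> n v) \<partial>M)"
    proof (rule indep_vars_nn_integral)
      show "indep_vars (\<lambda>_. borel) (\<lambda>n v. U (\<theta> n w) (\<omega> n v)) {..<k}"
        by (rule indep_vars_compose2[OF indep_vars_subset[OF indep_omega]]) auto
    qed auto
    also have "\<dots> = (\<Prod>n<k. \<integral>\<^sup>+x. U (\<theta> n w) x \<partial>distr M P0 (\<omega> n))"
      by (intro prod.cong refl nn_integral_distr[symmetric]) auto
    finally show "(\<integral>\<^sup>+v. (\<Prod>n<k. U (\<theta> n w) (\<omega> n v)) \<partial>M) = (\<Prod>n<k. mark_int D u (\<theta> n w))"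
      by (simp add: distr_omega mark_int_def U_def)
  qed
  finally show ?thesis .
qed

end

section \<open>Infinite products as exponentials of sums\<close>

definition elog :: "ennreal \<Rightarrow> ennreal" where
  "elog y = (if y = 0 then top else ennreal (- ln (enn2real y)))"

lemma eneg_elog: "y \<le> 1 \<Longrightarrow> eneg (elog y) = y"
proof (cases "y = 0")
  case False
  assume y: "y \<le> 1"
  then obtain x where x: "y = ennreal x" "0 \<le> x"
    by (cases y) (auto simp: top_unique)
  then have "0 < x" "x \<le> 1"
    using False y by auto
  then show ?thesis
    using x by (simp add: elog_def eneg_ennreal)
qed (simp add: elog_def)

lemma borel_measurable_elog [measurable]: "elog \<in> borel_measurable borel"
  unfolding elog_def by measurable

text \<open>A positive limit keeps the logarithm away from its pole. For means over marks,
  positivity comes from the zero row.\<close>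

lemma tendsto_elog:
  assumes "(F \<longlongrightarrow> y) G" "0 < y" "y < top"
  shows "((\<lambda>i. elog (F i)) \<longlongrightarrow> elog y) G"
proof -
  have "\<forall>\<^sub>F i in G. 0 < F i"
    using assms by (intro order_tendstoD)
  then have ev: "\<forall>\<^sub>F i in G. ennreal (- ln (enn2real (F i))) = elog (F i)"
    by eventually_elim (auto simp: elog_def)
  have "((\<lambda>i. ennreal (- ln (enn2real (F i)))) \<longlongrightarrow> ennreal (- ln (enn2real y))) G"
    using assms by (intro tendsto_ennrealI tendsto_minus tendsto_ln tendsto_enn2real) (auto simp: enn2real_eq_0_iff)
  then have "((\<lambda>i. elog (F i)) \<longlongrightarrow> ennreal (- ln (enn2real y))) G"
    by (rule tendsto_cong[THEN iffD1, OF ev])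
  moreover have "elog y = ennreal (- ln (enn2real y))"
    using assms by (auto simp: elog_def)
  ultimately show ?thesis by simp
qed

text \<open>Factors at most 1 make the partial products decrease, so the infimum is the infinite
  product. It is 0 exactly when the sum of the exponents is infinite.\<close>

lemma INF_prod_eq_eneg:
  assumes "\<And>n. F n \<le> 1"
  shows "(INF k. \<Prod>n<k. F n) = eneg (\<Sum>n. elog (F n))"
proof -
  have "(\<Prod>n<k. F n) = eneg (\<Sum>n<k. elog (F n))" for k
    by (simp add: eneg_sum eneg_elog assms)
  moreover have "(\<lambda>k. eneg (\<Sum>n<k. elog (F n))) \<longlonglongrightarrow> eneg (\<Sum>n. elog (F n))"
    by (intro tendsto_eneg summable_LIMSEQ) simp
  moreover have "decseq (\<lambda>k. eneg (\<Sum>n<k. elog (F n)))"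
    by (auto simp: decseq_def intro!: eneg_antimono sum_mono2)
  ultimately show ?thesis
    using LIMSEQ_INF[of "\<lambda>k. \<Prod>n<k. F n"] by (simp add: LIMSEQ_unique)
qed

definition nb_coeff :: "real \<Rightarrow> nat \<Rightarrow> real" where
  "nb_coeff a x = ((real x + a - 1) gchoose x)"

lemma nb_coeff_nonneg: "0 < a \<Longrightarrow> 0 \<le> nb_coeff a x"
  unfolding nb_coeff_def by (auto simp: gbinomial_prod_rev intro!: divide_nonneg_nonneg prod_nonneg)

lemma nb_coeff_0 [simp]: "nb_coeff a 0 = 1"
  by (simp add: nb_coeff_def)

lemma nb_coeff_sums:
  assumes "0 \<le> z" "z < 1"
  shows "(\<lambda>x. nb_coeff a x * z ^ x) sums (1 - z) powr (- a)"
proof -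
  have c: "nb_coeff a x = (-1) ^ x * ((- a) gchoose x)" for x
    unfolding nb_coeff_def
    by (simp add: gbinomial_minus flip: power_mult_distrib) (simp add: algebra_simps)
  have "(\<lambda>x. ((- a) gchoose x) * (- z) ^ x) sums (1 + (- z)) powr (- a)"
    using assms by (intro gen_binomial_real) auto
  then show ?thesis
    by (simp add: c power_minus[of z] mult_ac)
qed

lemma neg_binomial_density:
  assumes "0 < a" "0 < p" "p < 1"
  shows "neg_binomial a p = density (count_space UNIV) (\<lambda>x. ennreal (nb_coeff a x * p ^ x * (1 - p) powr a))"
  using assms by (simp add: neg_binomial_def nb_coeff_def)

lemma emeasure_neg_binomial:
  assumes "0 < a" "0 < p" "p < 1"
  shows "emeasure (neg_binomial a p) {x} = ennreal (nb_coeff a x * p ^ x * (1 - p) powr a)"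
  unfolding neg_binomial_density[OF assms] by (simp add: emeasure_density)

lemma neg_binomial_pgf:
  assumes "0 < a" "0 < p" "p < 1" "0 \<le> v" "v \<le> 1"
  shows "(\<integral>\<^sup>+x. ennreal (v ^ x) \<partial>neg_binomial a p) = ennreal (((1 - p) / (1 - v * p)) powr a)"
proof -
  have vp: "0 \<le> v * p" "v * p < 1"
    using assms mult_le_one[of v p] by (auto intro: le_less_trans[OF mult_right_mono[of v 1 p]])
  have "(\<integral>\<^sup>+x. ennreal (v ^ x) \<partial>neg_binomial a p) = (\<Sum>x. ennreal (nb_coeff a x * (v * p) ^ x * (1 - p) powr a))"
  proof -
    have "ennreal (nb_coeff a x * p ^ x * (1 - p) powr a) * ennreal (v ^ x) =
          ennreal (nb_coeff a x * (v * p) ^ x * (1 - p) powr a)" for x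
      using assms by (subst ennreal_mult[symmetric]) (auto simp: nb_coeff_nonneg power_mult_distrib mult_ac)
    then show ?thesis
      unfolding neg_binomial_density[OF assms(1-3)]
      by (subst nn_integral_density) (simp_all add: nn_integral_count_space_nat)
  qed
  also have "\<dots> = ennreal ((1 - v * p) powr (- a) * (1 - p) powr a)"
    using vp assms by (intro suminf_ennreal_eq sums_mult2 nb_coeff_sums) (auto intro!: mult_nonneg_nonneg nb_coeff_nonneg)
  also have "(1 - v * p) powr (- a) * (1 - p) powr a = ((1 - p) / (1 - v * p)) powr a"
    using vp assms by (subst powr_divide) (auto simp: powr_minus field_simps)
  finally show ?thesis .
qed

section \<open>The mean over a mark as a function of the jump\<close>

context nbp_model
begin

lemma row_space_count: "row_space D = count_space (PiE {1..D} (\<lambda>_. UNIV))"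
  by (rule count_space_PiM_finite) auto

definition weight :: "nat \<Rightarrow> (nat \<Rightarrow> nat) \<Rightarrow> real \<Rightarrow> real" where
  "weight D y s = (\<Prod>d\<in>{1..D}. nb_coeff r (y d) * s ^ y d * (1 - s) powr r)"

lemma weight_nonneg: "0 \<le> s \<Longrightarrow> 0 \<le> weight D y s"
  unfolding weight_def using r by (intro prod_nonneg mult_nonneg_nonneg nb_coeff_nonneg) auto

text \<open>Rows of finite length form a countable space, so it suffices to compare the masses of
  single rows.\<close>

lemma mark_density:
  assumes s: "0 < s" "s < 1"
  shows "mark D s = density (row_space D) (\<lambda>y. ennreal (weight D y s))"
proof (rule measure_eqI_countable[where A="PiE {1..D} (\<lambda>_. UNIV)"])
  show sets: "sets (mark D s) = Pow (PiE {1..D} (\<lambda>_. UNIV))"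
    by (simp add: row_space_count)
  show "sets (density (row_space D) (\<lambda>y. ennreal (weight D y s))) = Pow (PiE {1..D} (\<lambda>_. UNIV))"
    by (simp add: row_space_count)
  show "countable (PiE {1..D} (\<lambda>_. UNIV :: nat set))"
    by (intro countable_PiE) auto
  fix y assume y: "y \<in> PiE {1..D} (\<lambda>_. UNIV :: nat set)"
  interpret product_sigma_finite "\<lambda>_::nat. neg_binomial r s"
    by (intro product_sigma_finite.intro prob_space_imp_sigma_finite prob_space_neg_binomial)
  have "{y} = PiE {1..D} (\<lambda>d. {y d})"
    using y by (intro PiE_singleton[symmetric]) (auto simp: PiE_def)
  then have "emeasure (mark D s) {y} = (\<Prod>d\<in>{1..D}. emeasure (neg_binomial r s) {y d})"
    unfolding mark_def by (simp add: emeasure_PiM)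
  also have "\<dots> = ennreal (weight D y s)"
    using s r by (simp add: emeasure_neg_binomial weight_def prod_ennreal nb_coeff_nonneg)
  also have "\<dots> = emeasure (density (row_space D) (\<lambda>y. ennreal (weight D y s))) {y}"
    unfolding row_space_count using y by (simp add: emeasure_density)
  finally show "emeasure (mark D s) {y} = emeasure (density (row_space D) (\<lambda>y. ennreal (weight D y s))) {y}" .
qed

lemma nn_integral_mark:
  assumes s: "0 < s" "s < 1" and h: "h \<in> borel_measurable (row_space D)"
  shows "(\<integral>\<^sup>+y. h y \<partial>mark D s) = (\<integral>\<^sup>+y. ennreal (weight D y s) * h y \<partial>row_space D)"
  unfolding mark_density[OF s] by (rule nn_integral_density) (auto simp: row_space_count h)

lemma mark_int_Fubini:
  assumes u [measurable]: "u \<in> borel_measurable (mark_space D)"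
  shows "mark_int D u s = (\<integral>\<^sup>+y. \<integral>\<^sup>+x. u (x, y) \<partial>P0 \<partial>mark D s)"
proof -
  interpret m: prob_space "mark D s" by (rule prob_space_mark)
  interpret pair_sigma_finite P0 "mark D s" ..
  show ?thesis
    unfolding mark_int_def by (rule Fubini'[symmetric]) measurable
qed

lemma mark_int_le_1:
  assumes "\<And>z. u z \<le> 1"
  shows "mark_int D u s \<le> 1"
proof -
  interpret m: prob_space "mark D s" by (rule prob_space_mark)
  have "mark_int D u s \<le> (\<integral>\<^sup>+x. \<integral>\<^sup>+y. 1 \<partial>mark D s \<partial>P0)"
    unfolding mark_int_def by (intro nn_integral_mono assms)
  also have "\<dots> = 1"
    by (simp add: m.emeasure_space_1 P0.emeasure_space_1)
  finally show ?thesis .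
qed

lemma mark_int_left_continuous:
  assumes u [measurable]: "u \<in> borel_measurable (mark_space D)" and u1: "\<And>z. u z \<le> 1"
    and s: "0 < s" "s < 1" and X: "\<And>k. 0 < X k" "\<And>k. X k \<le> s" "X \<longlonglongrightarrow> s"
  shows "(\<lambda>k::nat. mark_int D u (X k)) \<longlonglongrightarrow> mark_int D u s"
proof -
  interpret m: prob_space "mark D s" by (rule prob_space_mark)
  define h where "h y = (\<integral>\<^sup>+x. u (x, y) \<partial>P0)" for y
  have [measurable]: "h \<in> borel_measurable (row_space D)"
    unfolding h_def by measurable
  have h1: "h y \<le> 1" for y
  proof -
    have "h y \<le> (\<integral>\<^sup>+x. 1 \<partial>P0)"
      unfolding h_def by (intro nn_integral_mono u1)
    then show ?thesis
      by (simp add: P0.emeasure_space_1)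
  qed
  have F: "mark_int D u t = (\<integral>\<^sup>+y. ennreal (weight D y t) * h y \<partial>row_space D)" if "0 < t" "t < 1" for t
    unfolding mark_int_Fubini[OF u] h_def[symmetric] by (rule nn_integral_mark) (use that in auto)
  \<comment> \<open>For \<open>X k \<le> s\<close> the powers of \<open>X k\<close> are at most
    those of s, and \<open>(1 - X k) powr r \<le> 1\<close>. Dividing by the missing factors of
    \<open>weight D y s\<close> gives C and a bound that does not depend on k; approach from the
    left is what makes it work.\<close>
  define C where "C = (1 / (1 - s) powr r) ^ D"
  have C: "0 \<le> C"
    using s by (auto simp: C_def)
  have bound: "weight D y (X k) \<le> C * weight D y s" for y k
  proof -
    have "weight D y (X k) \<le> (\<Prod>d\<in>{1..D}. nb_coeff r (y d) * s ^ y d * 1)"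
      unfolding weight_def
    proof (intro prod_mono conjI mult_mono)
      have "0 < X k" "X k \<le> s" using X by auto
      then show "(1 - X k) powr r \<le> 1"
        using s r by (intro powr_le1) auto
      show "0 \<le> nb_coeff r (y d) * X k ^ y d * (1 - X k) powr r" for d
        using \<open>0 < X k\<close> r by (intro mult_nonneg_nonneg nb_coeff_nonneg) auto
      show "X k ^ y d \<le> s ^ y d" for d
        using \<open>0 < X k\<close> \<open>X k \<le> s\<close> by (intro power_mono) auto
    qed (use X(1)[of k] s r in \<open>auto intro: nb_coeff_nonneg mult_nonneg_nonneg\<close>)
    also have "\<dots> = (\<Prod>d\<in>{1..D}. (1 / (1 - s) powr r) * (nb_coeff r (y d) * s ^ y d * (1 - s) powr r))"
      using s by (intro prod.cong refl) auto
    also have "\<dots> = C * weight D y s"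
      by (subst prod.distrib) (simp add: weight_def C_def)
    finally show ?thesis .
  qed
  have "(\<lambda>k. \<integral>\<^sup>+y. ennreal (weight D y (X k)) * h y \<partial>row_space D) \<longlonglongrightarrow>
        (\<integral>\<^sup>+y. ennreal (weight D y s) * h y \<partial>row_space D)"
  proof (rule nn_integral_dominated_convergence[where w="\<lambda>y. ennreal C * (ennreal (weight D y s) * h y)"])
    show "AE y in row_space D. ennreal (weight D y (X k)) * h y \<le> ennreal C * (ennreal (weight D y s) * h y)" for k
    proof (rule AE_I2)
      fix y
      have "ennreal (weight D y (X k)) \<le> ennreal C * ennreal (weight D y s)"
        using bound[of y k] C s weight_nonneg by (subst ennreal_mult[symmetric]) auto
      then show "ennreal (weight D y (X k)) * h y \<le> ennreal C * (ennreal (weight D y s) * h y)"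
        by (simp add: mult.assoc[symmetric] mult_right_mono)
    qed
    have "(\<integral>\<^sup>+y. ennreal C * (ennreal (weight D y s) * h y) \<partial>row_space D) = ennreal C * mark_int D u s"
      using s by (subst nn_integral_cmult) (auto simp: F row_space_count)
    also have "\<dots> < \<infinity>"
      using mark_int_le_1[of u D s, OF u1] by (auto simp: ennreal_mult_less_top intro: le_less_trans)
    finally show "(\<integral>\<^sup>+y. ennreal C * (ennreal (weight D y s) * h y) \<partial>row_space D) < \<infinity>" .
    show "AE y in row_space D. (\<lambda>k. ennreal (weight D y (X k)) * h y) \<longlonglongrightarrow> ennreal (weight D y s) * h y"
    proof (rule AE_I2)
      fix y
      have "(\<lambda>k. weight D y (X k)) \<longlonglongrightarrow> weight D y s"
        unfolding weight_def using s by (intro tendsto_intros X(3)) auto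
      then show "(\<lambda>k. ennreal (weight D y (X k)) * h y) \<longlonglongrightarrow> ennreal (weight D y s) * h y"
        using h1[of y] unfolding mult.commute[of _ "h y"]
        by (intro ennreal_tendsto_cmult tendsto_ennrealI) (auto intro: le_less_trans)
    qed
  qed (auto simp: row_space_count)
  moreover have "X k < 1" for k
    using X(2)[of k] s by simp
  ultimately show ?thesis
    using s X(1) by (simp add: F)
qed

text \<open>The zero row has positive mass for s in (0,1), and u equals 1 there. This makes
  \<open>elog\<close> of the mean finite.\<close>

lemma mark_int_pos:
  assumes u [measurable]: "u \<in> borel_measurable (mark_space D)"
    and u0: "\<And>x. u (x, \<lambda>d\<in>{1..D}. 0) = 1"
    and s: "0 < s" "s < 1"
  shows "0 < mark_int D u s"
proof -
  define z where "z = (\<lambda>d\<in>{1..D}. 0::nat)"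
  have z: "z \<in> PiE {1..D} (\<lambda>_. UNIV)"
    by (auto simp: z_def)
  have "0 < weight D z s"
    unfolding weight_def z_def using s by (intro prod_pos) auto
  have "emeasure (mark D s) {z} = ennreal (weight D z s)"
    unfolding mark_density[OF s] row_space_count using z by (simp add: emeasure_density)
  then have "0 < emeasure (mark D s) {z}"
    using \<open>0 < weight D z s\<close> by simp
  also have "\<dots> = (\<integral>\<^sup>+y. indicator {z} y \<partial>mark D s)"
    using z by (subst nn_integral_indicator) (auto simp: row_space_count)
  also have "\<dots> = (\<integral>\<^sup>+y. \<integral>\<^sup>+x. indicator {z} y \<partial>P0 \<partial>mark D s)"
    by (simp add: P0.emeasure_space_1)
  also have "\<dots> \<le> mark_int D u s"
    unfolding mark_int_Fubini[OF u] using u0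
    by (intro nn_integral_mono) (auto simp: indicator_def z_def)
  finally show ?thesis .
qed

text \<open>The infinite product over all units, as an infimum: for factors at most 1 it is the
  limit of the partial products.\<close>

definition mark_prod :: "nat \<Rightarrow> (real \<times> (nat \<Rightarrow> nat) \<Rightarrow> ennreal) \<Rightarrow> 'w \<Rightarrow> ennreal" where
  "mark_prod D u w = (INF k. \<Prod>n<k. u (\<omega> n w, row D n w))"

lemma marking:
  assumes u [measurable]: "u \<in> borel_measurable (mark_space D)" and u1: "\<And>z. u z \<le> 1"
  shows "(\<integral>\<^sup>+w. mark_prod D u w \<partial>M) = (\<integral>\<^sup>+w. eneg (\<Sum>n. elog (mark_int D u (\<theta> n w))) \<partial>M)"
proof -
  have lim: "(\<lambda>k. \<Prod>n<k. F n) \<longlonglongrightarrow> (INF k. \<Prod>n<k. F n)" if "\<And>n. F n \<le> 1" for F :: "nat \<Rightarrow> ennreal"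
  proof (rule LIMSEQ_INF)
    show "decseq (\<lambda>k. \<Prod>n<k. F n)"
      using that by (intro decseq_SucI) (simp add: mult_left_le)
  qed
  have le: "(\<Prod>n<k. F n) \<le> 1" if "\<And>n. F n \<le> 1" for F :: "nat \<Rightarrow> ennreal" and k
    using that by (intro prod_le_1) auto
  have [simp]: "mark_int D u s \<le> 1" for s
    by (rule mark_int_le_1) (rule u1)
  have "(\<lambda>k. \<integral>\<^sup>+w. (\<Prod>n<k. u (\<omega> n w, row D n w)) \<partial>M) \<longlonglongrightarrow> (\<integral>\<^sup>+w. mark_prod D u w \<partial>M)"
    unfolding mark_prod_def
    by (rule nn_integral_dominated_convergence[where w="\<lambda>_. 1"])
       (auto intro!: AE_I2 lim le u1 simp: emeasure_space_1)
  moreover have "(\<lambda>k. \<integral>\<^sup>+w. (\<Prod>n<k. mark_int D u (\<theta> n w)) \<partial>M) \<longlonglongrightarrow>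
                 (\<integral>\<^sup>+w. (INF k. \<Prod>n<k. mark_int D u (\<theta> n w)) \<partial>M)"
    by (rule nn_integral_dominated_convergence[where w="\<lambda>_. 1"])
       (auto intro!: AE_I2 lim le simp: emeasure_space_1)
  ultimately show ?thesis
    by (simp add: marking_finite[OF u] INF_prod_eq_eneg LIMSEQ_unique)
qed

text \<open>By the Laplace functional of the jumps, the mean of \<open>mark_prod D u\<close> depends on \<open>u\<close> only
  through the exponent of the thinned intensity.\<close>

theorem mark_prod_cong:
  assumes u [measurable]: "u \<in> borel_measurable (mark_space D)" and u1: "\<And>z. u z \<le> 1"
    and u0: "\<And>x. u (x, \<lambda>d\<in>{1..D}. 0) = 1"
    and u' [measurable]: "u' \<in> borel_measurable (mark_space D')" and u1': "\<And>z. u' z \<le> 1"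
    and u0': "\<And>x. u' (x, \<lambda>d\<in>{1..D'}. 0) = 1"
    and eq: "(\<integral>\<^sup>+s. (1 - mark_int D u s) * indicator {0<..<1} s \<partial>stable_intensity \<sigma>) =
             (\<integral>\<^sup>+s. (1 - mark_int D' u' s) * indicator {0<..<1} s \<partial>stable_intensity \<sigma>)"
  shows "(\<integral>\<^sup>+w. mark_prod D u w \<partial>M) = (\<integral>\<^sup>+w. mark_prod D' u' w \<partial>M)"
proof -
  obtain \<Psi> where \<Psi>: "\<And>f. f \<in> borel_measurable borel \<Longrightarrow> left_cont f \<Longrightarrow>
            (\<integral>\<^sup>+w. eneg (\<Sum>n. f (\<theta> n w)) \<partial>M) = \<Psi> (jump_exponent \<sigma> f)"
    using SBSP_jumps[OF \<sigma>(1) \<beta> c prob_space_axioms SB] by blast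
  have *: "(\<integral>\<^sup>+w. mark_prod D u w \<partial>M) =
           \<Psi> (\<integral>\<^sup>+s. (1 - mark_int D u s) * indicator {0<..<1} s \<partial>stable_intensity \<sigma>)"
    if u [measurable]: "u \<in> borel_measurable (mark_space D)" and u1: "\<And>z. u z \<le> 1"
      and u0: "\<And>x. u (x, \<lambda>d\<in>{1..D}. 0) = 1" for u D
  proof -
    have "left_cont (\<lambda>s. elog (mark_int D u s))"
      unfolding left_cont_def
      by (intro allI impI tendsto_elog mark_int_left_continuous[OF u u1] mark_int_pos[OF u u0])
         (auto intro: le_less_trans[OF mark_int_le_1[of u D, OF u1]])
    then have "(\<integral>\<^sup>+w. eneg (\<Sum>n. elog (mark_int D u (\<theta> n w))) \<partial>M) = \<Psi> (jump_exponent \<sigma> (\<lambda>s. elog (mark_int D u s)))"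
      by (intro \<Psi>) measurable
    then show ?thesis
      unfolding marking[OF u u1] by (simp add: jump_exponent_def eneg_elog mark_int_le_1 u1)
  qed
  show ?thesis
    unfolding *[OF u u1 u0] *[OF u' u1' u0'] eq ..
qed

end

section \<open>The Beta-negative binomial law of the future counts\<close>

definition nb_pgf :: "real \<Rightarrow> real \<Rightarrow> real \<Rightarrow> ennreal" where
  "nb_pgf v R p = (\<integral>\<^sup>+x. ennreal (v ^ x) \<partial>neg_binomial R p)"

lemma nb_pgf_eq:
  assumes "0 < R" "0 \<le> v" "v \<le> 1"
  shows "nb_pgf v R p = (if 0 < p \<and> p < 1 then ennreal (((1 - p) / (1 - v * p)) powr R) else 1)"
proof (cases "0 < p \<and> p < 1")
  case False
  then have "neg_binomial R p = return (count_space UNIV) 0"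
    unfolding neg_binomial_def by auto
  then have "nb_pgf v R p = 1"
    by (simp add: nb_pgf_def nn_integral_return)
  then show ?thesis using False by auto
qed (use assms in \<open>simp add: nb_pgf_def neg_binomial_pgf\<close>)

lemma nb_pgf_measurable [measurable]:
  assumes "0 < R" "0 \<le> v" "v \<le> 1"
  shows "nb_pgf v R \<in> borel_measurable borel"
  unfolding nb_pgf_eq[OF assms, abs_def] by measurable

lemma nb_pgf_le_1:
  assumes "0 \<le> v" "v \<le> 1"
  shows "nb_pgf v R p \<le> 1"
proof -
  interpret prob_space "neg_binomial R p" by (rule prob_space_neg_binomial)
  have "nb_pgf v R p \<le> (\<integral>\<^sup>+x. 1 \<partial>neg_binomial R p)"
    unfolding nb_pgf_def using assms by (intro nn_integral_mono) (auto intro: power_le_one)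
  then show ?thesis
    by (simp add: emeasure_space_1)
qed

text \<open>Shapes of independent negative binomial variables with the same p add up; this is the
  origin of the shape r D1.\<close>

lemma nb_pgf_power:
  assumes "0 < R" "0 \<le> v" "v \<le> 1" "0 < k" "0 < p" "p < 1"
  shows "nb_pgf v R p ^ k = nb_pgf v (R * real k) p"
proof -
  have "v * p \<le> 1 * p"
    using assms by (intro mult_right_mono) auto
  then have "v * p < 1"
    using assms by linarith
  then have "0 < (1 - p) / (1 - v * p)"
    using assms by simp
  moreover have "(x powr R) ^ k = x powr (R * real k)" if "0 < x" for x :: real
    using that by (simp add: powr_power mult.commute)
  ultimately show ?thesis
    using assms by (simp add: nb_pgf_eq ennreal_power)
qed

lemma sets_beta_distribution [simp, measurable_cong]: "sets (beta_distribution a b) = sets borel"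
  by (simp add: beta_distribution_def)

lemma prob_space_beta_distribution:
  assumes "0 < a" "0 < b"
  shows "prob_space (beta_distribution a b)"
proof (rule prob_spaceI)
  have B: "0 < Beta a b"
    using assms by (simp add: Beta_def Gamma_real_pos)
  have "((\<lambda>t. t powr (a - 1) * (1 - t) powr (b - 1)) has_integral Beta a b) {0<..<1}"
    using has_integral_Beta_real[OF assms] by (simp add: has_integral_Icc_iff_Ioo)
  then have "((\<lambda>t. if t \<in> {0<..<1} then t powr (a - 1) * (1 - t) powr (b - 1) else 0) has_integral Beta a b) UNIV"
    by (simp only: has_integral_restrict_UNIV)
  also have "(\<lambda>t. if t \<in> {0<..<1} then t powr (a - 1) * (1 - t) powr (b - 1) else 0) =
             (\<lambda>t. indicator {0<..<1} t * (t powr (a - 1) * (1 - t) powr (b - 1)))"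
    by auto
  finally have "(\<integral>\<^sup>+t. ennreal (indicator {0<..<1} t * (t powr (a - 1) * (1 - t) powr (b - 1))) \<partial>lborel) = ennreal (Beta a b)"
    by (intro nn_integral_has_integral_lborel) auto
  then have "(\<integral>\<^sup>+t. ennreal (1 / Beta a b) * ennreal (indicator {0<..<1} t * (t powr (a - 1) * (1 - t) powr (b - 1))) \<partial>lborel) = 1"
    using B by (subst nn_integral_cmult) (auto simp flip: ennreal_mult)
  then show "emeasure (beta_distribution a b) (space (beta_distribution a b)) = 1"
    unfolding beta_distribution_def using B
    by (simp add: emeasure_density mult.assoc flip: ennreal_mult')
qed

section \<open>Beta conjugacy and the equality of the exponents\<close>

locale nbp_days = nbp_model M \<sigma> \<beta> c r \<theta> \<omega> \<Theta> A Z
  for M :: "'w measure" and \<sigma> \<beta> c r :: real and \<theta> \<omega> :: "nat \<Rightarrow> 'w \<Rightarrow> real"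
    and \<Theta> :: "'w \<Rightarrow> real measure" and A :: "nat \<Rightarrow> nat \<Rightarrow> 'w \<Rightarrow> nat" and Z :: "nat \<Rightarrow> 'w \<Rightarrow> real measure" +
  fixes D0 D1 :: nat
  assumes D0: "1 \<le> D0" and D1: "1 \<le> D1"
begin

definition total :: "(nat \<Rightarrow> nat) \<Rightarrow> nat" where
  "total y = (\<Sum>d\<in>{1..D0}. y d)"

text \<open>For \<open>k = 0\<close> the first parameter is negative and this is no Beta law. Bounds
  on \<open>future_pgf v k\<close> are therefore confined to \<open>1 \<le> k\<close>, the totals of
  observed units.\<close>

definition future_law :: "nat \<Rightarrow> real measure" where
  "future_law k = beta_distribution (real k - \<sigma>) (r * real D0 + 1)"

definition future_pgf :: "real \<Rightarrow> nat \<Rightarrow> ennreal" where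
  "future_pgf v k = (\<integral>\<^sup>+j. nb_pgf v (r * real D1) j \<partial>future_law k)"

lemma prob_space_future_law: "1 \<le> k \<Longrightarrow> prob_space (future_law k)"
  unfolding future_law_def using \<sigma> r by (intro prob_space_beta_distribution) (auto simp: add_nonneg_pos)

lemma rD1: "0 < r * real D1"
  using r D1 by simp

lemma future_pgf_le_1:
  assumes "0 \<le> v" "v \<le> 1" "1 \<le> k"
  shows "future_pgf v k \<le> 1"
proof -
  interpret F: prob_space "future_law k" by (rule prob_space_future_law) fact
  have "future_pgf v k \<le> (\<integral>\<^sup>+j. 1 \<partial>future_law k)"
    unfolding future_pgf_def using assms by (intro nn_integral_mono nb_pgf_le_1)
  then show ?thesis
    by (simp add: F.emeasure_space_1)
qed

text \<open>The mass of the likelihood of an observed row y under the stable intensity on (0,1). Its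
  Beta factor cancels the normalisation of \<open>beta_distribution\<close>.\<close>

definition weight_const :: "(nat \<Rightarrow> nat) \<Rightarrow> real" where
  "weight_const y = (\<Prod>d\<in>{1..D0}. nb_coeff r (y d)) * \<sigma> * Beta (real (total y) - \<sigma>) (r * real D0 + 1)"

text \<open>Conjugacy: the likelihood of the counts \<open>y\<close> turns the stable intensity into a Beta law.\<close>

lemma weight_beta:
  assumes k: "1 \<le> total y" and h [measurable]: "h \<in> borel_measurable borel"
  shows "(\<integral>\<^sup>+s. ennreal (weight D0 y s) * h s * indicator {0<..<1} s \<partial>stable_intensity \<sigma>) =
         ennreal (weight_const y) * (\<integral>\<^sup>+s. h s \<partial>future_law (total y))"
proof -
  define a where "a = real (total y) - \<sigma>"
  define b where "b = r * real D0 + 1"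
  have ab: "0 < a" "0 < b"
    using k \<sigma> r by (auto simp: a_def b_def add_nonneg_pos)
  then have B: "0 < Beta a b"
    by (simp add: Beta_def Gamma_real_pos)
  define N where "N = (\<Prod>d\<in>{1..D0}. nb_coeff r (y d))"
  have N: "0 \<le> N"
    unfolding N_def using r by (intro prod_nonneg ballI nb_coeff_nonneg)
  have w: "weight D0 y s = N * s ^ total y * (1 - s) powr (r * real D0)" if "0 < s" "s < 1" for s
    using that by (simp add: weight_def N_def prod.distrib total_def power_sum powr_power mult.commute[of r])
  have [measurable]: "weight D0 y \<in> borel_measurable borel"
    unfolding weight_def[abs_def] by measurable
  have "(\<integral>\<^sup>+s. ennreal (weight D0 y s) * h s * indicator {0<..<1} s \<partial>stable_intensity \<sigma>) =
        (\<integral>\<^sup>+s. ennreal (indicator {0<..} s * \<sigma> * s powr (- 1 - \<sigma>)) * (ennreal (weight D0 y s) * h s * indicator {0<..<1} s) \<partial>lborel)"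
    unfolding stable_intensity_def by (rule nn_integral_density) measurable
  also have "\<dots> = (\<integral>\<^sup>+s. ennreal (weight_const y) *
      (ennreal (indicator {0<..<1} s * s powr (a - 1) * (1 - s) powr (b - 1) / Beta a b) * h s) \<partial>lborel)"
  proof (rule nn_integral_cong)
    fix s :: real
    show "ennreal (indicator {0<..} s * \<sigma> * s powr (- 1 - \<sigma>)) * (ennreal (weight D0 y s) * h s * indicator {0<..<1} s) =
        ennreal (weight_const y) * (ennreal (indicator {0<..<1} s * s powr (a - 1) * (1 - s) powr (b - 1) / Beta a b) * h s)"
    proof (cases "0 < s \<and> s < 1")
      case True
      have "s powr (- 1 - \<sigma>) * s ^ total y = s powr (a - 1)"
        using True by (simp add: a_def powr_realpow[symmetric] flip: powr_add) (simp add: algebra_simps)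
      then have "\<sigma> * s powr (- 1 - \<sigma>) * weight D0 y s = weight_const y * (s powr (a - 1) * (1 - s) powr (b - 1) / Beta a b)"
        using True B by (simp add: w weight_const_def N_def[symmetric] a_def[symmetric] b_def[symmetric])
           (simp add: b_def mult_ac)
      then have "ennreal (\<sigma> * s powr (- 1 - \<sigma>)) * ennreal (weight D0 y s) =
            ennreal (weight_const y) * ennreal (s powr (a - 1) * (1 - s) powr (b - 1) / Beta a b)"
        using True \<sigma> B N weight_nonneg[of s D0 y]
        by (subst (1 2) ennreal_mult[symmetric]) (auto simp: weight_const_def N_def[symmetric] a_def[symmetric] b_def[symmetric])
      then show ?thesis
        using True by (simp add: mult.assoc[symmetric])
    qed (auto simp: indicator_def)
  qed
  also have "\<dots> = ennreal (weight_const y) * (\<integral>\<^sup>+s. h s \<partial>future_law (total y))"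
    unfolding future_law_def a_def[symmetric] b_def[symmetric] beta_distribution_def
    by (subst nn_integral_cmult) (auto simp: nn_integral_density)
  finally show ?thesis .
qed

definition zero_row :: "(nat \<Rightarrow> nat) \<Rightarrow> bool" where
  "zero_row y \<longleftrightarrow> (\<forall>d\<in>{1..D0}. y d = 0)"

lemma total_pos: "\<not> zero_row y \<Longrightarrow> 1 \<le> total y"
  by (auto simp: zero_row_def total_def Suc_le_eq One_nat_def intro!: sum_pos2)

lemma zero_row_iff: "zero_row y \<longleftrightarrow> total y = 0"
  by (auto simp: zero_row_def total_def)

text \<open>The factor 1 at the zero row restricts the product to observed units, and it gives the
  positivity under which logarithms are continuous.\<close>

definition test_past :: "(real \<times> (nat \<Rightarrow> nat)) set \<Rightarrow> (nat \<Rightarrow> ennreal) \<Rightarrow> real \<times> (nat \<Rightarrow> nat) \<Rightarrow> ennreal" where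
  "test_past T q = (\<lambda>(x, a). if zero_row a then 1 else indicator (- T) (x, a) * q (total a))"

text \<open>Both \<open>zero_row\<close> and T look at the days up to D0 only, so a unit first seen
  later contributes 1, just as it is left out of the future sum.\<close>

definition test_future :: "(real \<times> (nat \<Rightarrow> nat)) set \<Rightarrow> real \<Rightarrow> real \<times> (nat \<Rightarrow> nat) \<Rightarrow> ennreal" where
  "test_future T v = (\<lambda>(x, y). if zero_row y then 1 else
     indicator (- T) (x, restrict y {1..D0}) * (\<Prod>d\<in>{D0<..D0 + D1}. ennreal (v ^ y d)))"

lemma total_measurable [measurable]: "D0 \<le> D \<Longrightarrow> total \<in> measurable (row_space D) (count_space UNIV)"
  unfolding total_def row_space_count by simp

lemma zero_row_measurable [measurable]: "D0 \<le> D \<Longrightarrow> Measurable.pred (row_space D) zero_row"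
  unfolding row_space_count by simp

lemma test_past_measurable [measurable]:
  assumes T [measurable]: "T \<in> sets (mark_space D0)"
  shows "test_past T q \<in> borel_measurable (mark_space D0)"
proof -
  have [measurable]: "(\<lambda>z. indicator (- T) z :: ennreal) \<in> borel_measurable (mark_space D0)"
    by (simp add: indicator_compl)
  have [measurable]: "Measurable.pred (mark_space D0) (\<lambda>z. zero_row (snd z))"
    by (rule measurable_compose[OF measurable_snd zero_row_measurable]) simp
  have [measurable]: "(\<lambda>z. q (total (snd z))) \<in> borel_measurable (mark_space D0)"
    by (rule measurable_compose[OF measurable_compose[OF measurable_snd total_measurable]]) simp_all
  have *: "test_past T q = (\<lambda>z. if zero_row (snd z) then 1 else indicator (- T) z * q (total (snd z)))"
    by (auto simp: test_past_def)
  show ?thesis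
    unfolding * by measurable
qed

lemma test_future_measurable [measurable]:
  assumes T [measurable]: "T \<in> sets (mark_space D0)"
  shows "test_future T v \<in> borel_measurable (mark_space (D0 + D1))"
proof -
  have [measurable]: "(\<lambda>z. indicator (- T) z :: ennreal) \<in> borel_measurable (mark_space D0)"
    by (simp add: indicator_compl)
  have [measurable]: "(\<lambda>y. restrict y {1..D0}) \<in> measurable (row_space (D0 + D1)) (row_space D0)"
    by (rule measurable_restrict_subset) auto
  have [measurable]: "(\<lambda>y. \<Prod>d\<in>{D0<..D0 + D1}. ennreal (v ^ y d)) \<in> borel_measurable (row_space (D0 + D1))"
    unfolding row_space_count by simp
  have [measurable]: "Measurable.pred (mark_space (D0 + D1)) (\<lambda>z. zero_row (snd z))"
    by (rule measurable_compose[OF measurable_snd zero_row_measurable]) simp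
  have [measurable]: "(\<lambda>z. indicator (- T) (fst z, restrict (snd z) {1..D0}) :: ennreal) \<in> borel_measurable (mark_space (D0 + D1))"
    by (rule measurable_compose[of "\<lambda>z. (fst z, restrict (snd z) {1..D0})" _ "mark_space D0"]) measurable
  have [measurable]: "(\<lambda>z. \<Prod>d\<in>{D0<..D0 + D1}. ennreal (v ^ snd z d)) \<in> borel_measurable (mark_space (D0 + D1))"
    by (rule measurable_compose[OF measurable_snd]) measurable
  have *: "test_future T v = (\<lambda>z. if zero_row (snd z) then 1 else indicator (- T) (fst z, restrict (snd z) {1..D0}) *
      (\<Prod>d\<in>{D0<..D0 + D1}. ennreal (v ^ snd z d)))"
    by (auto simp: test_future_def)
  show ?thesis
    unfolding * by measurable
qed

definition void_prob :: "(real \<times> (nat \<Rightarrow> nat)) set \<Rightarrow> (nat \<Rightarrow> nat) \<Rightarrow> ennreal" where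
  "void_prob T a = (\<integral>\<^sup>+x. indicator (- T) (x, a) \<partial>P0)"

lemma void_prob_le_1: "void_prob T a \<le> 1"
proof -
  have "void_prob T a \<le> (\<integral>\<^sup>+x. 1 \<partial>P0)"
    unfolding void_prob_def by (intro nn_integral_mono) (auto simp: indicator_def)
  then show ?thesis
    by (simp add: P0.emeasure_space_1)
qed

text \<open>Integrating the label first leaves \<open>void_prob T a\<close>, and the zero rows
  cancel against 1. Only rows with total at least 1 remain, which have finite weight under the
  stable intensity.\<close>

lemma mark_int_test_past:
  assumes T [measurable]: "T \<in> sets (mark_space D0)" and q: "\<And>k. 1 \<le> k \<Longrightarrow> q k \<le> 1"
    and s: "0 < s" "s < 1"
  shows "1 - mark_int D0 (test_past T q) s =
         (\<integral>\<^sup>+a. ennreal (weight D0 a s) * (if zero_row a then 0 else 1 - void_prob T a * q (total a)) \<partial>row_space D0)"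
proof -
  interpret m: prob_space "mark D0 s" by (rule prob_space_mark)
  define g where "g a = (if zero_row a then 1 else void_prob T a * q (total a))" for a
  have T' [measurable]: "(\<lambda>x. indicator (- T) (x, a) :: ennreal) \<in> borel_measurable P0" if "a \<in> space (row_space D0)" for a
  proof -
    have "(\<lambda>z. indicator (- T) z :: ennreal) \<in> borel_measurable (mark_space D0)"
      by (simp add: indicator_compl)
    then show ?thesis
      by (rule measurable_compose[rotated]) (use that in measurable)
  qed
  have g1: "g a \<le> 1" for a
    using void_prob_le_1[of T a] q[OF total_pos[of a]] mult_mono[of "void_prob T a" 1 "q (total a)" 1]
    by (auto simp: g_def)
  have sp: "space (mark D0 s) = space (row_space D0)"
    by (rule sets_eq_imp_space_eq) simp
  have "mark_int D0 (test_past T q) s = (\<integral>\<^sup>+a. g a \<partial>mark D0 s)"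
    unfolding mark_int_Fubini[OF test_past_measurable[OF T]]
  proof (rule nn_integral_cong)
    fix a assume "a \<in> space (mark D0 s)"
    then have a: "a \<in> space (row_space D0)" by (simp add: sp)
    show "(\<integral>\<^sup>+x. test_past T q (x, a) \<partial>P0) = g a"
      using T'[OF a] by (auto simp: test_past_def g_def void_prob_def P0.emeasure_space_1 nn_integral_multc)
  qed
  then have "1 - mark_int D0 (test_past T q) s = (\<integral>\<^sup>+a. 1 \<partial>mark D0 s) - (\<integral>\<^sup>+a. g a \<partial>mark D0 s)"
    by (simp add: m.emeasure_space_1)
  also have "\<dots> = (\<integral>\<^sup>+a. 1 - g a \<partial>mark D0 s)"
  proof (rule nn_integral_diff[symmetric])
    have "(\<integral>\<^sup>+a. g a \<partial>mark D0 s) \<le> (\<integral>\<^sup>+a. 1 \<partial>mark D0 s)"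
      by (intro nn_integral_mono g1)
    then show "(\<integral>\<^sup>+a. g a \<partial>mark D0 s) \<noteq> \<infinity>"
      by (auto simp: m.emeasure_space_1 top_unique)
    show "g \<in> borel_measurable (mark D0 s)"
      by (simp add: measurable_cong_sets[OF sets_mark refl]) (simp add: row_space_count)
  qed (auto simp: g1)
  also have "\<dots> = (\<integral>\<^sup>+a. ennreal (weight D0 a s) * (1 - g a) \<partial>row_space D0)"
    by (intro nn_integral_mark s) (simp add: row_space_count)
  finally show ?thesis
    by (simp add: g_def if_distrib[where f="\<lambda>x. 1 - x"] cong: if_cong)
qed

text \<open>Given the jump, past and future days are independent, so the future factors integrate to
  the number \<open>nb_pgf v (r * real D1) s\<close>, which takes the place of q.\<close>

lemma mark_int_test_future:
  assumes T [measurable]: "T \<in> sets (mark_space D0)" and v: "0 \<le> v" "v \<le> 1" and s: "0 < s" "s < 1"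
  shows "mark_int (D0 + D1) (test_future T v) s = mark_int D0 (test_past T (\<lambda>_. nb_pgf v (r * real D1) s)) s"
  unfolding mark_int_def
proof (rule nn_integral_cong)
  fix x assume x: "x \<in> space P0"
  interpret product_sigma_finite "\<lambda>_::nat. neg_binomial r s"
    by (intro product_sigma_finite.intro prob_space_imp_sigma_finite prob_space_neg_binomial)
  define I J where "I = {1..D0}" and "J = {D0<..D0 + D1}"
  have IJ: "I \<inter> J = {}" "finite I" "finite J" "I \<union> J = {1..D0 + D1}"
    by (auto simp: I_def J_def)
  interpret PJ: prob_space "PiM J (\<lambda>_. neg_binomial r s)"
    by (intro prob_space_PiM prob_space_neg_binomial)
  have "(\<lambda>y. test_future T v (x, y)) \<in> borel_measurable (mark (D0 + D1) s)"
    using x by measurable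
  then have "(\<integral>\<^sup>+y. test_future T v (x, y) \<partial>mark (D0 + D1) s) =
        (\<integral>\<^sup>+a. \<integral>\<^sup>+b. test_future T v (x, merge I J (a, b)) \<partial>PiM J (\<lambda>_. neg_binomial r s) \<partial>PiM I (\<lambda>_. neg_binomial r s))"
    unfolding mark_def IJ(4)[symmetric] by (rule product_nn_integral_fold[OF IJ(1-3)])
  also have "\<dots> = (\<integral>\<^sup>+a. test_past T (\<lambda>_. nb_pgf v (r * real D1) s) (x, a) \<partial>PiM I (\<lambda>_. neg_binomial r s))"
  proof (rule nn_integral_cong)
    fix a assume "a \<in> space (PiM I (\<lambda>_. neg_binomial r s))"
    then have a: "a \<in> extensional I"
      by (auto simp: space_PiM PiE_def)
    have z: "zero_row (merge I J (a, b)) \<longleftrightarrow> zero_row a" for b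
      by (auto simp: zero_row_def merge_def I_def)
    have rs: "restrict (merge I J (a, b)) {1..D0} = a" for b
      using a by (auto simp: merge_def I_def fun_eq_iff extensional_def)
    have pr: "(\<Prod>d\<in>J. ennreal (v ^ merge I J (a, b) d)) = (\<Prod>d\<in>J. ennreal (v ^ b d))" for b
      using IJ(1) by (intro prod.cong) (auto simp: merge_def)
    have "(\<integral>\<^sup>+b. (\<Prod>d\<in>J. ennreal (v ^ b d)) \<partial>PiM J (\<lambda>_. neg_binomial r s)) = (\<Prod>d\<in>J. nb_pgf v r s)"
      unfolding nb_pgf_def by (rule product_nn_integral_prod[OF IJ(3)]) auto
    also have "\<dots> = nb_pgf v (r * real D1) s"
      using nb_pgf_power[of r v D1 s] r v s D1 by (simp add: J_def)
    finally have pgf: "(\<integral>\<^sup>+b. (\<Prod>d\<in>J. ennreal (v ^ b d)) \<partial>PiM J (\<lambda>_. neg_binomial r s)) = nb_pgf v (r * real D1) s" .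
    have "(\<lambda>b. \<Prod>d\<in>J. ennreal (v ^ b d)) \<in> borel_measurable (PiM J (\<lambda>_. neg_binomial r s))"
      by measurable
    then show "(\<integral>\<^sup>+b. test_future T v (x, merge I J (a, b)) \<partial>PiM J (\<lambda>_. neg_binomial r s)) =
          test_past T (\<lambda>_. nb_pgf v (r * real D1) s) (x, a)"
      by (simp add: test_future_def test_past_def z rs pr pgf PJ.emeasure_space_1 nn_integral_cmult J_def[symmetric])
  qed
  finally show "(\<integral>\<^sup>+y. test_future T v (x, y) \<partial>mark (D0 + D1) s) =
      (\<integral>\<^sup>+a. test_past T (\<lambda>_. nb_pgf v (r * real D1) s) (x, a) \<partial>mark D0 s)"
    by (simp add: mark_def I_def)
qed

lemma exponent_eq:
  assumes T [measurable]: "T \<in> sets (mark_space D0)" and v: "0 \<le> v" "v \<le> 1"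
  shows "(\<integral>\<^sup>+s. (1 - mark_int (D0 + D1) (test_future T v) s) * indicator {0<..<1} s \<partial>stable_intensity \<sigma>) =
         (\<integral>\<^sup>+s. (1 - mark_int D0 (test_past T (future_pgf v)) s) * indicator {0<..<1} s \<partial>stable_intensity \<sigma>)"
proof -
  have [measurable]: "weight D0 a \<in> borel_measurable borel" for a
    unfolding weight_def[abs_def] by measurable
  note nb_pgf_measurable[OF rD1 v, measurable]
  \<comment> \<open>Covers both exponents: in one, q depends on the jump s only, in the other on the
    total k only. The integrand is affine in q, so only the mean of \<open>q s k\<close> under
    \<open>future_law k\<close> enters, and this is \<open>future_pgf v k\<close> in both
    cases.\<close>
  have swap: "(\<integral>\<^sup>+s. (1 - F s) * indicator {0<..<1} s \<partial>stable_intensity \<sigma>) =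
      (\<integral>\<^sup>+a. (if zero_row a then 0 else ennreal (weight_const a) * (1 - void_prob T a * future_pgf v (total a))) \<partial>row_space D0)"
    if F: "\<And>s. 0 < s \<Longrightarrow> s < 1 \<Longrightarrow> F s = mark_int D0 (test_past T (q s)) s"
      and q1: "\<And>s k. 1 \<le> k \<Longrightarrow> q s k \<le> 1"
      and q_meas [measurable]: "\<And>k. (\<lambda>s. q s k) \<in> borel_measurable borel"
      and q: "\<And>k. 1 \<le> k \<Longrightarrow> (\<integral>\<^sup>+s. q s k \<partial>future_law k) = future_pgf v k"
    for F and q :: "real \<Rightarrow> nat \<Rightarrow> ennreal"
  proof -
    define h where "h a s = (if zero_row a then 0 else 1 - void_prob T a * q s (total a))" for a s
    have [measurable]: "h a \<in> borel_measurable borel" for a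
      unfolding h_def by measurable
    have "(\<integral>\<^sup>+s. (1 - F s) * indicator {0<..<1} s \<partial>stable_intensity \<sigma>) =
          (\<integral>\<^sup>+s. (\<integral>\<^sup>+a. ennreal (weight D0 a s) * h a s * indicator {0<..<1} s \<partial>row_space D0) \<partial>stable_intensity \<sigma>)"
    proof (rule nn_integral_cong)
      fix s
      show "(1 - F s) * indicator {0<..<1} s =
            (\<integral>\<^sup>+a. ennreal (weight D0 a s) * h a s * indicator {0<..<1} s \<partial>row_space D0)"
        by (cases "0 < s \<and> s < 1") (auto simp: F mark_int_test_past[OF T q1] h_def)
    qed
    \<comment> \<open>There are countably many rows, so this exchanges a series with an
      integral.\<close>
    also have "\<dots> = (\<integral>\<^sup>+a. (\<integral>\<^sup>+s. ennreal (weight D0 a s) * h a s * indicator {0<..<1} s \<partial>stable_intensity \<sigma>) \<partial>row_space D0)"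
      unfolding row_space_count
      by (rule nn_integral_count_space_nn_integral) (auto intro!: countable_PiE)
    also have "\<dots> = (\<integral>\<^sup>+a. (if zero_row a then 0 else ennreal (weight_const a) * (1 - void_prob T a * future_pgf v (total a))) \<partial>row_space D0)"
    proof (rule nn_integral_cong)
      fix a
      show "(\<integral>\<^sup>+s. ennreal (weight D0 a s) * h a s * indicator {0<..<1} s \<partial>stable_intensity \<sigma>) =
            (if zero_row a then 0 else ennreal (weight_const a) * (1 - void_prob T a * future_pgf v (total a)))"
      proof (cases "zero_row a")
        case False
        then have k: "1 \<le> total a" by (rule total_pos)
        interpret b: prob_space "future_law (total a)" by (rule prob_space_future_law[OF k])
        have [measurable_cong]: "sets (future_law (total a)) = sets borel"
          by (simp add: future_law_def)
        have le: "void_prob T a * q s (total a) \<le> 1" for s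
          using mult_mono[OF void_prob_le_1 q1[OF k]] by simp
        have "(\<integral>\<^sup>+s. h a s \<partial>future_law (total a)) =
              (\<integral>\<^sup>+s. 1 \<partial>future_law (total a)) - (\<integral>\<^sup>+s. void_prob T a * q s (total a) \<partial>future_law (total a))"
          unfolding h_def if_not_P[OF False]
        proof (rule nn_integral_diff)
          have "(\<integral>\<^sup>+s. void_prob T a * q s (total a) \<partial>future_law (total a)) \<le> (\<integral>\<^sup>+s. 1 \<partial>future_law (total a))"
            by (intro nn_integral_mono le)
          then show "(\<integral>\<^sup>+s. void_prob T a * q s (total a) \<partial>future_law (total a)) \<noteq> \<infinity>"
            by (auto simp: b.emeasure_space_1 top_unique)
        qed (auto simp: le)
        also have "\<dots> = 1 - void_prob T a * future_pgf v (total a)"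
          by (simp add: b.emeasure_space_1 nn_integral_cmult q[OF k])
        finally show ?thesis
          using False by (simp add: weight_beta[OF k])
      qed (simp add: h_def)
    qed
    finally show ?thesis .
  qed
  have "(\<integral>\<^sup>+s. (1 - mark_int (D0 + D1) (test_future T v) s) * indicator {0<..<1} s \<partial>stable_intensity \<sigma>) =
      (\<integral>\<^sup>+a. (if zero_row a then 0 else ennreal (weight_const a) * (1 - void_prob T a * future_pgf v (total a))) \<partial>row_space D0)"
    by (rule swap[of "mark_int (D0 + D1) (test_future T v)" "\<lambda>s _. nb_pgf v (r * real D1) s"])
       (auto simp: mark_int_test_future T v nb_pgf_le_1 future_pgf_def)
  moreover have "(\<integral>\<^sup>+s. (1 - mark_int D0 (test_past T (future_pgf v)) s) * indicator {0<..<1} s \<partial>stable_intensity \<sigma>) =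
      (\<integral>\<^sup>+a. (if zero_row a then 0 else ennreal (weight_const a) * (1 - void_prob T a * future_pgf v (total a))) \<partial>row_space D0)"
    by (rule swap[of "mark_int D0 (test_past T (future_pgf v))" "\<lambda>_. future_pgf v"])
       (auto simp: v future_pgf_le_1 prob_space.emeasure_space_1[OF prob_space_future_law])
  ultimately show ?thesis by simp
qed

end

section \<open>The sigma-algebra of the data\<close>

lemma measurable_emeasure_measure_algebra:
  "a \<in> sets K \<Longrightarrow> (\<lambda>M. emeasure M a) \<in> borel_measurable (measure_algebra K)"
  by (auto intro!: measurable_Sup1 measurable_vimage_algebra1 simp: measure_algebra_def)

lemma measurable_measure_algebra:
  "(\<And>x. x \<in> space N \<Longrightarrow> sets (f x) = sets K) \<Longrightarrow>
   (\<And>a. a \<in> sets K \<Longrightarrow> (\<lambda>x. emeasure (f x) a) \<in> borel_measurable N) \<Longrightarrow>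
   f \<in> measurable N (measure_algebra K)"
  by (auto intro!: measurable_Sup2 measurable_vimage_algebra2 simp: measure_algebra_def)

section \<open>Counting points by the cells of a grid\<close>

definition cell :: "nat \<Rightarrow> real \<Rightarrow> nat" where
  "cell k x = nat \<lfloor>x * real k\<rfloor>"

text \<open>For positive k the point 1 has cell k to itself, so there are k + 1 cells; hence the
  range \<open>i \<le> k\<close> in all sums and products over cells.\<close>

lemma cell_le: "x \<in> {0..1} \<Longrightarrow> cell k x \<le> k"
proof -
  assume "x \<in> {0..1}"
  then have "x * real k \<le> 1 * real k"
    by (intro mult_right_mono) auto
  then have "\<lfloor>x * real k\<rfloor> \<le> int k"
    by (simp add: floor_le_iff)
  then show ?thesis
    by (simp add: cell_def)
qed

lemma cell_measurable [measurable]: "cell k \<in> measurable borel (count_space UNIV)"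
  unfolding cell_def[abs_def] by measurable

text \<open>Two points are in different cells once the mesh 1/k is below their distance, and a
  finite set has finitely many pairs.\<close>

lemma cell_separates:
  assumes "finite X" "X \<subseteq> {0..1}"
  shows "\<forall>\<^sub>F k in sequentially. inj_on (cell k) X"
proof -
  have "\<forall>\<^sub>F k in sequentially. cell k (fst p) = cell k (snd p) \<longrightarrow> fst p = snd p" if p: "p \<in> X \<times> X" for p
  proof (cases "fst p = snd p")
    case False
    obtain x y where "p = (x, y)"
      by (cases p)
    then have xy: "p = (x, y)" "x \<in> {0..1}" "y \<in> {0..1}" "x \<noteq> y"
      using p subsetD[OF assms(2)] False by auto
    obtain K :: nat where K: "1 / \<bar>x - y\<bar> < real K"
      using reals_Archimedean2 by blast
    show ?thesis
      using eventually_ge_at_top[of K]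
    proof eventually_elim
      case (elim k)
      then have "1 / \<bar>x - y\<bar> < real k"
        using K by (meson less_le_trans of_nat_mono)
      then have "1 < \<bar>x - y\<bar> * real k"
        using xy by (simp add: field_simps)
      also have "\<dots> = \<bar>x * real k - y * real k\<bar>"
        by (simp add: abs_mult flip: left_diff_distrib)
      finally have "\<lfloor>x * real k\<rfloor> \<noteq> \<lfloor>y * real k\<rfloor>"
        by linarith
      moreover have "0 \<le> x * real k" "0 \<le> y * real k"
        using xy by auto
      ultimately have "cell k x \<noteq> cell k y"
        by (simp add: cell_def nat_eq_iff)
      then show ?case
        by (simp add: xy)
    qed
  qed auto
  then have "\<forall>\<^sub>F k in sequentially. \<forall>p\<in>X \<times> X. cell k (fst p) = cell k (snd p) \<longrightarrow> fst p = snd p"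
    using assms by (intro eventually_ball_finite) auto
  then show ?thesis
    by eventually_elim (auto simp: inj_on_def)
qed

text \<open>Occupied cells never outnumber the points, and every finite subset is separated by some
  grid. The grids are not nested, so this is not a monotone limit; infinite X has finite subsets of
  every size.\<close>

lemma SUP_card_cells:
  assumes X: "X \<subseteq> {0..1}"
  shows "(SUP k. of_nat (card (cell k ` X))) = emeasure (count_space UNIV) X"
proof (rule antisym)
  show "(SUP k. of_nat (card (cell k ` X))) \<le> emeasure (count_space UNIV) X"
    by (intro SUP_least) (auto simp: emeasure_count_space intro!: of_nat_mono card_image_le)
  have fin: "finite (cell k ` X)" for k
    by (rule finite_subset[of _ "{..k}"], rule image_subsetI, unfold atMost_iff, rule cell_le, erule subsetD[OF X]) simp
  have *: "of_nat (card Y) \<le> (SUP k. of_nat (card (cell k ` X)) :: ennreal)" if "finite Y" "Y \<subseteq> X" for Y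
  proof -
    have "Y \<subseteq> {0..1}"
      using that X by blast
    from cell_separates[OF \<open>finite Y\<close> this] obtain k where "inj_on (cell k) Y"
      unfolding eventually_sequentially by blast
    then have "card Y = card (cell k ` Y)"
      by (simp add: card_image)
    also have "\<dots> \<le> card (cell k ` X)"
      using that by (intro card_mono fin image_mono)
    finally show ?thesis
      by (intro SUP_upper2[of k]) auto
  qed
  show "emeasure (count_space UNIV) X \<le> (SUP k. of_nat (card (cell k ` X)))"
  proof (cases "finite X")
    case False
    have "(SUP n. of_nat n :: ennreal) \<le> (SUP k. of_nat (card (cell k ` X)))"
    proof (rule SUP_least)
      fix n
      obtain Y where "finite Y" "Y \<subseteq> X" "card Y = n"
        using infinite_arbitrarily_large[OF False] by blast
      then show "of_nat n \<le> (SUP k. of_nat (card (cell k ` X)) :: ennreal)"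
        using * by blast
    qed
    then have "(SUP k. of_nat (card (cell k ` X)) :: ennreal) = top"
      by (simp only: ennreal_SUP_of_nat_eq_top top_unique)
    then show ?thesis
      by (simp only: top_greatest)
  qed (use * in auto)
qed

lemma emeasure_count_space_nat: "emeasure (count_space UNIV) X = (\<Sum>n::nat. indicator X n)"
  by (simp add: nn_integral_count_space_nat[symmetric])

lemma suminf_swap_ennreal:
  fixes f :: "nat \<Rightarrow> nat \<Rightarrow> ennreal"
  shows "(\<Sum>i. \<Sum>j. f i j) = (\<Sum>j. \<Sum>i. f i j)"
proof -
  have "(\<Sum>i. \<Sum>j. f i j) = (\<integral>\<^sup>+i. (\<Sum>j. f i j) \<partial>count_space UNIV)"
    by (simp add: nn_integral_count_space_nat)
  also have "\<dots> = (\<Sum>j. \<integral>\<^sup>+i. f i j \<partial>count_space UNIV)"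
    by (rule nn_integral_suminf) auto
  finally show ?thesis
    by (simp add: nn_integral_count_space_nat)
qed

lemma of_nat_eq_suminf: "(of_nat a :: ennreal) = (\<Sum>j. if j < a then 1 else 0)"
proof -
  have "(\<Sum>j. if j < a then 1 else 0 :: ennreal) = (\<Sum>j<a. if j < a then 1 else 0)"
    by (rule suminf_finite) auto
  then show ?thesis by simp
qed

context nbp_model
begin

lemma omega_in [simp]: "w \<in> space M \<Longrightarrow> \<omega> n w \<in> space P0"
  using measurable_space[OF omega_measurable] .

lemma borel_P0: "f \<in> measurable borel N \<Longrightarrow> f \<in> measurable P0 N"
proof -
  assume "f \<in> measurable borel N"
  then have "f \<in> measurable lborel N" by simp
  then show ?thesis
    unfolding P0_def by (rule measurable_restrict_space1)
qed

lemma omega_borel [measurable]: "\<omega> n \<in> borel_measurable M"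
proof -
  have "(\<lambda>x. x) \<in> borel_measurable P0"
    by (rule borel_P0) simp
  from measurable_compose[OF omega_measurable this] show ?thesis .
qed

lemma singleton_P0: "x \<in> space P0 \<Longrightarrow> {x} \<in> sets P0"
  unfolding sets_P0 by (subst sets_restrict_space_iff) (auto simp: space_P0)

lemma Z_eq:
  "w \<in> space M \<Longrightarrow> 1 \<le> d \<Longrightarrow> Z d w = atomic_measure P0 (\<lambda>n. of_nat (A d n w)) (\<lambda>n. \<omega> n w)"
  using NB unfolding iid_NBP_def by blast

lemma sets_Z [simp]: "w \<in> space M \<Longrightarrow> 1 \<le> d \<Longrightarrow> sets (Z d w) = sets P0"
  by (simp add: Z_eq)

lemma emeasure_Z:
  assumes "w \<in> space M" "1 \<le> d" "I \<in> sets P0"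
  shows "emeasure (Z d w) I = (\<Sum>n. of_nat (A d n w) * indicator I (\<omega> n w))"
  using assms by (simp add: Z_eq emeasure_atomic_measure)

lemma emeasure_Z_pos_iff:
  assumes "w \<in> space M" "1 \<le> d" "I \<in> sets P0"
  shows "0 < emeasure (Z d w) I \<longleftrightarrow> (\<exists>n. 0 < A d n w \<and> \<omega> n w \<in> I)"
proof -
  have "emeasure (Z d w) I = 0 \<longleftrightarrow> (\<forall>n. of_nat (A d n w) * indicator I (\<omega> n w) = (0::ennreal))"
    unfolding emeasure_Z[OF assms] by (simp add: suminf_eq_zero_iff)
  then show ?thesis
    unfolding zero_less_iff_neq_zero[of "emeasure (Z d w) I"] by (auto simp: indicator_def)
qed

lemma Z_measurable:
  assumes d: "1 \<le> d"
  shows "Z d \<in> measurable M (measure_algebra P0)"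
proof (rule measurable_measure_algebra)
  fix I assume I [measurable]: "I \<in> sets P0"
  have [measurable]: "A d n \<in> measurable M (count_space UNIV)" for n
    by (rule A_measurable[OF d])
  have "(\<lambda>w. \<Sum>n. of_nat (A d n w) * indicator I (\<omega> n w) :: ennreal) \<in> borel_measurable M"
    by measurable
  then show "(\<lambda>w. emeasure (Z d w) I) \<in> borel_measurable M"
    by (rule measurable_cong[THEN iffD1, rotated]) (simp add: emeasure_Z d I)
qed (simp add: d)

text \<open>Two independent uniform labels coincide with probability 0, since single points are null
  for \<open>P0\<close>, and there are countably many pairs.\<close>

lemma AE_inj_omega: "AE w in M. inj (\<lambda>n. \<omega> n w)"
proof -
  have "AE w in M. \<omega> i w \<noteq> \<omega> j w" if ij: "i \<noteq> j" for i j
  proof -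
    have "indep_vars (\<lambda>_. P0) \<omega> {i, j}"
      by (rule indep_vars_subset[OF indep_omega subset_UNIV])
    then have "distr M (PiM {i, j} (\<lambda>_. P0)) (\<lambda>w. \<lambda>k\<in>{i, j}. \<omega> k w) = PiM {i, j} (\<lambda>k. distr M P0 (\<omega> k))"
      by (subst (asm) indep_vars_iff_distr_eq_PiM') auto
    then have eq: "distr M (PiM {i, j} (\<lambda>_. P0)) (\<lambda>w. \<lambda>k\<in>{i, j}. \<omega> k w) = PiM {i, j} (\<lambda>_. P0)"
      by (simp add: distr_omega)
    interpret product_sigma_finite "\<lambda>_::nat. P0"
      by (intro product_sigma_finite.intro prob_space_imp_sigma_finite P0.prob_space_axioms)
    have [measurable]: "(\<lambda>x. x) \<in> borel_measurable P0"
      by (rule borel_P0) simp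
    have [measurable]: "(\<lambda>y. y k) \<in> borel_measurable (PiM {i, j} (\<lambda>_. P0))" if "k \<in> {i, j}" for k
      by (rule measurable_compose[OF measurable_component_singleton[OF that]]) measurable
    have m [measurable]: "(\<lambda>y. if y i = y j then 1 else 0 :: ennreal) \<in> borel_measurable (PiM {i, j} (\<lambda>_. P0))"
      by measurable
    have "(\<integral>\<^sup>+w. (if \<omega> i w = \<omega> j w then 1 else 0) \<partial>M) =
          (\<integral>\<^sup>+y. (if y i = y j then 1 else 0) \<partial>distr M (PiM {i, j} (\<lambda>_. P0)) (\<lambda>w. \<lambda>k\<in>{i, j}. \<omega> k w))"
      by (subst nn_integral_distr) (auto intro!: measurable_restrict)
    also have "\<dots> = (\<integral>\<^sup>+y. (if y i = y j then 1 else 0) \<partial>PiM {i, j} (\<lambda>_. P0))"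
      unfolding eq ..
    also have "\<dots> = (\<integral>\<^sup>+x. \<integral>\<^sup>+y. (if x = y then 1 else 0) \<partial>P0 \<partial>P0)"
    proof -
      have "(\<integral>\<^sup>+y. (if y i = y j then 1 else 0 :: ennreal) \<partial>PiM {i, j} (\<lambda>_. P0)) =
            (\<integral>\<^sup>+x. \<integral>\<^sup>+y. (if x = y j then 1 else 0) \<partial>PiM {j} (\<lambda>_. P0) \<partial>P0)"
        using ij m by (subst product_nn_integral_insert_rev) auto
      also have "\<dots> = (\<integral>\<^sup>+x. \<integral>\<^sup>+y. (if x = y then 1 else 0) \<partial>P0 \<partial>P0)"
        by (intro nn_integral_cong product_nn_integral_singleton) measurable
      finally show ?thesis .
    qed
    also have "\<dots> = (\<integral>\<^sup>+x. 0 \<partial>P0)"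
    proof (rule nn_integral_cong)
      fix x assume x: "x \<in> space P0"
      have "(\<integral>\<^sup>+y. (if x = y then 1 else 0) \<partial>P0) = (\<integral>\<^sup>+y. indicator {x} y \<partial>P0)"
        by (intro nn_integral_cong) (auto simp: indicator_def)
      also have "\<dots> = emeasure P0 {x}"
        using singleton_P0[OF x] by simp
      also have "\<dots> = 0"
        using x by (simp add: P0_def emeasure_restrict_space)
      finally show "(\<integral>\<^sup>+y. (if x = y then 1 else 0) \<partial>P0) = 0" .
    qed
    finally have "(\<integral>\<^sup>+w. (if \<omega> i w = \<omega> j w then 1 else 0) \<partial>M) = 0"
      by simp
    then have "AE w in M. (if \<omega> i w = \<omega> j w then 1 else 0) = (0::ennreal)"
      by (subst (asm) nn_integral_0_iff_AE) auto
    then show ?thesis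
      by eventually_elim (auto split: if_splits)
  qed
  then have "AE w in M. \<forall>i j. i \<noteq> j \<longrightarrow> \<omega> i w \<noteq> \<omega> j w"
    by (simp add: AE_all_countable)
  then show ?thesis
    by eventually_elim (auto simp: inj_def)
qed

end

section \<open>Observed units and void events\<close>

context nbp_days
begin

text \<open>Observed units by their index in the model, whereas \<open>observed\<close> collects
  labels; the two are in bijection when labels are distinct.\<close>

definition obs :: "'w \<Rightarrow> nat set" where
  "obs w = {n. \<not> zero_row (row D0 n w)}"

lemma obs_iff: "n \<in> obs w \<longleftrightarrow> (\<exists>d\<in>{1..D0}. 0 < A d n w)"
  by (auto simp: obs_def zero_row_def row_def)

lemma observed_eq: "w \<in> space M \<Longrightarrow> observed Z D0 w = (\<lambda>n. \<omega> n w) ` obs w"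
proof (rule set_eqI)
  fix x assume w: "w \<in> space M"
  have "x \<in> observed Z D0 w \<longleftrightarrow> x \<in> space P0 \<and> (\<exists>d\<in>{1..D0}. \<exists>n. 0 < A d n w \<and> \<omega> n w = x)"
  proof -
    have "0 < emeasure (Z d w) {x} \<longleftrightarrow> (\<exists>n. 0 < A d n w \<and> \<omega> n w = x)"
      if "x \<in> space P0" "d \<in> {1..D0}" for d
      using emeasure_Z_pos_iff[OF w _ singleton_P0[OF that(1)], of d] that(2) by auto
    then show ?thesis
      unfolding observed_def by blast
  qed
  also have "\<dots> \<longleftrightarrow> (\<exists>n\<in>obs w. \<omega> n w = x)"
    using w omega_in[OF w] unfolding obs_iff Bex_def by blast
  finally show "x \<in> observed Z D0 w \<longleftrightarrow> x \<in> (\<lambda>n. \<omega> n w) ` obs w"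
    by auto
qed

lemma data_map_measurable:
  "(\<lambda>w. \<lambda>d\<in>{1..D0}. Z d w) \<in> measurable M (PiM {1..D0} (\<lambda>_. measure_algebra P0))"
  by (intro measurable_restrict Z_measurable) auto

lemma sets_data_algebra:
  "sets (data_algebra M Z D0) =
     {(\<lambda>w. \<lambda>d\<in>{1..D0}. Z d w) -` Y \<inter> space M |Y. Y \<in> sets (PiM {1..D0} (\<lambda>_. measure_algebra P0))}"
  unfolding data_algebra_def
  by (rule sets_vimage_algebra2) (auto dest: measurable_space[OF data_map_measurable])

definition void_event :: "(real \<times> (nat \<Rightarrow> nat)) set \<Rightarrow> 'w set" where
  "void_event T = {w \<in> space M. \<forall>n\<in>obs w. (\<omega> n w, row D0 n w) \<notin> T}"

text \<open>Counts of observed units in a set are limits of numbers of occupied cells of finer and finer grids,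
  so on \<open>simple_labels\<close> the void events determine the data.\<close>

definition void_algebra :: "'w measure" where
  "void_algebra = sigma (space M) (void_event ` sets (mark_space D0))"

lemma void_event_subset: "void_event ` X \<subseteq> Pow (space M)"
  by (auto simp: void_event_def)

lemma space_void_algebra [simp]: "space void_algebra = space M"
  by (simp add: void_algebra_def space_measure_of_conv)

lemma sets_void_algebra: "sets void_algebra = sigma_sets (space M) (void_event ` sets (mark_space D0))"
  unfolding void_algebra_def by (intro sets_measure_of void_event_subset)

lemma void_event_in [measurable]: "T \<in> sets (mark_space D0) \<Longrightarrow> void_event T \<in> sets void_algebra"
  by (auto simp: sets_void_algebra)

text \<open>Counts indices, so units with a common label count separately. Occupied cells do not
  show such multiplicities, which is why measurability is claimed on \<open>simple_labels\<close>
  only.\<close>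

definition npts :: "(real \<times> (nat \<Rightarrow> nat)) set \<Rightarrow> 'w \<Rightarrow> ennreal" where
  "npts T w = emeasure (count_space UNIV) {n \<in> obs w. (\<omega> n w, row D0 n w) \<in> T}"

definition simple_labels :: "'w set" where
  "simple_labels = {w \<in> space M. inj (\<lambda>n. \<omega> n w)}"

lemma row_in: "w \<in> space M \<Longrightarrow> row D n w \<in> space (row_space D)"
  using measurable_space[OF row_measurable] .

lemma npts_measurable:
  assumes T [measurable]: "T \<in> sets (mark_space D0)"
  shows "npts T \<in> borel_measurable (restrict_space void_algebra simple_labels)"
proof -
  \<comment> \<open>Cell i of grid k is occupied by an observed unit with mark in T exactly outside
    \<open>void_event (C k i)\<close>, so the number of occupied cells is a sum of indicators of the
    void algebra.\<close>
  define C where "C k i = T \<inter> {z \<in> space (mark_space D0). cell k (fst z) = i}" for k i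
  have [measurable]: "cell k \<in> measurable P0 (count_space UNIV)" for k
    by (rule borel_P0) measurable
  have C: "C k i \<in> sets (mark_space D0)" for k i
    unfolding C_def by measurable
  have "npts T w = (SUP k. \<Sum>i\<le>k. indicator (space M - void_event (C k i)) w)" if w: "w \<in> simple_labels" for w
  proof -
    define X where "X = (\<lambda>n. \<omega> n w) ` {n \<in> obs w. (\<omega> n w, row D0 n w) \<in> T}"
    have wM: "w \<in> space M" and inj: "inj (\<lambda>n. \<omega> n w)"
      using w by (auto simp: simple_labels_def)
    have X: "X \<subseteq> {0..1}"
      using wM by (auto simp: X_def space_P0[symmetric])
    have "npts T w = emeasure (count_space UNIV) X"
      using inj_on_subset[OF inj] card_image[OF inj_on_subset[OF inj]] finite_image_iff[OF inj_on_subset[OF inj]]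
      by (simp add: npts_def X_def emeasure_count_space)
    also have "\<dots> = (SUP k. of_nat (card (cell k ` X)))"
      by (rule SUP_card_cells[OF X, symmetric])
    also have "\<dots> = (SUP k. \<Sum>i\<le>k. indicator (space M - void_event (C k i)) w)"
    proof (rule SUP_cong[OF refl])
      fix k
      have "w \<in> void_event (C k i) \<longleftrightarrow> i \<notin> cell k ` X" for i
        using wM by (auto simp: void_event_def C_def X_def space_pair_measure row_in)
      then have "(\<Sum>i\<le>k. indicator (space M - void_event (C k i)) w :: ennreal) = (\<Sum>i\<le>k. indicator (cell k ` X) i)"
        using wM by (intro sum.cong) (auto simp: indicator_def)
      also have "\<dots> = of_nat (card ({..k} \<inter> cell k ` X))"
        by (simp add: indicator_def sum.If_cases)
      also have "{..k} \<inter> cell k ` X = cell k ` X"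
        using X cell_le by auto
      finally show "of_nat (card (cell k ` X)) = (\<Sum>i\<le>k. indicator (space M - void_event (C k i)) w :: ennreal)" ..
    qed
    finally show ?thesis .
  qed
  moreover have "(\<lambda>w. SUP k. \<Sum>i\<le>k. indicator (space M - void_event (C k i)) w :: ennreal) \<in> borel_measurable void_algebra"
    using C sets.compl_sets[OF void_event_in[OF C]]
    by (intro borel_measurable_SUP borel_measurable_sum borel_measurable_indicator) auto
  then have "(\<lambda>w. SUP k. \<Sum>i\<le>k. indicator (space M - void_event (C k i)) w :: ennreal) \<in> borel_measurable (restrict_space void_algebra simple_labels)"
    by (rule measurable_restrict_space1)
  ultimately show ?thesis
    by (subst measurable_cong) (auto simp: space_restrict_space)
qed

text \<open>An integer a is the number of j < a. Hence the mass of I is the sum over j of the number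
  of units in I with more than j counts on day d.\<close>

lemma emeasure_Z_npts:
  assumes w: "w \<in> space M" and d: "d \<in> {1..D0}" and I: "I \<in> sets P0"
  shows "emeasure (Z d w) I = (\<Sum>j. npts {z \<in> I \<times> space (row_space D0). j < snd z d} w)"
proof -
  have I': "I \<subseteq> space P0"
    using I by (rule sets.sets_into_space)
  have "(of_nat (A d n w) * indicator I (\<omega> n w) :: ennreal) =
        (\<Sum>j. indicator {n \<in> obs w. (\<omega> n w, row D0 n w) \<in> {z \<in> I \<times> space (row_space D0). j < snd z d}} n)" for n
  proof (cases "\<omega> n w \<in> I")
    case True
    have "n \<in> obs w" if "j < A d n w" for j
      using that d by (auto simp: obs_iff intro!: bexI[of _ d])
    then have "indicator {n \<in> obs w. (\<omega> n w, row D0 n w) \<in> {z \<in> I \<times> space (row_space D0). j < snd z d}} n =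
          (if j < A d n w then 1 else 0 :: ennreal)" for j
      using True d row_in[OF w, of D0 n] by (auto simp: row_def)
    then show ?thesis
      using True by (simp add: of_nat_eq_suminf)
  qed simp
  then have "emeasure (Z d w) I = (\<Sum>n. \<Sum>j. indicator {n \<in> obs w. (\<omega> n w, row D0 n w) \<in> {z \<in> I \<times> space (row_space D0). j < snd z d}} n)"
    using d by (subst emeasure_Z[OF w _ I]) auto
  also have "\<dots> = (\<Sum>j. npts {z \<in> I \<times> space (row_space D0). j < snd z d} w)"
    unfolding npts_def emeasure_count_space_nat by (rule suminf_swap_ennreal)
  finally show ?thesis .
qed

text \<open>Only traces on \<open>simple_labels\<close> are compared, and this event itself is not
  claimed to lie in the void algebra. As it has probability one, integrals do not see the
  difference.\<close>

lemma data_in_void_algebra: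
  assumes C: "C \<in> sets (data_algebra M Z D0)"
  shows "\<exists>C'\<in>sets void_algebra. C \<inter> simple_labels = C' \<inter> simple_labels"
proof -
  define R where "R = restrict_space void_algebra simple_labels"
  have sp: "space R = simple_labels"
    by (auto simp: R_def space_restrict_space simple_labels_def)
  have Zm: "(\<lambda>w. \<lambda>d\<in>{1..D0}. Z d w) \<in> measurable R (PiM {1..D0} (\<lambda>_. measure_algebra P0))"
  proof (rule measurable_restrict, rule measurable_measure_algebra)
    fix d I assume d: "d \<in> {1..D0}" and I [measurable]: "I \<in> sets P0"
    have "{z \<in> I \<times> space (row_space D0). j < snd z d} \<in> sets (mark_space D0)" for j
    proof -
      have "(\<lambda>y. y d) \<in> measurable (row_space D0) (count_space UNIV)"
        using d by (rule measurable_component_singleton)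
      then have [measurable]: "(\<lambda>z. snd z d) \<in> measurable (mark_space D0) (count_space UNIV)"
        by (rule measurable_compose[OF measurable_snd])
      have "{z \<in> I \<times> space (row_space D0). j < snd z d} =
            (I \<times> space (row_space D0)) \<inter> {z \<in> space (mark_space D0). j < snd z d}"
        using sets.sets_into_space[OF I] by (auto simp: space_pair_measure)
      also have "\<dots> \<in> sets (mark_space D0)"
        by measurable
      finally show ?thesis .
    qed
    then have "(\<lambda>w. \<Sum>j. npts {z \<in> I \<times> space (row_space D0). j < snd z d} w) \<in> borel_measurable R"
      unfolding R_def by (intro borel_measurable_suminf_order npts_measurable)
    then show "(\<lambda>w. emeasure (Z d w) I) \<in> borel_measurable R"
      by (rule measurable_cong[THEN iffD1, rotated])
         (auto simp: sp simple_labels_def emeasure_Z_npts[OF _ d I])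
  qed (auto simp: sp simple_labels_def)
  obtain Y where Y: "Y \<in> sets (PiM {1..D0} (\<lambda>_. measure_algebra P0))"
    and CY: "C = (\<lambda>w. \<lambda>d\<in>{1..D0}. Z d w) -` Y \<inter> space M"
    using C by (auto simp: sets_data_algebra)
  have "(\<lambda>w. \<lambda>d\<in>{1..D0}. Z d w) -` Y \<inter> space R \<in> sets R"
    by (rule measurable_sets[OF Zm Y])
  also have "(\<lambda>w. \<lambda>d\<in>{1..D0}. Z d w) -` Y \<inter> space R = C \<inter> simple_labels"
    by (auto simp: CY sp simple_labels_def)
  finally show ?thesis
    by (auto simp: R_def sets_restrict_space)
qed

end

section \<open>Generating functions of the future counts on data events\<close>

lemma INF_prod_finite:
  fixes G :: "nat \<Rightarrow> ennreal"
  assumes J: "finite J" and G1: "\<And>n. G n \<le> 1" and G: "\<And>n. n \<notin> J \<Longrightarrow> G n = 1"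
  shows "(INF k. \<Prod>n<k. G n) = (\<Prod>n\<in>J. G n)"
proof (rule antisym)
  obtain k where k: "J \<subseteq> {..<k}"
    using finite_nat_iff_bounded J by blast
  have "(\<Prod>n<k. G n) = (\<Prod>n\<in>J. G n)"
    using k G by (intro prod.mono_neutral_right) auto
  then show "(INF k. \<Prod>n<k. G n) \<le> (\<Prod>n\<in>J. G n)"
    by (intro INF_lower2[OF UNIV_I[of k]]) (simp only: order_refl)
  show "(\<Prod>n\<in>J. G n) \<le> (INF k. \<Prod>n<k. G n)"
  proof (rule INF_greatest)
    fix k
    have "(\<Prod>n\<in>J. G n) = (\<Prod>n\<in>J \<inter> {..<k}. G n) * (\<Prod>n\<in>J - {..<k}. G n)"
      using J by (subst prod.union_disjoint[symmetric]) (auto intro!: prod.cong)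
    also have "\<dots> \<le> (\<Prod>n\<in>J \<inter> {..<k}. G n) * 1"
      by (intro mult_left_mono prod_le_1) (auto simp: G1)
    also have "\<dots> = (\<Prod>n\<in>J \<inter> {..<k}. G n)"
      by simp
    also have "\<dots> = (\<Prod>n<k. G n)"
      by (rule prod.mono_neutral_left) (auto intro: G)
    finally show "(\<Prod>n\<in>J. G n) \<le> (\<Prod>n<k. G n)" .
  qed
qed

text \<open>One zero factor annihilates the product. With it, the set T comes out of the infinite
  product as the indicator of its void event.\<close>

lemma INF_prod_kill:
  fixes G :: "nat \<Rightarrow> ennreal"
  shows "(INF k. \<Prod>n<k. if P n then 0 else G n) = (if \<exists>n. P n then 0 else (INF k. \<Prod>n<k. G n))"
proof (cases "\<exists>n. P n")
  case True
  then obtain n where "P n" by auto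
  then have "(\<Prod>j<Suc n. if P j then 0 else G j) = 0"
    by (subst prod.lessThan_Suc) simp
  then have "(INF k. \<Prod>n<k. if P n then 0 else G n) \<le> 0"
    by (intro INF_lower2[OF UNIV_I[of "Suc n"]]) (simp only: order_refl)
  then have "(INF k. \<Prod>n<k. if P n then 0 else G n) = 0"
    by (simp only: le_zero_eq)
  then show ?thesis
    by (simp only: if_P[OF True])
qed auto

lemma cells_subset: "X \<subseteq> {0..1} \<Longrightarrow> cell k ` X \<subseteq> {..k}"
  by (rule image_subsetI, unfold atMost_iff, rule cell_le, erule subsetD)

context nbp_days
begin

lemma row_restrict: "restrict (row (D0 + D1) n w) {1..D0} = row D0 n w"
  by (auto simp: row_def)

lemma zero_row_row: "zero_row (row (D0 + D1) n w) \<longleftrightarrow> n \<notin> obs w" "zero_row (row D0 n w) \<longleftrightarrow> n \<notin> obs w"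
  by (auto simp: zero_row_def obs_iff row_def)

lemma test_past_le_1:
  assumes "\<And>k. 1 \<le> k \<Longrightarrow> q k \<le> 1"
  shows "test_past T q z \<le> 1"
  using assms[OF total_pos] by (cases z) (auto simp: test_past_def indicator_def)

lemma test_future_le_1:
  assumes "0 \<le> v" "v \<le> 1"
  shows "test_future T v z \<le> 1"
proof -
  have "(\<Prod>d\<in>J. ennreal (v ^ y d)) \<le> 1" for J and y :: "nat \<Rightarrow> nat"
    using assms by (intro prod_le_1) (auto intro: power_le_one)
  then show ?thesis
    by (cases z) (auto simp: test_future_def indicator_def)
qed

lemma mark_prod_test:
  assumes T: "T \<in> sets (mark_space D0)" and v: "0 \<le> v" "v \<le> 1"
  shows "(\<integral>\<^sup>+w. mark_prod (D0 + D1) (test_future T v) w \<partial>M) =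
         (\<integral>\<^sup>+w. mark_prod D0 (test_past T (future_pgf v)) w \<partial>M)"
proof (rule mark_prod_cong)
  show "test_future T v (x, \<lambda>d\<in>{1..D0 + D1}. 0) = 1" "test_past T (future_pgf v) (x, \<lambda>d\<in>{1..D0}. 0) = 1" for x
    by (auto simp: test_future_def test_past_def zero_row_def)
qed (use T v in \<open>auto intro!: test_past_le_1 test_future_le_1 future_pgf_le_1 exponent_eq\<close>)

text \<open>For finitely many observed units this is v to the power of their future total. The
  product form makes sense without finiteness, so the identity on data events can be proved first
  and restricted afterwards.\<close>

definition real_pgf :: "real \<Rightarrow> 'w \<Rightarrow> ennreal" where
  "real_pgf v = mark_prod (D0 + D1) (test_future {} v)"

definition pred_pgf :: "real \<Rightarrow> 'w \<Rightarrow> ennreal" where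
  "pred_pgf v = mark_prod D0 (test_past {} (future_pgf v))"

lemma mark_prod_measurable:
  assumes [measurable]: "u \<in> borel_measurable (mark_space D)"
  shows "mark_prod D u \<in> borel_measurable M"
  unfolding mark_prod_def[abs_def] by measurable

lemma pgf_measurable [measurable]: "real_pgf v \<in> borel_measurable M" "pred_pgf v \<in> borel_measurable M"
  unfolding real_pgf_def pred_pgf_def by (intro mark_prod_measurable test_future_measurable test_past_measurable; simp)+

lemma void_future:
  assumes w: "w \<in> space M"
  shows "mark_prod (D0 + D1) (test_future T v) w = indicator (void_event T) w * real_pgf v w"
proof -
  have "test_future T v (\<omega> n w, row (D0 + D1) n w) =
        (if n \<in> obs w \<and> (\<omega> n w, row D0 n w) \<in> T then 0 else test_future {} v (\<omega> n w, row (D0 + D1) n w))" for n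
    by (auto simp: test_future_def row_restrict zero_row_row)
  then show ?thesis
    unfolding mark_prod_def real_pgf_def
    using w by (simp add: INF_prod_kill) (auto simp: void_event_def indicator_def)
qed

lemma void_past:
  assumes w: "w \<in> space M"
  shows "mark_prod D0 (test_past T (future_pgf v)) w = indicator (void_event T) w * pred_pgf v w"
proof -
  have "test_past T (future_pgf v) (\<omega> n w, row D0 n w) =
        (if n \<in> obs w \<and> (\<omega> n w, row D0 n w) \<in> T then 0 else test_past {} (future_pgf v) (\<omega> n w, row D0 n w))" for n
    by (auto simp: test_past_def zero_row_row)
  then show ?thesis
    unfolding mark_prod_def pred_pgf_def
    using w by (simp add: INF_prod_kill) (auto simp: void_event_def indicator_def)
qed

lemma pgf_le_1:
  assumes "0 \<le> v" "v \<le> 1"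
  shows "real_pgf v w \<le> 1" "pred_pgf v w \<le> 1"
proof -
  have *: "mark_prod D u w \<le> 1" for D u
    unfolding mark_prod_def by (rule INF_lower2[of 0]) auto
  show "real_pgf v w \<le> 1" "pred_pgf v w \<le> 1"
    unfolding real_pgf_def pred_pgf_def by (rule *)+
qed

lemma void_event_sets_M: "T \<in> sets (mark_space D0) \<Longrightarrow> void_event T \<in> sets M"
proof -
  assume [measurable]: "T \<in> sets (mark_space D0)"
  have [measurable]: "Measurable.pred M (\<lambda>w. zero_row (row D0 n w))" for n
    by (rule measurable_compose[OF row_measurable zero_row_measurable]) simp
  have "void_event T = {w \<in> space M. \<forall>n. zero_row (row D0 n w) \<or> (\<omega> n w, row D0 n w) \<notin> T}"
    by (auto simp: void_event_def zero_row_row)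
  also have "\<dots> \<in> sets M"
    by measurable
  finally show ?thesis .
qed

lemma void_algebra_subset: "sets void_algebra \<subseteq> sets M"
  unfolding sets_void_algebra by (rule sets.sigma_sets_subset) (auto intro: void_event_sets_M)

text \<open>Void events satisfy \<open>void_event S \<inter> void_event T = void_event (S \<union>
  T)\<close>, so finite measures on the algebra are determined by them. On each of them the two
  densities have the same integral by \<open>mark_prod_test\<close>.\<close>

lemma void_algebra_eq:
  assumes C: "C \<in> sets void_algebra" and v: "0 \<le> v" "v \<le> 1"
  shows "(\<integral>\<^sup>+w. indicator C w * real_pgf v w \<partial>M) = (\<integral>\<^sup>+w. indicator C w * pred_pgf v w \<partial>M)"
proof -
  define \<mu> where "\<mu> f = distr (density M f) void_algebra (\<lambda>w. w)" for f :: "'w \<Rightarrow> ennreal"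
  have id: "(\<lambda>w. w) \<in> measurable (density M f) void_algebra" for f
    using void_algebra_subset by (intro measurableI) auto
  have em: "emeasure (\<mu> f) X = (\<integral>\<^sup>+w. indicator X w * f w \<partial>M)"
    if [measurable]: "f \<in> borel_measurable M" and X: "X \<in> sets void_algebra" for f X
  proof -
    have "X \<in> sets M"
      using X void_algebra_subset by blast
    moreover have "X \<subseteq> space M"
      using sets.sets_into_space[OF \<open>X \<in> sets M\<close>] .
    ultimately show ?thesis
      unfolding \<mu>_def by (subst emeasure_distr[OF id X]) (auto simp: emeasure_density Int_absorb2 mult.commute)
  qed
  have "\<mu> (real_pgf v) = \<mu> (pred_pgf v)"
  proof (rule measure_eqI_generator_eq[where E="void_event ` sets (mark_space D0)" and A="\<lambda>_. space M" and \<Omega>="space M"])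
    show "Int_stable (void_event ` sets (mark_space D0))"
    proof (rule Int_stableI)
      fix a b assume "a \<in> void_event ` sets (mark_space D0)" "b \<in> void_event ` sets (mark_space D0)"
      then obtain S T where ST: "a = void_event S" "b = void_event T" "S \<in> sets (mark_space D0)" "T \<in> sets (mark_space D0)"
        by auto
      then have "a \<inter> b = void_event (S \<union> T)"
        by (auto simp: void_event_def)
      then show "a \<inter> b \<in> void_event ` sets (mark_space D0)"
        using ST by auto
    qed
    show "void_event ` sets (mark_space D0) \<subseteq> Pow (space M)"
      by (rule void_event_subset)
    show "sets (\<mu> (real_pgf v)) = sigma_sets (space M) (void_event ` sets (mark_space D0))"
      "sets (\<mu> (pred_pgf v)) = sigma_sets (space M) (void_event ` sets (mark_space D0))"
      by (simp_all add: \<mu>_def sets_void_algebra)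
    have "space M = void_event {}"
      by (auto simp: void_event_def)
    then show "range (\<lambda>_::nat. space M) \<subseteq> void_event ` sets (mark_space D0)"
      by blast
    have "emeasure (\<mu> (real_pgf v)) (space M) = (\<integral>\<^sup>+w. indicator (space M) w * real_pgf v w \<partial>M)"
      using sets.top[of void_algebra] by (intro em) auto
    also have "\<dots> \<le> (\<integral>\<^sup>+w. 1 \<partial>M)"
      using pgf_le_1[OF v] by (intro nn_integral_mono) (auto simp: indicator_def)
    finally show "emeasure (\<mu> (real_pgf v)) (space M) \<noteq> \<infinity>"
      by (auto simp: emeasure_space_1 top_unique)
    fix X assume "X \<in> void_event ` sets (mark_space D0)"
    then obtain T where T: "X = void_event T" "T \<in> sets (mark_space D0)" by auto
    then have X: "X \<in> sets void_algebra" by simp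
    have "emeasure (\<mu> (real_pgf v)) X = (\<integral>\<^sup>+w. mark_prod (D0 + D1) (test_future T v) w \<partial>M)"
      using X by (subst em) (auto simp: T void_future intro!: nn_integral_cong)
    also have "\<dots> = (\<integral>\<^sup>+w. mark_prod D0 (test_past T (future_pgf v)) w \<partial>M)"
      by (rule mark_prod_test[OF T(2) v])
    also have "\<dots> = emeasure (\<mu> (pred_pgf v)) X"
      using X by (subst em) (auto simp: T void_past intro!: nn_integral_cong)
    finally show "emeasure (\<mu> (real_pgf v)) X = emeasure (\<mu> (pred_pgf v)) X" .
  qed auto
  then show ?thesis
    using em[OF _ C] by (metis pgf_measurable)
qed

lemma data_algebra_eq:
  assumes C: "C \<in> sets (data_algebra M Z D0)" and v: "0 \<le> v" "v \<le> 1"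
  shows "(\<integral>\<^sup>+w. indicator C w * real_pgf v w \<partial>M) = (\<integral>\<^sup>+w. indicator C w * pred_pgf v w \<partial>M)"
proof -
  obtain C' where C': "C' \<in> sets void_algebra" "C \<inter> simple_labels = C' \<inter> simple_labels"
    using data_in_void_algebra[OF C] by auto
  have "AE w in M. indicator C w = (indicator C' w :: ennreal)"
    using AE_inj_omega AE_space
  proof eventually_elim
    case (elim w)
    then have "w \<in> simple_labels"
      by (simp add: simple_labels_def)
    then show ?case
      using C'(2) by (auto simp: indicator_def)
  qed
  then have *: "(\<integral>\<^sup>+w. indicator C w * f w \<partial>M) = (\<integral>\<^sup>+w. indicator C' w * f w \<partial>M)" for f
    by (intro nn_integral_cong_AE) auto
  show ?thesis
    unfolding * by (rule void_algebra_eq[OF C'(1) v])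
qed

lemma obs_finite_iff: "w \<in> simple_labels \<Longrightarrow> finite (observed Z D0 w) \<longleftrightarrow> finite (obs w)"
  by (auto simp: simple_labels_def observed_eq finite_image_iff inj_on_subset)

lemma pred_pgf_finite:
  assumes w: "w \<in> space M" and fin: "finite (obs w)" and v: "0 \<le> v" "v \<le> 1"
  shows "pred_pgf v w = (\<Prod>n\<in>obs w. future_pgf v (total (row D0 n w)))"
proof -
  have "pred_pgf v w = (\<Prod>n\<in>obs w. test_past {} (future_pgf v) (\<omega> n w, row D0 n w))"
    unfolding pred_pgf_def mark_prod_def
    using v by (intro INF_prod_finite[OF fin] test_past_le_1 future_pgf_le_1) (auto simp: test_past_def zero_row_row)
  also have "\<dots> = (\<Prod>n\<in>obs w. future_pgf v (total (row D0 n w)))"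
    by (intro prod.cong) (auto simp: test_past_def zero_row_row)
  finally show ?thesis .
qed

lemma real_pgf_finite:
  assumes w: "w \<in> space M" and fin: "finite (obs w)" and v: "0 \<le> v" "v \<le> 1"
  shows "real_pgf v w = ennreal (v ^ (\<Sum>n\<in>obs w. \<Sum>d\<in>{D0<..D0 + D1}. A d n w))"
proof -
  have "real_pgf v w = (\<Prod>n\<in>obs w. test_future {} v (\<omega> n w, row (D0 + D1) n w))"
    unfolding real_pgf_def mark_prod_def
    using v by (intro INF_prod_finite[OF fin] test_future_le_1) (auto simp: test_future_def zero_row_row)
  also have "\<dots> = (\<Prod>n\<in>obs w. \<Prod>d\<in>{D0<..D0 + D1}. ennreal (v ^ A d n w))"
  proof -
    have "row (D0 + D1) n w d = A d n w" if "d \<in> {D0<..D0 + D1}" for n d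
      using that by (auto simp: row_def)
    then show ?thesis
      by (intro prod.cong refl) (auto simp: test_future_def zero_row_row intro!: prod.cong)
  qed
  also have "\<dots> = ennreal (v ^ (\<Sum>n\<in>obs w. \<Sum>d\<in>{D0<..D0 + D1}. A d n w))"
    using v by (simp add: prod_ennreal power_sum prod_nonneg)
  finally show ?thesis .
qed

section \<open>The predictive generating function as a function of the data\<close>

abbreviation "data \<equiv> data_algebra M Z D0"

lemma Z_data_measurable:
  assumes "d \<in> {1..D0}" "I \<in> sets P0"
  shows "(\<lambda>w. emeasure (Z d w) I) \<in> borel_measurable data"
proof -
  have "(\<lambda>w. \<lambda>d\<in>{1..D0}. Z d w) \<in> measurable data (PiM {1..D0} (\<lambda>_. measure_algebra P0))"
    unfolding data_algebra_def
    by (rule measurable_vimage_algebra1) (auto dest: measurable_space[OF data_map_measurable])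
  from measurable_compose[OF this measurable_component_singleton[OF assms(1)]]
  have "(\<lambda>w. Z d w) \<in> measurable data (measure_algebra P0)"
    using assms by simp
  from measurable_compose[OF this measurable_emeasure_measure_algebra[OF assms(2)]]
  show ?thesis .
qed

lemma space_data [simp]: "space data = space M"
  by (simp add: data_algebra_def)

lemma subalgebra_data: "subalgebra M data"
  unfolding subalgebra_def sets_data_algebra using data_map_measurable by (auto simp: measurable_sets)

definition cell_set :: "nat \<Rightarrow> nat \<Rightarrow> real set" where
  "cell_set k i = {x \<in> space P0. cell k x = i}"

lemma cell_set [simp]: "cell_set k i \<in> sets P0"
proof -
  have [measurable]: "cell k \<in> measurable P0 (count_space UNIV)"
    by (rule borel_P0) measurable
  show ?thesis
    unfolding cell_set_def by measurable
qed

definition cell_count :: "nat \<Rightarrow> nat \<Rightarrow> 'w \<Rightarrow> ennreal" where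
  "cell_count k i w = (\<Sum>d\<in>{1..D0}. emeasure (Z d w) (cell_set k i))"

lemma cell_count_measurable [measurable]: "cell_count k i \<in> borel_measurable data"
  unfolding cell_count_def[abs_def] by (intro borel_measurable_sum Z_data_measurable) auto

lemma cell_count_eq_0:
  assumes w: "w \<in> space M"
  shows "cell_count k i w = 0 \<longleftrightarrow> i \<notin> cell k ` observed Z D0 w"
proof -
  have "cell_count k i w \<noteq> 0 \<longleftrightarrow> (\<exists>d\<in>{1..D0}. 0 < emeasure (Z d w) (cell_set k i))"
    by (auto simp: cell_count_def zero_less_iff_neq_zero)
  also have "\<dots> \<longleftrightarrow> (\<exists>d\<in>{1..D0}. \<exists>n. 0 < A d n w \<and> \<omega> n w \<in> cell_set k i)"
    using w by (auto simp: emeasure_Z_pos_iff)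
  also have "\<dots> \<longleftrightarrow> (\<exists>n\<in>obs w. \<omega> n w \<in> cell_set k i)"
    unfolding Bex_def obs_iff by blast
  also have "\<dots> \<longleftrightarrow> i \<in> cell k ` observed Z D0 w"
    using w by (auto simp: observed_eq cell_set_def)
  finally show ?thesis by blast
qed

lemma observed_subset: "observed Z D0 w \<subseteq> {0..1}"
  by (auto simp: observed_def space_P0)

text \<open>The number of observed labels is the supremum over the grids of the number of cells with
  a positive count, and cell counts are functions of the data.\<close>

lemma finite_observed_data: "{w \<in> space M. finite (observed Z D0 w)} \<in> sets data"
proof -
  define X where "X w = (SUP k. \<Sum>i\<le>k. if cell_count k i w = 0 then 0 else 1 :: ennreal)" for w
  have X: "X w = emeasure (count_space UNIV) (observed Z D0 w)" if w: "w \<in> space M" for w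
  proof -
    have "(\<Sum>i\<le>k. if cell_count k i w = 0 then 0 else 1 :: ennreal) = of_nat (card (cell k ` observed Z D0 w))" for k
    proof -
      have "(\<Sum>i\<le>k. if cell_count k i w = 0 then 0 else 1 :: ennreal) =
            (\<Sum>i\<le>k. if i \<in> cell k ` observed Z D0 w then 1 else 0)"
        using w by (intro sum.cong) (auto simp: cell_count_eq_0)
      also have "\<dots> = of_nat (card ({..k} \<inter> cell k ` observed Z D0 w))"
        by (simp add: sum.If_cases)
      also have "{..k} \<inter> cell k ` observed Z D0 w = cell k ` observed Z D0 w"
        by (intro Int_absorb1 cells_subset observed_subset)
      finally show ?thesis .
    qed
    then show ?thesis
      unfolding X_def by (simp only: SUP_card_cells[OF observed_subset])
  qed
  have [measurable]: "X \<in> borel_measurable data"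
    unfolding X_def by measurable
  have "{w \<in> space M. finite (observed Z D0 w)} = {w \<in> space data. X w < top}"
    by (auto simp: X emeasure_count_space less_top[symmetric] of_nat_less_top split: if_splits)
  also have "\<dots> \<in> sets data"
    by measurable
  finally show ?thesis .
qed

text \<open>A conditional expectation must be a function of the data, whereas
  \<open>pred_pgf v\<close> refers to the numbering of the units. Here each cell is treated as a
  single unit, which is correct for fine grids when finitely many, distinct labels are observed. The
  \<open>liminf\<close> always exists and preserves measurability.\<close>

definition data_pgf :: "real \<Rightarrow> 'w \<Rightarrow> ennreal" where
  "data_pgf v w = liminf (\<lambda>k. \<Prod>i\<le>k. if cell_count k i w = 0 then 1 else future_pgf v (nat \<lfloor>enn2real (cell_count k i w)\<rfloor>))"

lemma data_pgf_measurable [measurable]: "data_pgf v \<in> borel_measurable data"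
proof -
  have "(\<lambda>w. nat \<lfloor>enn2real (cell_count k i w)\<rfloor>) \<in> measurable data (count_space UNIV)" for k i
    by measurable
  then have [measurable]: "(\<lambda>w. future_pgf v (nat \<lfloor>enn2real (cell_count k i w)\<rfloor>)) \<in> borel_measurable data" for k i
    by (rule measurable_compose) simp
  show ?thesis
    unfolding data_pgf_def[abs_def] by measurable
qed

lemma data_pgf_eq:
  assumes w: "w \<in> simple_labels" and fin: "finite (obs w)" and v: "0 \<le> v" "v \<le> 1"
  shows "data_pgf v w = pred_pgf v w"
proof -
  have wM: "w \<in> space M" and inj: "inj (\<lambda>n. \<omega> n w)"
    using w by (auto simp: simple_labels_def)
  define X where "X = observed Z D0 w"
  have X: "X = (\<lambda>n. \<omega> n w) ` obs w" "X \<subseteq> {0..1}"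
    unfolding X_def using observed_eq[OF wM] observed_subset by auto
  then have "finite X"
    using fin by simp
  have "\<forall>\<^sub>F k in sequentially. (\<Prod>i\<le>k. if cell_count k i w = 0 then 1 else future_pgf v (nat \<lfloor>enn2real (cell_count k i w)\<rfloor>)) = pred_pgf v w"
    using cell_separates[OF \<open>finite X\<close> X(2)]
  proof eventually_elim
    case (elim k)
    \<comment> \<open>Grid k separates the observed labels, so the count of an occupied cell is the
      total of its only unit.\<close>
    have cnt: "cell_count k (cell k (\<omega> n w)) w = of_nat (total (row D0 n w))" if n: "n \<in> obs w" for n
    proof -
      have "emeasure (Z d w) (cell_set k (cell k (\<omega> n w))) = of_nat (A d n w)" if d: "d \<in> {1..D0}" for d
      proof -
        have "of_nat (A d j w) * indicator (cell_set k (cell k (\<omega> n w))) (\<omega> j w) = (if j = n then of_nat (A d n w) else 0 :: ennreal)" for j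
        proof (cases "A d j w = 0")
          case False
          then have j: "j \<in> obs w"
            using d by (auto simp: obs_iff intro!: bexI[of _ d])
          have "cell k (\<omega> j w) = cell k (\<omega> n w) \<longleftrightarrow> j = n"
            using inj_onD[OF elim, of "\<omega> j w" "\<omega> n w"] injD[OF inj, of j n] j n X(1) by auto
          then show ?thesis
            using wM by (auto simp: cell_set_def indicator_def)
        qed auto
        then show ?thesis
          using d wM sums_single[of n "\<lambda>_. of_nat (A d n w) :: ennreal"] by (simp add: emeasure_Z sums_iff)
      qed
      then show ?thesis
        by (simp add: cell_count_def total_def row_def)
    qed
    define \<phi> where "\<phi> i = (if cell_count k i w = 0 then 1 else future_pgf v (nat \<lfloor>enn2real (cell_count k i w)\<rfloor>))" for i
    have "(\<Prod>i\<le>k. \<phi> i) = (\<Prod>i\<in>cell k ` X. \<phi> i)"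
    proof (rule prod.mono_neutral_right)
      show "cell k ` X \<subseteq> {..k}"
        by (rule cells_subset[OF X(2)])
      show "\<forall>i\<in>{..k} - cell k ` X. \<phi> i = 1"
        using cell_count_eq_0[OF wM] by (auto simp: \<phi>_def X_def)
    qed simp
    also have "\<dots> = (\<Prod>x\<in>X. \<phi> (cell k x))"
      by (simp add: prod.reindex[OF elim])
    also have "\<dots> = (\<Prod>n\<in>obs w. \<phi> (cell k (\<omega> n w)))"
      unfolding X(1) using inj by (subst prod.reindex) (auto intro: inj_on_subset)
    also have "\<dots> = (\<Prod>n\<in>obs w. future_pgf v (total (row D0 n w)))"
    proof (rule prod.cong[OF refl])
      fix n assume n: "n \<in> obs w"
      then have "total (row D0 n w) \<noteq> 0"
        using zero_row_iff zero_row_row(2) by blast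
      then show "\<phi> (cell k (\<omega> n w)) = future_pgf v (total (row D0 n w))"
        by (simp add: \<phi>_def cnt[OF n] ennreal_of_nat_eq_real_of_nat)
    qed
    also have "\<dots> = pred_pgf v w"
      by (rule pred_pgf_finite[OF wM fin v, symmetric])
    finally show ?case
      by (simp add: \<phi>_def)
  qed
  then have "(\<lambda>k. \<Prod>i\<le>k. if cell_count k i w = 0 then 1 else future_pgf v (nat \<lfloor>enn2real (cell_count k i w)\<rfloor>)) \<longlonglongrightarrow> pred_pgf v w"
    by (rule tendsto_eventually)
  then show ?thesis
    unfolding data_pgf_def by (intro lim_imp_Liminf) auto
qed

end

section \<open>The predictive law\<close>

text \<open>Almost sure identities are available for countably many arguments only. The points 1/j
  suffice because they accumulate at the centre of the series.\<close>

lemma ennreal_power_series_unique: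
  fixes a b :: "nat \<Rightarrow> ennreal"
  assumes eq: "\<And>j::nat. 2 \<le> j \<Longrightarrow> (\<Sum>s. a s * ennreal ((1 / real j) ^ s)) = (\<Sum>s. b s * ennreal ((1 / real j) ^ s))"
    and fin: "(\<Sum>s. a s * ennreal ((1 / 2) ^ s)) < top"
  shows "a s = b s"
proof -
  have finite: "c s < top" and summ: "summable (\<lambda>s. enn2real (c s) * (1 / 2) ^ s)"
    and real_eq: "\<And>j::nat. 2 \<le> j \<Longrightarrow> (\<Sum>s. c s * ennreal ((1 / real j) ^ s)) = ennreal (\<Sum>s. enn2real (c s) * (1 / real j) ^ s)
        \<and> summable (\<lambda>s. enn2real (c s) * (1 / real j) ^ s)"
    if c: "(\<Sum>s. c s * ennreal ((1 / 2) ^ s)) < top" for c :: "nat \<Rightarrow> ennreal" and s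
  proof -
    show cs: "c s < top" for s
    proof -
      have "c s * ennreal ((1 / 2) ^ s) \<le> (\<Sum>s. c s * ennreal ((1 / 2) ^ s))"
        using sum_le_suminf[of "\<lambda>s. c s * ennreal ((1 / 2) ^ s)" "{s}"] by simp
      then have "c s * ennreal ((1 / 2) ^ s) < top"
        using c by (rule le_less_trans)
      then show ?thesis
        by (auto simp: ennreal_mult_less_top)
    qed
    have e: "c s * ennreal (x ^ s) = ennreal (enn2real (c s) * x ^ s)" if "0 \<le> x" for s and x :: real
      using cs[of s] that by (simp add: ennreal_mult)
    have "(\<Sum>s. ennreal (enn2real (c s) * (1 / 2) ^ s)) < top"
      using c e[of "1 / 2"] by simp
    then show s2: "summable (\<lambda>s. enn2real (c s) * (1 / 2) ^ s)"
      by (intro summable_suminf_not_top) auto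
    fix j :: nat assume j: "2 \<le> j"
    have sj: "summable (\<lambda>s. enn2real (c s) * (1 / real j) ^ s)"
    proof (rule summable_comparison_test'[OF s2])
      fix s :: nat
      have "(1 / real j) ^ s \<le> (1 / 2) ^ s"
        using j by (intro power_mono divide_left_mono) auto
      then show "norm (enn2real (c s) * (1 / real j) ^ s) \<le> enn2real (c s) * (1 / 2) ^ s"
        by (auto simp: abs_mult intro!: mult_left_mono)
    qed
    then show "(\<Sum>s. c s * ennreal ((1 / real j) ^ s)) = ennreal (\<Sum>s. enn2real (c s) * (1 / real j) ^ s)
        \<and> summable (\<lambda>s. enn2real (c s) * (1 / real j) ^ s)"
      using e[of "1 / real j"] by (simp add: suminf_ennreal2)
  qed
  have finb: "(\<Sum>s. b s * ennreal ((1 / 2) ^ s)) < top"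
    using fin eq[of 2] by simp
  define d where "d s = enn2real (a s) - enn2real (b s)" for s
  have d2: "summable (\<lambda>s. d s * (1 / 2) ^ s)"
    using summable_diff[OF summ[OF fin] summ[OF finb]] by (simp add: d_def left_diff_distrib)
  have d0: "(\<lambda>s. d s * (1 / real j) ^ s) sums 0" if j: "2 \<le> j" for j
  proof -
    have A: "summable (\<lambda>s. enn2real (a s) * (1 / real j) ^ s)" and B: "summable (\<lambda>s. enn2real (b s) * (1 / real j) ^ s)"
      using real_eq[OF fin j] real_eq[OF finb j] by auto
    have "ennreal (\<Sum>s. enn2real (a s) * (1 / real j) ^ s) = ennreal (\<Sum>s. enn2real (b s) * (1 / real j) ^ s)"
      using real_eq[OF fin j] real_eq[OF finb j] eq[OF j] by simp
    then have "(\<Sum>s. enn2real (a s) * (1 / real j) ^ s) = (\<Sum>s. enn2real (b s) * (1 / real j) ^ s)"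
      using A B by (subst (asm) ennreal_inj) (auto intro!: suminf_nonneg)
    then show ?thesis
      using sums_diff[OF summable_sums[OF A] summable_sums[OF B]] by (simp add: d_def left_diff_distrib)
  qed
  have "d n = 0" for n
  proof (induction n rule: less_induct)
    case (less n)
    \<comment> \<open>When the coefficients before n vanish, this is the difference series divided
      by x^n, and its limit at 0 is \<open>d n\<close>.\<close>
    define g where "g x = (\<Sum>s. d (s + n) * x ^ s)" for x
    have sg: "summable (\<lambda>s. d (s + n) * x ^ s)" if "norm x < 1 / 2" for x
    proof -
      have "summable (\<lambda>s. d (s + n) * (1 / 2) ^ (s + n))"
        using d2 by (subst summable_iff_shift)
      then have "summable (\<lambda>s. d (s + n) * (1 / 2) ^ (s + n) * 2 ^ n)"
        by (rule summable_mult2)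
      moreover have "d (s + n) * (1 / 2) ^ (s + n) * 2 ^ n = d (s + n) * (1 / 2) ^ s" for s
        by (simp add: power_add power_divide)
      ultimately have "summable (\<lambda>s. d (s + n) * (1 / 2) ^ s)"
        by simp
      then show ?thesis
        by (rule powser_inside) (use that in auto)
    qed
    have gd: "(g \<longlongrightarrow> d (0 + n)) (at 0)"
      unfolding g_def[abs_def] using sg
      by (intro powser_limit_0[of "1 / 2" "\<lambda>s. d (s + n)"] summable_sums) auto
    \<comment> \<open>The shift by 3 keeps the points strictly inside the disc of radius
      1/2.\<close>
    have "filterlim (\<lambda>j. 1 / real (j + 3)) (at 0) sequentially"
      by real_asymp
    then have "(\<lambda>j. g (1 / real (j + 3))) \<longlonglongrightarrow> d (0 + n)"
      by (rule filterlim_compose[OF gd])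
    moreover have "g (1 / real (j + 3)) = 0" for j
    proof -
      define x where "x = 1 / real (j + 3)"
      have x: "0 < x" "norm x < 1 / 2"
        by (auto simp: x_def field_simps)
      have "(\<Sum>s. d s * x ^ s) = 0" and sd: "summable (\<lambda>s. d s * x ^ s)"
        using d0[of "j + 3"] by (auto simp: x_def sums_iff)
      then have "0 = (\<Sum>s. d (s + n) * x ^ (s + n)) + (\<Sum>s<n. d s * x ^ s)"
        using suminf_split_initial_segment[OF sd, of n] by simp
      also have "(\<Sum>s<n. d s * x ^ s) = 0"
        using less by simp
      also have "(\<Sum>s. d (s + n) * x ^ (s + n)) = x ^ n * g x"
        unfolding g_def using sg[OF x(2)]
        by (subst suminf_mult[symmetric]) (auto simp: power_add mult_ac)
      finally show ?thesis
        using x(1) by (simp add: x_def)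
    qed
    ultimately show ?case
      by (simp add: LIMSEQ_const_iff)
  qed
  then have "enn2real (a s) = enn2real (b s)"
    by (simp add: d_def)
  then show ?thesis
    using finite[OF fin, of s] finite[OF finb, of s]
    by (metis ennreal_enn2real)
qed

lemma nn_integral_nat_sum:
  fixes \<mu> :: "nat measure" and f :: "nat \<Rightarrow> ennreal"
  assumes \<mu>: "sets \<mu> = sets (count_space UNIV)"
  shows "(\<integral>\<^sup>+x. f x \<partial>\<mu>) = (\<Sum>s. emeasure \<mu> {s} * f s)"
proof -
  have m: "g \<in> borel_measurable \<mu>" for g :: "nat \<Rightarrow> ennreal"
    by (simp add: measurable_cong_sets[OF \<mu> refl])
  have "f x = (\<Sum>s. f s * indicator {s} x)" for x
  proof -
    have "(\<Sum>s. f s * indicator {s} x) = (\<Sum>s\<in>{x}. f s * indicator {s} x)"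
      by (rule suminf_finite) auto
    then show ?thesis by simp
  qed
  then have "(\<integral>\<^sup>+x. f x \<partial>\<mu>) = (\<integral>\<^sup>+x. (\<Sum>s. f s * indicator {s} x) \<partial>\<mu>)"
    by (rule nn_integral_cong)
  also have "\<dots> = (\<Sum>s. \<integral>\<^sup>+x. f s * indicator {s} x \<partial>\<mu>)"
    by (rule nn_integral_suminf) (rule m)
  also have "\<dots> = (\<Sum>s. emeasure \<mu> {s} * f s)"
    by (intro suminf_cong) (simp add: nn_integral_cmult_indicator \<mu> mult.commute)
  finally show ?thesis .
qed

lemma measurable_neg_binomial:
  assumes R: "0 < R"
  shows "neg_binomial R \<in> measurable borel (prob_algebra (count_space UNIV))"
proof (rule measurable_prob_algebraI)
  show "prob_space (neg_binomial R p)" for p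
    by (rule prob_space_neg_binomial)
  show "neg_binomial R \<in> measurable borel (subprob_algebra (count_space UNIV))"
  proof (rule measurable_subprob_algebra)
    show "subprob_space (neg_binomial R p)" for p
      by (intro prob_space_imp_subprob_space prob_space_neg_binomial)
    fix A :: "nat set"
    have "emeasure (neg_binomial R p) A =
      (if 0 < p \<and> p < 1 then (\<Sum>x. ennreal (nb_coeff R x * p ^ x * (1 - p) powr R) * indicator A x)
       else indicator A 0)" for p
    proof (cases "0 < p \<and> p < 1")
      case True
      then show ?thesis
        using R by (simp add: neg_binomial_density emeasure_density nn_integral_count_space_nat)
    next
      case False
      then have "neg_binomial R p = return (count_space UNIV) 0"
        unfolding neg_binomial_def by auto
      then show ?thesis
        using False by auto
    qed
    then show "(\<lambda>p. emeasure (neg_binomial R p) A) \<in> borel_measurable borel"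
      by simp
  qed simp
qed

lemma beta_neg_binomial:
  assumes R: "0 < R" and ab: "0 < a" "0 < b"
  shows "prob_space (beta_neg_binomial a b R)"
    and "sets (beta_neg_binomial a b R) = sets (borel \<Otimes>\<^sub>M count_space UNIV)"
    and "(\<integral>\<^sup>+p. ennreal (v ^ snd p) \<partial>beta_neg_binomial a b R) = (\<integral>\<^sup>+j. nb_pgf v R j \<partial>beta_distribution a b)"
proof -
  interpret b: prob_space "beta_distribution a b"
    by (rule prob_space_beta_distribution[OF ab])
  note measurable_neg_binomial[OF R, measurable]
  define K where "K j = distr (neg_binomial R j) (borel \<Otimes>\<^sub>M count_space UNIV) (\<lambda>x. (j, x))" for j :: real
  have K: "K \<in> measurable borel (prob_algebra (borel \<Otimes>\<^sub>M count_space UNIV))"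
    unfolding K_def by measurable
  then have K' [measurable]: "K \<in> measurable (beta_distribution a b) (subprob_algebra (borel \<Otimes>\<^sub>M count_space UNIV))"
    using measurable_prob_algebraD by (simp add: measurable_cong_sets[OF sets_beta_distribution refl])
  have eq: "beta_neg_binomial a b R = beta_distribution a b \<bind> K"
    by (simp add: beta_neg_binomial_def K_def[abs_def])
  show "prob_space (beta_neg_binomial a b R)"
    unfolding eq
    by (rule b.prob_space_bind[OF _ K']) (auto simp: K_def intro!: AE_I2 prob_space.prob_space_distr prob_space_neg_binomial)
  show "sets (beta_neg_binomial a b R) = sets (borel \<Otimes>\<^sub>M count_space UNIV)"
    unfolding eq by (rule sets_bind) (auto simp: K_def b.not_empty)
  have "(\<integral>\<^sup>+p. ennreal (v ^ snd p) \<partial>beta_neg_binomial a b R) = (\<integral>\<^sup>+j. \<integral>\<^sup>+p. ennreal (v ^ snd p) \<partial>K j \<partial>beta_distribution a b)"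
    unfolding eq by (rule nn_integral_bind[OF _ K']) measurable
  also have "\<dots> = (\<integral>\<^sup>+j. nb_pgf v R j \<partial>beta_distribution a b)"
    unfolding K_def nb_pgf_def by (intro nn_integral_cong) (subst nn_integral_distr, auto)
  finally show "(\<integral>\<^sup>+p. ennreal (v ^ snd p) \<partial>beta_neg_binomial a b R) = (\<integral>\<^sup>+j. nb_pgf v R j \<partial>beta_distribution a b)" .
qed

text \<open>On the naturals a law is determined by its generating function;
  \<open>predictive_law\<close> is the image of this one on the reals.\<close>

definition sum_law :: "nat \<Rightarrow> (nat \<Rightarrow> real) \<Rightarrow> real \<Rightarrow> real \<Rightarrow> nat measure" where
  "sum_law N a b R =
     distr (PiM {1..N} (\<lambda>n. beta_neg_binomial (a n) b R)) (count_space UNIV) (\<lambda>p. \<Sum>n=1..N. snd (p n))"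

lemma sets_sum_law [simp, measurable_cong]: "sets (sum_law N a b R) = sets (count_space UNIV)"
  by (simp add: sum_law_def)

lemma sum_law:
  assumes R: "0 < R" and b: "0 < b" and a: "\<And>n. n \<in> {1..N} \<Longrightarrow> 0 < a n"
  shows "prob_space (sum_law N a b R)"
    and "predictive_law N a b R = distr (sum_law N a b R) borel real"
    and "0 \<le> v \<Longrightarrow> (\<integral>\<^sup>+x. ennreal (v ^ x) \<partial>sum_law N a b R) = (\<Prod>n=1..N. \<integral>\<^sup>+j. nb_pgf v R j \<partial>beta_distribution (a n) b)"
proof -
  \<comment> \<open>Outside \<open>{1..N}\<close> nothing is known about a, but the product lemmas
    ask for sigma-finite measures at every index.\<close>
  define a' where "a' n = (if n \<in> {1..N} then a n else 1)" for n
  have a': "0 < a' n" for n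
    using a by (auto simp: a'_def)
  define P where "P = PiM {1..N} (\<lambda>n. beta_neg_binomial (a' n) b R)"
  have P: "PiM {1..N} (\<lambda>n. beta_neg_binomial (a n) b R) = P"
    unfolding P_def by (intro PiM_cong) (auto simp: a'_def)
  note BN = beta_neg_binomial[OF R a' b]
  interpret P: prob_space P
    unfolding P_def by (intro prob_space_PiM BN)
  interpret product_sigma_finite "\<lambda>n. beta_neg_binomial (a' n) b R"
    by (intro product_sigma_finite.intro prob_space_imp_sigma_finite BN)
  have [measurable_cong]: "sets (beta_neg_binomial (a' n) b R) = sets (borel \<Otimes>\<^sub>M count_space UNIV)" for n
    by (rule BN)
  have c [measurable]: "(\<lambda>p. snd (p n)) \<in> measurable P (count_space UNIV)" if "n \<in> {1..N}" for n
    unfolding P_def by (rule measurable_compose[OF measurable_component_singleton[OF that]]) measurable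
  have S: "(\<lambda>p. \<Sum>n=1..N. snd (p n)) \<in> measurable P (count_space UNIV)"
    by (intro measurable_sum_nat c)
  show "prob_space (sum_law N a b R)"
    unfolding sum_law_def P by (rule P.prob_space_distr[OF S])
  show "predictive_law N a b R = distr (sum_law N a b R) borel real"
    unfolding sum_law_def predictive_law_def P by (subst distr_distr[OF _ S]) (auto simp: comp_def)
  assume v: "0 \<le> v"
  have "(\<integral>\<^sup>+x. ennreal (v ^ x) \<partial>sum_law N a b R) = (\<integral>\<^sup>+p. ennreal (v ^ (\<Sum>n=1..N. snd (p n))) \<partial>P)"
    unfolding sum_law_def P by (rule nn_integral_distr[OF S]) simp
  also have "\<dots> = (\<integral>\<^sup>+p. (\<Prod>n=1..N. ennreal (v ^ snd (p n))) \<partial>P)"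
    using v by (simp add: power_sum prod_ennreal)
  also have "\<dots> = (\<Prod>n=1..N. \<integral>\<^sup>+p. ennreal (v ^ snd p) \<partial>beta_neg_binomial (a' n) b R)"
    unfolding P_def by (rule product_nn_integral_prod) auto
  also have "\<dots> = (\<Prod>n=1..N. \<integral>\<^sup>+j. nb_pgf v R j \<partial>beta_distribution (a n) b)"
  proof (rule prod.cong[OF refl])
    fix n assume "n \<in> {1..N}"
    then have "a' n = a n"
      by (simp add: a'_def)
    then show "(\<integral>\<^sup>+p. ennreal (v ^ snd p) \<partial>beta_neg_binomial (a' n) b R) = (\<integral>\<^sup>+j. nb_pgf v R j \<partial>beta_distribution (a n) b)"
      by (subst beta_neg_binomial(3)[OF R a' b]) simp
  qed
  finally show "(\<integral>\<^sup>+x. ennreal (v ^ x) \<partial>sum_law N a b R) = (\<Prod>n=1..N. \<integral>\<^sup>+j. nb_pgf v R j \<partial>beta_distribution (a n) b)" .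
qed

section \<open>Identification of the conditional law\<close>

context nbp_days
begin

lemma emeasure_Z_atom:
  assumes "w \<in> simple_labels" "1 \<le> d"
  shows "measure (Z d w) {\<omega> n w} = real (A d n w)"
proof -
  have wM: "w \<in> space M" and inj: "inj (\<lambda>n. \<omega> n w)"
    using assms by (auto simp: simple_labels_def)
  have "(\<Sum>k. of_nat (A d k w) * indicator {\<omega> n w} (\<omega> k w) :: ennreal) = (\<Sum>k\<in>{n}. of_nat (A d k w) * indicator {\<omega> n w} (\<omega> k w))"
    using injD[OF inj] by (intro suminf_finite) (auto simp: indicator_def)
  then have "emeasure (Z d w) {\<omega> n w} = of_nat (A d n w)"
    using wM assms by (simp add: emeasure_Z singleton_P0)
  then show ?thesis
    by (simp add: measure_def)
qed

text \<open>Measurability is needed on all of \<open>M\<close>, including the null event of coinciding labels, as \<open>M\<close> need not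
  be complete; hence the sum over first occurrences of labels in the proof.\<close>

lemma future_sum_measurable:
  "(\<lambda>w. if finite (observed Z D0 w) then \<Sum>x\<in>observed Z D0 w. \<Sum>d=1..D1. measure (Z (D0 + d) w) {x} else 0)
     \<in> borel_measurable M"
proof -
  \<comment> \<open>The inner sum collects the counts of all units that share the label of unit n,
    which is what \<open>Z\<close> assigns to that label.\<close>
  define H where "H n w = (\<Sum>d=1..D1. enn2real (\<Sum>k. of_nat (A (D0 + d) k w) * (if \<omega> k w = \<omega> n w then 1 else 0)))" for n w
  have H: "H n w = (\<Sum>d=1..D1. measure (Z (D0 + d) w) {\<omega> n w})" if "w \<in> space M" for n w
    unfolding H_def measure_def using that
    by (intro sum.cong refl arg_cong[where f=enn2real]) (simp add: emeasure_Z singleton_P0 indicator_def of_bool_def)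
  have [measurable]: "H n \<in> borel_measurable M" for n
  proof -
    have [measurable]: "A (D0 + d) k \<in> measurable M (count_space UNIV)" for d k
      using D0 by (intro A_measurable) simp
    show ?thesis
      unfolding H_def by measurable
  qed
  have obs_m [measurable]: "Measurable.pred M (\<lambda>w. n \<in> obs w)" for n
  proof -
    have [measurable]: "Measurable.pred M (\<lambda>w. zero_row (row D0 n w))"
      by (rule measurable_compose[OF row_measurable zero_row_measurable]) simp
    have "Measurable.pred M (\<lambda>w. \<not> zero_row (row D0 n w))"
      by measurable
    then show ?thesis
      by (simp add: zero_row_row)
  qed
  define fst_occ where "fst_occ n w \<longleftrightarrow> n \<in> obs w \<and> (\<forall>k<n. k \<in> obs w \<longrightarrow> \<omega> k w \<noteq> \<omega> n w)" for n w
  have [measurable]: "Measurable.pred M (fst_occ n)" for n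
    unfolding fst_occ_def by measurable
  define T where "T w = (\<Sum>n. if fst_occ n w then ennreal (H n w) else 0)" for w
  have [measurable]: "T \<in> borel_measurable M"
    unfolding T_def by measurable
  have fin: "{w \<in> space M. finite (observed Z D0 w)} \<in> sets M"
    using finite_observed_data subalgebra_data by (auto simp: subalgebra_def)
  have "(if finite (observed Z D0 w) then \<Sum>x\<in>observed Z D0 w. \<Sum>d=1..D1. measure (Z (D0 + d) w) {x} else 0) =
        (if w \<in> {w \<in> space M. finite (observed Z D0 w)} then enn2real (T w) else 0)" if w: "w \<in> space M" for w
  proof (cases "finite (observed Z D0 w)")
    case True
    define J where "J = {n. fst_occ n w}"
    have inj: "inj_on (\<lambda>n. \<omega> n w) J"
    proof (rule inj_onI)
      fix i j assume ij: "i \<in> J" "j \<in> J" "\<omega> i w = \<omega> j w"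
      show "i = j"
      proof (rule ccontr)
        assume "i \<noteq> j"
        then consider "i < j" | "j < i" by linarith
        then show False
          using ij by cases (auto simp: J_def fst_occ_def)
      qed
    qed
    have img: "(\<lambda>n. \<omega> n w) ` J = observed Z D0 w"
    proof
      show "(\<lambda>n. \<omega> n w) ` J \<subseteq> observed Z D0 w"
        using w by (auto simp: J_def fst_occ_def observed_eq)
      show "observed Z D0 w \<subseteq> (\<lambda>n. \<omega> n w) ` J"
      proof
        fix x assume "x \<in> observed Z D0 w"
        then obtain n where n: "n \<in> obs w" "x = \<omega> n w"
          using w by (auto simp: observed_eq)
        define n0 where "n0 = (LEAST k. k \<in> obs w \<and> \<omega> k w = x)"
        have n0: "n0 \<in> obs w \<and> \<omega> n0 w = x"
          unfolding n0_def by (rule LeastI[of _ n]) (use n in auto)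
        then have "fst_occ n0 w"
          using not_less_Least[of _ "\<lambda>k. k \<in> obs w \<and> \<omega> k w = x"] by (auto simp: fst_occ_def n0_def[symmetric])
        then show "x \<in> (\<lambda>n. \<omega> n w) ` J"
          using n0 by (auto simp: J_def)
      qed
    qed
    have J: "finite J"
      using True inj img finite_image_iff by metis
    have H0: "0 \<le> H n w" for n
      unfolding H_def by (intro sum_nonneg) auto
    have "T w = (\<Sum>n\<in>J. ennreal (H n w))"
      unfolding T_def by (subst suminf_finite[OF J]) (auto simp: J_def)
    also have "\<dots> = ennreal (\<Sum>n\<in>J. H n w)"
      using H0 by (simp add: sum_ennreal)
    finally have "enn2real (T w) = (\<Sum>n\<in>J. H n w)"
      using H0 by (simp add: sum_nonneg)
    also have "\<dots> = (\<Sum>x\<in>observed Z D0 w. \<Sum>d=1..D1. measure (Z (D0 + d) w) {x})"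
      unfolding img[symmetric] by (simp add: sum.reindex[OF inj] H[OF w])
    finally show ?thesis
      using True w by simp
  qed simp
  then show ?thesis
    using fin by (subst measurable_cong) (auto intro!: measurable_If_set)
qed

text \<open>The enumeration W of the observed labels may be chosen separately at each w, measurably
  or not. So the conditional probabilities \<open>Y s\<close> of the values of the sum are taken
  first, and the predictive law is matched with them pointwise by generating functions.\<close>

lemma real_cond_exp_future_sum:
  fixes N :: "'w \<Rightarrow> nat" and W :: "nat \<Rightarrow> 'w \<Rightarrow> real" and m :: "nat \<Rightarrow> 'w \<Rightarrow> real" and S :: "'w \<Rightarrow> real" and B :: "real set"
  assumes N: "\<And>w. w \<in> space M \<Longrightarrow> N w = card (observed Z D0 w)"
    and W: "\<And>w. w \<in> space M \<Longrightarrow> finite (observed Z D0 w) \<Longrightarrow> bij_betw (\<lambda>n. W n w) {1..N w} (observed Z D0 w)"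
    and m: "\<And>w n. w \<in> space M \<Longrightarrow> m n w = (\<Sum>d=1..D0. measure (Z d w) {W n w})"
    and S: "\<And>w. w \<in> space M \<Longrightarrow> S w = (\<Sum>d=1..D1. \<Sum>n=1..N w. measure (Z (D0 + d) w) {W n w})"
    and B [measurable]: "B \<in> sets borel"
  shows "AE w in M. finite (observed Z D0 w) \<longrightarrow>
           real_cond_exp M data (indicator {v \<in> space M. S v \<in> B}) w =
           measure (predictive_law (N w) (\<lambda>n. m n w - \<sigma>) (r * real D0 + 1) (r * real D1)) B"
proof -
  interpret F: finite_measure_subalgebra M data
    by (intro finite_measure_subalgebra.intro finite_measure_subalgebra_axioms.intro finite_measure_axioms subalgebra_data)
  define E where "E = {w \<in> space M. finite (observed Z D0 w)}"
  have E [measurable]: "E \<in> sets data"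
    unfolding E_def by (rule finite_observed_data)
  have E_M [measurable]: "E \<in> sets M"
    using E subalgebra_data by (auto simp: subalgebra_def)
  have S_sum: "S w = (\<Sum>x\<in>observed Z D0 w. \<Sum>d=1..D1. measure (Z (D0 + d) w) {x})"
    if w: "w \<in> space M" and fin: "finite (observed Z D0 w)" for w
  proof -
    have "S w = (\<Sum>n=1..N w. \<Sum>d=1..D1. measure (Z (D0 + d) w) {W n w})"
      unfolding S[OF w] by (rule sum.swap)
    also have "\<dots> = (\<Sum>x\<in>observed Z D0 w. \<Sum>d=1..D1. measure (Z (D0 + d) w) {x})"
      by (rule sum.reindex_bij_betw[OF W[OF w fin]])
    finally show ?thesis .
  qed
  \<comment> \<open>If infinitely many labels are observed, \<open>card\<close> is 0 and the sum
    defining S is empty, in agreement with the default value 0.\<close>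
  have [measurable]: "S \<in> borel_measurable M"
  proof (rule measurable_cong[THEN iffD2, OF _ future_sum_measurable])
    fix w assume w: "w \<in> space M"
    show "S w = (if finite (observed Z D0 w) then \<Sum>x\<in>observed Z D0 w. \<Sum>d=1..D1. measure (Z (D0 + d) w) {x} else 0)"
      using S_sum[OF w] S[OF w] N[OF w] by auto
  qed
  define k where "k w = (\<Sum>n\<in>obs w. \<Sum>d\<in>{D0<..D0 + D1}. A d n w)" for w
  have good: "finite (obs w)" "S w = real (k w)" "0 \<le> v \<Longrightarrow> v \<le> 1 \<Longrightarrow> real_pgf v w = ennreal (v ^ k w)"
    if w: "w \<in> simple_labels" and wE: "w \<in> E" for w v
  proof -
    have wM: "w \<in> space M" and inj: "inj (\<lambda>n. \<omega> n w)"
      using w by (auto simp: simple_labels_def)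
    show fin: "finite (obs w)"
      using wE obs_finite_iff[OF w] by (simp add: E_def)
    have "S w = (\<Sum>n\<in>obs w. \<Sum>d=1..D1. real (A (D0 + d) n w))"
      using wE wM inj by (subst S_sum)
        (auto simp: E_def observed_eq sum.reindex inj_on_subset emeasure_Z_atom[OF w] D0 intro!: sum.cong)
    also have "\<dots> = real (k w)"
    proof -
      have "(\<Sum>d=1..D1. A (D0 + d) n w) = (\<Sum>d\<in>{D0<..D0 + D1}. A d n w)" for n
        by (rule sum.reindex_bij_witness[of _ "\<lambda>d. d - D0" "\<lambda>d. D0 + d"]) auto
      then show ?thesis
        by (simp add: k_def flip: of_nat_sum)
    qed
    finally show "S w = real (k w)" .
    show "real_pgf v w = ennreal (v ^ k w)" if "0 \<le> v" "v \<le> 1"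
      unfolding k_def by (rule real_pgf_finite[OF wM fin that])
  qed
  \<comment> \<open>On E the sum is almost surely a natural number, so up to a null set these events
    partition E.\<close>
  define ind :: "nat \<Rightarrow> 'w \<Rightarrow> ennreal" where "ind s = indicator (E \<inter> {w \<in> space M. S w = real s})" for s
  have [measurable]: "ind s \<in> borel_measurable M" for s
    unfolding ind_def by measurable
  define Y where "Y s = nn_cond_exp M data (ind s)" for s
  have Y_M [measurable]: "Y s \<in> borel_measurable M" and Y_F [measurable]: "Y s \<in> borel_measurable data" for s
    unfolding Y_def by measurable
  have ind_sum: "(\<Sum>s. ind s w * q s) = indicator E w * q (k w)" if w: "w \<in> simple_labels" for w and q :: "nat \<Rightarrow> ennreal"
  proof (cases "w \<in> E")
    case True
    have "w \<in> space M"
      using w by (simp add: simple_labels_def)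
    then have "w \<in> E \<inter> {w \<in> space M. S w = real (k w)}"
      using True good(2)[OF w True] by blast
    then have "ind (k w) w = 1"
      by (simp add: ind_def)
    have "ind s w = 0" if "s \<noteq> k w" for s
      using good(2)[OF w True] that by (simp add: ind_def)
    then have "(\<Sum>s. ind s w * q s) = (\<Sum>s\<in>{k w}. ind s w * q s)"
      by (intro suminf_finite) auto
    also have "\<dots> = indicator E w * q (k w)"
      using \<open>ind (k w) w = 1\<close> True by simp
    finally show ?thesis .
  qed (simp add: ind_def)
  have AE_simple: "AE w in M. w \<in> simple_labels"
    using AE_inj_omega AE_space by eventually_elim (simp add: simple_labels_def)
  \<comment> \<open>Conditional expectation commutes with countable nonnegative combinations. The
    weights \<open>v ^ s\<close> give the generating function, the indicators of B the final
    probability.\<close>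
  have Y_sum: "AE w in M. (\<Sum>s. Y s w * q s) = nn_cond_exp M data (\<lambda>w. \<Sum>s. ind s w * q s) w" for q :: "nat \<Rightarrow> ennreal"
  proof (rule F.nn_cond_exp_charact)
    fix C assume C [measurable]: "C \<in> sets data"
    then have [measurable]: "C \<in> sets M"
      using subalgebra_data by (auto simp: subalgebra_def)
    have "(\<integral>\<^sup>+w\<in>C. (\<Sum>s. ind s w * q s) \<partial>M) = (\<integral>\<^sup>+w. (\<Sum>s. indicator C w * ind s w * q s) \<partial>M)"
      by (intro nn_integral_cong) (simp add: mult.assoc mult.commute[of _ "indicator C _"])
    also have "\<dots> = (\<Sum>s. \<integral>\<^sup>+w. indicator C w * ind s w * q s \<partial>M)"
      by (rule nn_integral_suminf) measurable
    also have "\<dots> = (\<Sum>s. \<integral>\<^sup>+w. indicator C w * Y s w * q s \<partial>M)"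
    proof (rule suminf_cong)
      fix s
      have "(\<integral>\<^sup>+w. indicator C w * Y s w \<partial>M) = (\<integral>\<^sup>+w. indicator C w * ind s w \<partial>M)"
        unfolding Y_def by (rule F.nn_cond_exp_intg) measurable
      then show "(\<integral>\<^sup>+w. indicator C w * ind s w * q s \<partial>M) = (\<integral>\<^sup>+w. indicator C w * Y s w * q s \<partial>M)"
        by (simp add: nn_integral_multc)
    qed
    also have "\<dots> = (\<integral>\<^sup>+w. (\<Sum>s. indicator C w * Y s w * q s) \<partial>M)"
      by (rule nn_integral_suminf[symmetric]) measurable
    also have "\<dots> = (\<integral>\<^sup>+w\<in>C. (\<Sum>s. Y s w * q s) \<partial>M)"
      by (intro nn_integral_cong) (simp add: mult.assoc mult.commute[of _ "indicator C _"])
    finally show "(\<integral>\<^sup>+w\<in>C. (\<Sum>s. ind s w * q s) \<partial>M) = (\<integral>\<^sup>+w\<in>C. (\<Sum>s. Y s w * q s) \<partial>M)" .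
  qed measurable
  have pgf: "AE w in M. (\<Sum>s. Y s w * ennreal (v ^ s)) = indicator E w * data_pgf v w" if v: "0 \<le> v" "v \<le> 1" for v
  proof -
    \<comment> \<open>Integrals over a data event C only see \<open>C \<inter> E\<close>, again a
      data event; there the actual generating function may be exchanged for the predictive
      one.\<close>
    have "AE w in M. indicator E w * data_pgf v w = nn_cond_exp M data (\<lambda>w. \<Sum>s. ind s w * ennreal (v ^ s)) w"
    proof (rule F.nn_cond_exp_charact)
      fix C assume C [measurable]: "C \<in> sets data"
      have "(\<integral>\<^sup>+w\<in>C. (\<Sum>s. ind s w * ennreal (v ^ s)) \<partial>M) = (\<integral>\<^sup>+w. indicator (C \<inter> E) w * real_pgf v w \<partial>M)"
      proof (rule nn_integral_cong_AE)
        show "AE w in M. (\<Sum>s. ind s w * ennreal (v ^ s)) * indicator C w = indicator (C \<inter> E) w * real_pgf v w"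
          using AE_simple
        proof eventually_elim
          case (elim w)
          then show ?case
            using good(3)[OF elim _ v] by (simp add: ind_sum) (auto simp: indicator_def)
        qed
      qed
      also have "\<dots> = (\<integral>\<^sup>+w. indicator (C \<inter> E) w * pred_pgf v w \<partial>M)"
        by (rule data_algebra_eq[OF _ v]) measurable
      also have "\<dots> = (\<integral>\<^sup>+w\<in>C. (indicator E w * data_pgf v w) \<partial>M)"
      proof (rule nn_integral_cong_AE)
        show "AE w in M. indicator (C \<inter> E) w * pred_pgf v w = indicator E w * data_pgf v w * indicator C w"
          using AE_simple
        proof eventually_elim
          case (elim w)
          then show ?case
            using data_pgf_eq[OF elim good(1)[OF elim] v] by (auto simp: indicator_def)
        qed
      qed
      finally show "(\<integral>\<^sup>+w\<in>C. (\<Sum>s. ind s w * ennreal (v ^ s)) \<partial>M) = (\<integral>\<^sup>+w\<in>C. (indicator E w * data_pgf v w) \<partial>M)" .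
    qed measurable
    with Y_sum[of "\<lambda>s. ennreal (v ^ s)"] show ?thesis
      by eventually_elim simp
  qed
  define law where "law w = sum_law (N w) (\<lambda>n. m n w - \<sigma>) (r * real D0 + 1) (r * real D1)" for w
  have b0: "0 < r * real D0 + 1"
    using r by (simp add: add_nonneg_pos)
  have law_props: "prob_space (law w)"
      "predictive_law (N w) (\<lambda>n. m n w - \<sigma>) (r * real D0 + 1) (r * real D1) = distr (law w) borel real"
      "0 \<le> v \<Longrightarrow> v \<le> 1 \<Longrightarrow> (\<Sum>s. emeasure (law w) {s} * ennreal (v ^ s)) = pred_pgf v w"
    if w: "w \<in> simple_labels" and wE: "w \<in> E" for w v
  proof -
    have wM: "w \<in> space M" and inj: "inj (\<lambda>n. \<omega> n w)"
      using w by (auto simp: simple_labels_def)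
    have fin: "finite (observed Z D0 w)"
      using wE by (simp add: E_def)
    define c where "c x = (\<Sum>d=1..D0. measure (Z d w) {x})" for x
    have c: "c (\<omega> n w) = real (total (row D0 n w))" for n
      by (simp add: c_def emeasure_Z_atom[OF w] total_def row_def)
    have mc: "m n w = c (W n w)" for n
      by (simp add: m[OF wM] c_def)
    have pos: "0 < m n w - \<sigma>" if n: "n \<in> {1..N w}" for n
    proof -
      have "W n w \<in> observed Z D0 w"
        using W[OF wM fin] n by (auto simp: bij_betw_def)
      then obtain j where j: "j \<in> obs w" "W n w = \<omega> j w"
        using wM by (auto simp: observed_eq)
      then have "1 \<le> total (row D0 j w)"
        using total_pos[of "row D0 j w"] by (simp add: zero_row_row)
      then show ?thesis
        using \<sigma> j by (simp add: mc c)
    qed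
    show "prob_space (law w)"
      unfolding law_def by (intro sum_law rD1 b0 pos)
    show "predictive_law (N w) (\<lambda>n. m n w - \<sigma>) (r * real D0 + 1) (r * real D1) = distr (law w) borel real"
      unfolding law_def by (intro sum_law rD1 b0 pos)
    assume v: "0 \<le> v" "v \<le> 1"
    have "(\<Sum>s. emeasure (law w) {s} * ennreal (v ^ s)) = (\<integral>\<^sup>+x. ennreal (v ^ x) \<partial>law w)"
      by (rule nn_integral_nat_sum[symmetric]) (simp add: law_def)
    also have "\<dots> = (\<Prod>n=1..N w. \<integral>\<^sup>+j. nb_pgf v (r * real D1) j \<partial>beta_distribution (c (W n w) - \<sigma>) (r * real D0 + 1))"
      unfolding law_def mc[symmetric] by (intro sum_law rD1 b0 pos v)
    \<comment> \<open>The product becomes one over labels and then over units, so the choice of the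
      enumeration W disappears.\<close>
    also have "\<dots> = (\<Prod>x\<in>observed Z D0 w. \<integral>\<^sup>+j. nb_pgf v (r * real D1) j \<partial>beta_distribution (c x - \<sigma>) (r * real D0 + 1))"
      by (rule prod.reindex_bij_betw[OF W[OF wM fin]])
    also have "\<dots> = (\<Prod>n\<in>obs w. future_pgf v (total (row D0 n w)))"
      using inj by (simp add: observed_eq[OF wM] prod.reindex inj_on_subset c future_pgf_def future_law_def)
    also have "\<dots> = pred_pgf v w"
      by (rule pred_pgf_finite[OF wM good(1)[OF w wE] v, symmetric])
    finally show "(\<Sum>s. emeasure (law w) {s} * ennreal (v ^ s)) = pred_pgf v w" .
  qed
  \<comment> \<open>The exceptional null set depends on v, so only the countable family v = 1 / (j +
    2) is used simultaneously.\<close>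
  have "AE w in M. \<forall>j::nat. (\<Sum>s. Y s w * ennreal ((1 / real (j + 2)) ^ s)) = indicator E w * data_pgf (1 / real (j + 2)) w"
    unfolding AE_all_countable by (intro allI pgf) auto
  then have Y_law: "AE w in M. w \<in> E \<longrightarrow> (\<forall>s. Y s w = emeasure (law w) {s})"
    using AE_simple
  proof eventually_elim
    case (elim w)
    show ?case
    proof (intro impI allI)
      fix s assume wE: "w \<in> E"
      have *: "(\<Sum>s. Y s w * ennreal ((1 / real j) ^ s)) = pred_pgf (1 / real j) w" if j: "2 \<le> j" for j
      proof -
        have "(\<Sum>s. Y s w * ennreal ((1 / real j) ^ s)) = data_pgf (1 / real j) w"
          using elim(1)[rule_format, of "j - 2"] wE j by simp
        also have "\<dots> = pred_pgf (1 / real j) w"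
          by (rule data_pgf_eq[OF elim(2) good(1)[OF elim(2) wE]]) (use j in auto)
        finally show ?thesis .
      qed
      show "Y s w = emeasure (law w) {s}"
      proof (rule ennreal_power_series_unique)
        fix j :: nat assume j: "2 \<le> j"
        show "(\<Sum>s. Y s w * ennreal ((1 / real j) ^ s)) = (\<Sum>s. emeasure (law w) {s} * ennreal ((1 / real j) ^ s))"
          using j by (simp only: *[OF j]) (subst law_props(3)[OF elim(2) wE], auto)
      next
        have "(\<Sum>s. Y s w * ennreal ((1 / 2) ^ s)) = pred_pgf (1 / 2) w"
          using *[of 2] by simp
        also have "\<dots> \<le> 1"
          by (rule pgf_le_1) auto
        finally show "(\<Sum>s. Y s w * ennreal ((1 / 2) ^ s)) < top"
          by (rule le_less_trans) simp
      qed
    qed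
  qed
  define SB where "SB = {v \<in> space M. S v \<in> B}"
  have [measurable]: "SB \<in> sets M"
    unfolding SB_def by measurable
  \<comment> \<open>E is a data event, so its indicator passes through the conditional expectation;
    on E the event splits according to the values of the sum.\<close>
  have c1: "AE w in M. indicator E w * nn_cond_exp M data (indicator SB) w = nn_cond_exp M data (\<lambda>w. indicator E w * indicator SB w) w"
    by (rule F.nn_cond_exp_prod) measurable
  have c2: "AE w in M. nn_cond_exp M data (\<lambda>w. indicator E w * indicator SB w) w =
                       nn_cond_exp M data (\<lambda>w. \<Sum>s. ind s w * indicator B (real s)) w"
  proof (rule F.nn_cond_exp_cong)
    show "AE w in M. indicator E w * indicator SB w = (\<Sum>s. ind s w * indicator B (real s) :: ennreal)"
      using AE_simple
    proof eventually_elim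
      case (elim w)
      then have "w \<in> space M"
        by (simp add: simple_labels_def)
      then show ?case
        using good(2)[OF elim] by (simp add: ind_sum[OF elim] SB_def indicator_def)
    qed
  qed measurable
  \<comment> \<open>\<open>real_cond_exp\<close> subtracts the conditional expectation of the
    negative part, which is zero for an indicator.\<close>
  have c3: "AE w in M. (0::ennreal) = nn_cond_exp M data (\<lambda>w. 0) w"
    by (rule F.nn_cond_exp_F_meas) simp
  show ?thesis
    using c1 c2 c3 Y_sum[of "\<lambda>s. indicator B (real s)"] Y_law AE_simple
  proof eventually_elim
    case (elim w)
    show ?case
    proof
      assume fin: "finite (observed Z D0 w)"
      have wE: "w \<in> E"
        using fin elim(6) by (auto simp: E_def simple_labels_def)
      interpret law: prob_space "law w"
        by (rule law_props[OF elim(6) wE])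
      have "nn_cond_exp M data (indicator SB) w = (\<Sum>s. emeasure (law w) {s} * indicator B (real s))"
        using elim wE by simp
      also have "\<dots> = (\<integral>\<^sup>+x. indicator B (real x) \<partial>law w)"
        by (rule nn_integral_nat_sum[symmetric]) (simp add: law_def)
      also have "\<dots> = (\<integral>\<^sup>+x. indicator (real -` B) x \<partial>law w)"
        by (simp add: indicator_def)
      also have "\<dots> = emeasure (law w) (real -` B)"
        by (rule nn_integral_indicator) (simp add: law_def)
      finally have 1: "nn_cond_exp M data (indicator SB) w = emeasure (law w) (real -` B)" .
      have "measure (predictive_law (N w) (\<lambda>n. m n w - \<sigma>) (r * real D0 + 1) (r * real D1)) B = measure (law w) (real -` B)"
        unfolding law_props(2)[OF elim(6) wE]
        by (subst measure_distr) (auto simp: law_def sets_eq_imp_space_eq[OF sets_sum_law] measurable_cong_sets[OF sets_sum_law refl])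
      moreover have "(\<lambda>x. ennreal (indicator SB x)) = indicator SB" "(\<lambda>x. ennreal (- indicator SB x)) = (\<lambda>_. 0)"
        by (auto simp: indicator_def ennreal_neg)
      ultimately show "real_cond_exp M data (indicator {v \<in> space M. S v \<in> B}) w =
           measure (predictive_law (N w) (\<lambda>n. m n w - \<sigma>) (r * real D0 + 1) (r * real D1)) B"
        unfolding real_cond_exp_def SB_def[symmetric]
        using elim(3) by (simp add: 1 measure_def)
    qed
  qed
qed

end

theorem corollary7:
  fixes M :: "'w measure"
    and \<sigma> \<beta> c r :: real
    and \<theta> \<omega> :: "nat \<Rightarrow> 'w \<Rightarrow> real" and \<Theta> :: "'w \<Rightarrow> real measure"
    and A :: "nat \<Rightarrow> nat \<Rightarrow> 'w \<Rightarrow> nat" and Z :: "nat \<Rightarrow> 'w \<Rightarrow> real measure"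
    and D0 D1 :: nat
    and N :: "'w \<Rightarrow> nat" and W :: "nat \<Rightarrow> 'w \<Rightarrow> real"
    and m :: "nat \<Rightarrow> 'w \<Rightarrow> real" and S :: "'w \<Rightarrow> real"
    and B :: "real set"
  assumes "prob_space M"
    and "0 < \<sigma>" "\<sigma> < 1" "0 < \<beta>" "0 < c" "0 < r"
    and "SBSP M \<beta> \<sigma> c \<theta> \<omega> \<Theta>"
    and "iid_NBP M r \<theta> \<omega> \<Theta> A Z"
    and "1 \<le> D0" "1 \<le> D1"
    and N: "\<And>w. w \<in> space M \<Longrightarrow> N w = card (observed Z D0 w)"
    and W: "\<And>w. w \<in> space M \<Longrightarrow> finite (observed Z D0 w) \<Longrightarrow>
              bij_betw (\<lambda>n. W n w) {1..N w} (observed Z D0 w)"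
    and m: "\<And>w n. w \<in> space M \<Longrightarrow> m n w = (\<Sum>d=1..D0. measure (Z d w) {W n w})"
    and S: "\<And>w. w \<in> space M \<Longrightarrow>
              S w = (\<Sum>d=1..D1. \<Sum>n=1..N w. measure (Z (D0 + d) w) {W n w})"
    and "B \<in> sets borel"
  shows "AE w in M. finite (observed Z D0 w) \<and> 0 < N w \<longrightarrow>
           real_cond_exp M (data_algebra M Z D0) (indicator {v \<in> space M. S v \<in> B}) w =
           measure (predictive_law (N w) (\<lambda>n. m n w - \<sigma>) (r * real D0 + 1) (r * real D1)) B"
proof -
  interpret nbp_days M \<sigma> \<beta> c r \<theta> \<omega> \<Theta> A Z D0 D1
    by (intro nbp_days.intro nbp_model.intro nbp_model_axioms.intro nbp_days_axioms.intro assms)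
  have "AE w in M. finite (observed Z D0 w) \<longrightarrow>
           real_cond_exp M (data_algebra M Z D0) (indicator {v \<in> space M. S v \<in> B}) w =
           measure (predictive_law (N w) (\<lambda>n. m n w - \<sigma>) (r * real D0 + 1) (r * real D1)) B"
    by (rule real_cond_exp_future_sum; fact)
  then show ?thesis
    by eventually_elim auto
qed

end
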